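(* Let $D$ be a diagram of a spatial $\mathbb K_4$-graph $\Omega$ with twist parameters $n_1,\dots,n_6$, let $L=D^{(2)}$ be its band diagram, and let $\mathcal L_\Omega=L(n_1,\dots,n_6)$ be the associated link of $\Omega$. Put $\varphi=A^2+A^{-2}$ and $y_i=(-A^{-4})^{n_i}$. Then $$\begin{aligned}V(\mathcal L_\Omega)=(-A^4)^{n_1+\cdots+n_6}\Big\{&\langle L\rangle+\sum_{i=1}^6\frac{1-y_i}{\varphi}\langle\Theta_i^{(2)}\rangle\\ &+\frac1{\varphi^2}\Big[\langle l_{126}^{(2)}\rangle(2-y_3-y_4-y_5+y_3y_4y_5)+\langle l_{234}^{(2)}\rangle(2-y_1-y_5-y_6+y_1y_5y_6)\\ &\quad+\langle l_{135}^{(2)}\rangle(2-y_2-y_4-y_6+y_2y_4y_6)+\langle l_{456}^{(2)}\rangle(2-y_1-y_2-y_3+y_1y_2y_3)\\ &\quad+\langle l_{1245}^{(2)}\rangle(1-y_3-y_6+y_3y_6)+\langle l_{1346}^{(2)}\rangle(1-y_2-y_5+y_2y_5)+\langle l_{2356}^{(2)}\rangle(1-y_1-y_4+y_1y_4)\Big]\\ &+\frac1{\varphi^3}\Big[6-2\sum_{i=1}^6y_i+\sum_{i=1}^3y_iy_{i+3}+y_3y_4y_5+y_2y_4y_6+y_1y_5y_6+y_1y_2y_3-y_1y_2y_3y_4y_5y_6\Big]\Big\}.\end{aligned}$$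
   Context: Everything is piecewise linear. A spatial $\mathbb K_4$-graph is an embedding in $S^3$ of the complete graph $\mathbb K_4$; a diagram is a regular projection with over/under information. The sign of a crossing of oriented arcs is the usual one (right-handed crossings are $+1$). Edge labels. $\mathbb K_4$ has vertices $c,v_1,v_2,v_3$; its edges are oriented and labelled: $a_i$ from $c$ to $v_i$ ($i=1,2,3$), $a_6$ from $v_1$ to $v_2$, $a_4$ from $v_2$ to $v_3$, $a_5$ from $v_3$ to $v_1$. Twist parameters. For a diagram $D$ of $\Omega$ let $w_{ij}$ be the sum of the signs of all crossings between $a_i$ and $a_j$ ($i=j$ allowed: self-crossings). The twist parameters of $D$ are $n_1=-2w_{11}-w_{23}-w_{25}+w_{12}+w_{13}+w_{15}+w_{36}-w_{16}+w_{56}$, $n_2=-2w_{22}-w_{24}+w_{14}+w_{46}+w_{23}-w_{13}-w_{36}+w_{12}+w_{26}$, $n_3=-2w_{33}+w_{34}-w_{14}+w_{45}+w_{23}+w_{25}-w_{12}+w_{13}-w_{35}$, $n_4=-2w_{44}-w_{24}+w_{34}-w_{46}+w_{36}-w_{26}-w_{45}-w_{25}+w_{35}$, $n_5=-2w_{55}-w_{35}+w_{15}-w_{36}+w_{16}-w_{56}-w_{34}+w_{14}-w_{45}$, $n_6=-2w_{66}-w_{16}+w_{26}+w_{25}-w_{15}-w_{56}+w_{24}-w_{14}-w_{46}$. Band diagrams. The band diagram of a spatial graph diagram is the boundary of the surface obtained by replacing each vertex by a flat disk and each edge by a flat band parallel to the projection plane (each crossing gives four crossings). $\Theta_i^{(2)}$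 is the band diagram of the sub-diagram of $D$ obtained by deleting the edge $a_i$. $l_{ijk}^{(2)}$, $l_{ijkl}^{(2)}$ are the band diagrams (2-parallels) of the sub-diagrams of $D$ formed by the cycles with edges $\{a_i,a_j,a_k\}$, $\{a_i,a_j,a_k,a_l\}$. Associated link. $L(n_1,\dots,n_6)$ is obtained from $L$ by inserting $n_i$ half twists in the band of $a_i$, $i=1,\ldots,6$, where a positive half twist is one whose crossing has sign $-1$ when the two sides of the band are oppositely oriented. It is the boundary of the band surface with spine $\Omega$ and zero Seifert form (unique up to ambient isotopy), oriented as its boundary, so that the two sides of each band are oppositely directed. Bracket and Jones polynomial. View a crossing so that its overstrand joins SW to NE. Let $D_+$ be the smoothing joining NW with SW and NE with SE, and $D_-$ the smoothing joining NW with NE and SW with SE. The Kauffman bracket of unoriented link diagrams satisfies $\langle D\rangle=A\langle D_+\rangle+A^{-1}\langle D_-\rangle$, $\langle D\sqcup\mathbf 0\rangle=(-A^2-A^{-2})\langle D\rangle$, $\langle\mathbf 0\rangle=1$, where $\mathbf 0$ is the crossingless unknot. For an oriented link with diagram $D$ of writhe $w$ (sum of crossing signs), $V=(-A^3)^{-w}\langle D\rangle$ (the Jones polynomial in the variable $A$, $A=t^{-1/4}$). *)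

theory Defs
  imports "HOL-Analysis.Analysis" "HOL-Computational_Algebra.Fraction_Field"
    "HOL-Computational_Algebra.Polynomial"
begin

section \<open>Unoriented link diagrams and the Kauffman bracket\<close>

text \<open>
  The indeterminate \<open>A\<close>, as an element of the field of rational functions, which contains
  \<open>\<int>[A, A\<^sup>-\<^sup>1]\<close>.
\<close>

definition \<A> :: "int poly fract" where
  "\<A> = Fract [:0, 1:] 1"

text \<open>
  Link diagrams are given by planar-diagram codes. The diagram is cut into finitely many arcs, each
  with a label. A crossing \<open>(a, b, c, d)\<close> lists the four arcs meeting there counterclockwise,
  starting with one of the two ends of the \<^emph>\<open>overstrand\<close>; so the overstrand runs
  between \<open>a\<close> and \<open>c\<close>, and \<open>(a, b, c, d)\<close> stands for the positions (SW, SE, NE, NW). A join \<open>(p, q)\<close>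
  says that the arcs \<open>p\<close> and \<open>q\<close> are glued end to end without a crossing. Each label is used
  exactly twice in the crossings and joins together.
\<close>

type_synonym 'p crossing = "'p \<times> 'p \<times> 'p \<times> 'p"

record 'p link_diagram =
  labels :: "'p set"
  crossings :: "'p crossing set"
  joins :: "('p \<times> 'p) set"

fun plus_smoothing :: "'p crossing \<Rightarrow> ('p \<times> 'p) set" where
  "plus_smoothing (SW, SE, NE, NW) = {(NW, SW), (NE, SE)}"

fun minus_smoothing :: "'p crossing \<Rightarrow> ('p \<times> 'p) set" where
  "minus_smoothing (SW, SE, NE, NW) = {(NW, NE), (SW, SE)}"

definition smooth_plus :: "'p link_diagram \<Rightarrow> 'p crossing \<Rightarrow> 'p link_diagram" where
  "smooth_plus D x = D\<lparr>crossings := crossings D - {x}, joins := joins D \<union> plus_smoothing x\<rparr>"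

definition smooth_minus :: "'p link_diagram \<Rightarrow> 'p crossing \<Rightarrow> 'p link_diagram" where
  "smooth_minus D x = D\<lparr>crossings := crossings D - {x}, joins := joins D \<union> minus_smoothing x\<rparr>"

definition components :: "'p set \<Rightarrow> ('p \<times> 'p) set \<Rightarrow> 'p set set" where
  "components P J = P // {(p, q). p \<in> P \<and> q \<in> P \<and> (p, q) \<in> (J \<union> J\<inverse>)\<^sup>*}"

text \<open>
  The bracket as a state sum; the state \<open>S\<close> is the set of crossings smoothed positively. The lemmas
  \<open>bracket_skein\<close>, \<open>bracket_disjoint_circle\<close> and \<open>bracket_unknot\<close> below are the relations
  that determine it.
\<close>

definition state_circles :: "'p link_diagram \<Rightarrow> 'p crossing set \<Rightarrow> nat" where
  "state_circles D S = card (components (labels D)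
     (joins D \<union> (\<Union>x\<in>S. plus_smoothing x) \<union> (\<Union>x\<in>crossings D - S. minus_smoothing x)))"

definition bracket :: "'p link_diagram \<Rightarrow> int poly fract" where
  "bracket D = (\<Sum>S\<in>Pow (crossings D).
     \<A> powi (int (card S) - int (card (crossings D - S))) *
     (- \<A>\<^sup>2 - \<A> powi (-2)) powi (int (state_circles D S) - 1))"

lemma A_nonzero: "\<A> \<noteq> 0"
  by (simp add: \<A>_def Zero_fract_def eq_fract)

lemma delta_nonzero: "- \<A>\<^sup>2 - \<A> powi (-2) \<noteq> 0"
proof
  assume "- \<A>\<^sup>2 - \<A> powi (-2) = 0"
  then have "\<A> ^ 2 * \<A> ^ 2 + 1 = 0"
    using A_nonzero by (simp add: power_int_minus field_simps)
  moreover have "\<A> ^ 2 * \<A> ^ 2 + 1 = Fract ([:0, 1:] ^ 4 + 1) 1"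
    by (simp add: \<A>_def One_fract_def power2_eq_square power4_eq_xxxx)
  ultimately have "([:0, 1:] ^ 4 + 1 :: int poly) = 0"
    by (simp add: Zero_fract_def eq_fract)
  then have "poly ([:0, 1:] ^ 4 + 1 :: int poly) 0 = poly 0 0" by simp
  then show False by simp
qed

theorem bracket_skein:
  assumes "finite (crossings D)" and x: "x \<in> crossings D"
  shows "bracket D = \<A> * bracket (smooth_plus D x) + \<A> powi (-1) * bracket (smooth_minus D x)"
proof -
  define X where "X = crossings D - {x}"
  have X: "crossings D = insert x X" "x \<notin> X" "finite X" using assms by (auto simp: X_def)
  define f where "f D S = \<A> powi (int (card S) - int (card (crossings D - S))) *
     (- \<A>\<^sup>2 - \<A> powi (-2)) powi (int (state_circles D S) - 1)" for D :: "'a link_diagram" and S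
  have br: "bracket D = sum (f D) (Pow (crossings D))" for D :: "'a link_diagram"
    by (simp add: bracket_def f_def)
  have p: "f D (insert x S) = \<A> * f (smooth_plus D x) S" if "S \<subseteq> X" for S
  proof -
    have S: "finite S" "x \<notin> S" using that X finite_subset by auto
    have e: "insert x X - insert x S = X - S" using X S by auto
    have "state_circles D (insert x S) = state_circles (smooth_plus D x) S"
      using X S e by (simp add: state_circles_def smooth_plus_def Un_assoc)
    moreover have "\<A> powi (int (Suc (card S)) - int (card (X - S))) =
        \<A> * \<A> powi (int (card S) - int (card (X - S)))"
    proof -
      have "int (Suc (card S)) - int (card (X - S)) = 1 + (int (card S) - int (card (X - S)))" by simp
      then show ?thesis using A_nonzero power_int_add[of \<A> 1] by (simp only: power_int_1_right) simp
    qed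
    ultimately show ?thesis
      using X S e by (simp add: f_def smooth_plus_def del: of_nat_Suc)
  qed
  have m: "f D S = \<A> powi (-1) * f (smooth_minus D x) S" if "S \<subseteq> X" for S
  proof -
    have S: "finite S" "x \<notin> S" using that X finite_subset by auto
    have e: "insert x X - S = insert x (X - S)" using X S by auto
    have "state_circles D S = state_circles (smooth_minus D x) S"
      using X S e by (simp add: state_circles_def smooth_minus_def Un_ac)
    moreover have "\<A> powi (int (card S) - int (Suc (card (X - S)))) =
        \<A> powi (-1) * \<A> powi (int (card S) - int (card (X - S)))"
    proof -
      have "int (card S) - int (Suc (card (X - S))) = -1 + (int (card S) - int (card (X - S)))" by simp
      then show ?thesis using A_nonzero power_int_add[of \<A> "-1"] by metis
    qed
    ultimately show ?thesis
      using X S e by (simp add: f_def smooth_minus_def del: of_nat_Suc)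
  qed
  have "bracket D = sum (f D) (Pow X \<union> insert x ` Pow X)"
    by (simp add: br X Pow_insert)
  also have "\<dots> = sum (f D) (Pow X) + sum (f D) (insert x ` Pow X)"
    using X by (intro sum.union_disjoint) auto
  also have "sum (f D) (insert x ` Pow X) = (\<Sum>S\<in>Pow X. f D (insert x S))"
    using X by (subst sum.reindex) (auto simp: inj_on_def)
  also have "\<dots> = \<A> * bracket (smooth_plus D x)"
    using X by (simp add: br sum_distrib_left smooth_plus_def p[unfolded smooth_plus_def])
  also have "sum (f D) (Pow X) = \<A> powi (-1) * bracket (smooth_minus D x)"
    unfolding br sum_distrib_left using X m by (intro sum.cong) (auto simp: smooth_minus_def)
  finally show ?thesis by (simp add: add.commute)
qed

lemma rtrancl_in_component:
  assumes "(p, q) \<in> (J \<union> K)\<^sup>*" "p \<in> P" "J \<subseteq> P \<times> P" "K \<subseteq> Q \<times> Q" "P \<inter> Q = {}"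
  shows "q \<in> P \<and> (p, q) \<in> J\<^sup>*"
  using assms(1)
proof induction
  case (step q r)
  then have "(q, r) \<in> J" using assms by auto
  then show ?case using step assms by (auto intro: rtrancl_into_rtrancl)
qed (use assms in auto)

lemma components_disjoint_union:
  assumes "J \<subseteq> P \<times> P" "K \<subseteq> Q \<times> Q" "P \<inter> Q = {}"
  shows "components (P \<union> Q) (J \<union> K) = components P J \<union> components Q K"
proof -
  let ?R = "\<lambda>P J. {(p, q). p \<in> P \<and> q \<in> P \<and> (p, q) \<in> (J \<union> J\<inverse>)\<^sup>*}"
  have e: "(J \<union> K) \<union> (J \<union> K)\<inverse> = (J \<union> J\<inverse>) \<union> (K \<union> K\<inverse>)" by auto
  have 1: "J \<union> J\<inverse> \<subseteq> P \<times> P" "K \<union> K\<inverse> \<subseteq> Q \<times> Q" using assms by auto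
  have mono: "(J \<union> J\<inverse>)\<^sup>* \<subseteq> ((J \<union> J\<inverse>) \<union> (K \<union> K\<inverse>))\<^sup>*" "(K \<union> K\<inverse>)\<^sup>* \<subseteq> ((J \<union> J\<inverse>) \<union> (K \<union> K\<inverse>))\<^sup>*"
    by (intro rtrancl_mono; auto)+
  have a: "?R (P \<union> Q) (J \<union> K) `` {p} = ?R P J `` {p}" if "p \<in> P" for p
    unfolding e using rtrancl_in_component[OF _ that 1 assms(3)] mono that assms(3) by auto
  have b: "?R (P \<union> Q) (J \<union> K) `` {p} = ?R Q K `` {p}" if "p \<in> Q" for p
    unfolding e
    using rtrancl_in_component[OF _ that 1(2) 1(1)] mono that assms(3)
    by (auto simp: Un_commute Int_commute)
  show ?thesis
    unfolding components_def quotient_def using a b by auto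
qed

definition link_arcs_valid :: "'p link_diagram \<Rightarrow> bool" where
  "link_arcs_valid D \<longleftrightarrow> finite (labels D) \<and> joins D \<subseteq> labels D \<times> labels D \<and>
     crossings D \<subseteq> labels D \<times> labels D \<times> labels D \<times> labels D"

theorem bracket_disjoint_circle:
  assumes D: "link_arcs_valid D"
    and Q: "labels D \<inter> Q = {}" "K \<subseteq> Q \<times> Q" "components Q K = {Q}"
  shows "bracket (D\<lparr>labels := labels D \<union> Q, joins := joins D \<union> K\<rparr>) =
           (- \<A>\<^sup>2 - \<A> powi (-2)) * bracket D"
proof -
  let ?D = "D\<lparr>labels := labels D \<union> Q, joins := joins D \<union> K\<rparr>"
  have ne: "Q \<noteq> {}" using Q(3) by (auto simp: components_def quotient_def)
  have c: "state_circles ?D S = Suc (state_circles D S)" if "S \<subseteq> crossings D" for S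
  proof -
    let ?J = "joins D \<union> (\<Union>x\<in>S. plus_smoothing x) \<union> (\<Union>x\<in>crossings D - S. minus_smoothing x)"
    have "?J \<subseteq> labels D \<times> labels D" using D that by (fastforce simp: link_arcs_valid_def)
    then have "components (labels D \<union> Q) (?J \<union> K) = insert Q (components (labels D) ?J)"
      using Q by (simp add: components_disjoint_union)
    moreover have "Q \<notin> components (labels D) ?J"
      using Q ne by (auto simp: components_def quotient_def)
    moreover have "finite (components (labels D) ?J)"
      using D by (auto simp: components_def link_arcs_valid_def intro: finite_quotient)
    moreover have "joins D \<union> K \<union> (\<Union>x\<in>S. plus_smoothing x) \<union> (\<Union>x\<in>crossings D - S. minus_smoothing x) = ?J \<union> K"
      by auto
    ultimately show ?thesis by (simp add: state_circles_def)
  qed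
  have "(- \<A>\<^sup>2 - \<A> powi (-2)) powi (int k) =
      (- \<A>\<^sup>2 - \<A> powi (-2)) * (- \<A>\<^sup>2 - \<A> powi (-2)) powi (int k - 1)" for k
    using power_int_add[of "- \<A>\<^sup>2 - \<A> powi (-2)" 1 "int k - 1"] delta_nonzero by simp
  with c show ?thesis
    unfolding bracket_def sum_distrib_left
    by (intro sum.cong) (auto simp: mult_ac simp del: power_int_of_nat)
qed

theorem bracket_unknot:
  assumes "components Q K = {Q}"
  shows "bracket \<lparr>labels = Q, crossings = {}, joins = K\<rparr> = 1"
  using assms by (simp add: bracket_def state_circles_def)



section \<open>Oriented link diagrams and the Jones polynomial\<close>

text \<open>
  An orientation of a diagram is the set of its passages from one arc to the next one, directed in
  the sense of traversal.
\<close>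

definition passages :: "'p link_diagram \<Rightarrow> ('p \<times> 'p) set" where
  "passages D = joins D \<union> {(a, c) | a b c d. (a, b, c, d) \<in> crossings D}
                        \<union> {(b, d) | a b c d. (a, b, c, d) \<in> crossings D}"

definition link_orientation :: "'p link_diagram \<Rightarrow> ('p \<times> 'p) set \<Rightarrow> bool" where
  "link_orientation D ori \<longleftrightarrow>
     ori \<subseteq> passages D \<union> (passages D)\<inverse> \<and>
     (\<forall>(p, q)\<in>passages D. (p, q) \<in> ori \<longleftrightarrow> (q, p) \<notin> ori) \<and>
     (\<forall>p\<in>labels D. (\<exists>!q. (p, q) \<in> ori) \<and> (\<exists>!q. (q, p) \<in> ori))"

text \<open>
  The overstrand directed from \<open>a\<close> to \<open>c\<close> and the understrand directed from \<open>b\<close> to \<open>d\<close> form a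
  right-handed crossing, as \<open>a, b, c, d\<close> are in counterclockwise order.
\<close>

fun crossing_sign :: "('p \<times> 'p) set \<Rightarrow> 'p crossing \<Rightarrow> int" where
  "crossing_sign ori (a, b, c, d) = (if (a, c) \<in> ori \<longleftrightarrow> (b, d) \<in> ori then 1 else -1)"

definition writhe :: "'p link_diagram \<Rightarrow> ('p \<times> 'p) set \<Rightarrow> int" where
  "writhe D ori = (\<Sum>x\<in>crossings D. crossing_sign ori x)"

definition jones :: "'p link_diagram \<Rightarrow> ('p \<times> 'p) set \<Rightarrow> int poly fract" where
  "jones D ori = (- (\<A> ^ 3)) powi (- writhe D ori) * bracket D"


section \<open>Diagrams of spatial \<open>K\<^sub>4\<close>-graphs\<close>

text \<open>
  The vertices \<open>c, v\<^sub>1, v\<^sub>2, v\<^sub>3\<close> are numbered 0, 1, 2, 3; the edge \<open>a\<^sub>i\<close> runs from \<open>tail i\<close> to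
  \<open>head i\<close>, for \<open>i = 1, \<dots>, 6\<close>.
\<close>

definition tail :: "nat \<Rightarrow> nat" where
  "tail i = (if i = 6 then 1 else if i = 4 then 2 else if i = 5 then 3 else 0)"

definition head :: "nat \<Rightarrow> nat" where
  "head i = (if i = 6 then 2 else if i = 4 then 3 else if i = 5 then 1 else i)"

definition incident :: "nat set \<Rightarrow> nat \<Rightarrow> nat set" where
  "incident E v = {i\<in>E. tail i = v \<or> head i = v}"

text \<open>
  Three-dimensional space is \<open>complex \<times> real\<close> with projection \<open>fst\<close> and height \<open>snd\<close>; the
  diagram is seen from above. The point at infinity of the 3-sphere lies off the graph.
\<close>

definition piecewise_linear :: "(real \<Rightarrow> 'a::real_vector) \<Rightarrow> bool" where
  "piecewise_linear g \<longleftrightarrow> (\<exists>B. finite B \<and>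
     (\<forall>s t. 0 \<le> s \<and> s < t \<and> t \<le> 1 \<and> {s<..<t} \<inter> B = {} \<longrightarrow>
       (\<forall>u\<in>{0..1}. g ((1 - u) * s + u * t) = (1 - u) *\<^sub>R g s + u *\<^sub>R g t)))"

definition spatial_K4 :: "(nat \<Rightarrow> real \<Rightarrow> complex \<times> real) \<Rightarrow> bool" where
  "spatial_K4 \<gamma> \<longleftrightarrow>
     (\<forall>i\<in>{1..6}. arc (\<gamma> i) \<and> piecewise_linear (\<gamma> i)) \<and>
     (\<exists>P. inj_on P {0..3} \<and>
        (\<forall>i\<in>{1..6}. pathstart (\<gamma> i) = P (tail i) \<and> pathfinish (\<gamma> i) = P (head i))) \<and>
     (\<forall>i\<in>{1..6}. \<forall>j\<in>{1..6}. \<forall>s\<in>{0..1}. \<forall>t\<in>{0..1}.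
        i \<noteq> j \<and> \<gamma> i s = \<gamma> j t \<longrightarrow> s \<in> {0, 1} \<and> t \<in> {0, 1})"

text \<open>
  A crossing of the diagram is recorded as the pair of its over point and its under point, each of
  them given as an edge together with a parameter on that edge.
\<close>

type_synonym graph_crossing = "(nat \<times> real) \<times> (nat \<times> real)"

definition graph_crossings :: "(nat \<Rightarrow> real \<Rightarrow> complex \<times> real) \<Rightarrow> graph_crossing set" where
  "graph_crossings \<gamma> = {((i, s), (j, t)) | i s j t.
     i \<in> {1..6} \<and> j \<in> {1..6} \<and> s \<in> {0..1} \<and> t \<in> {0..1} \<and>
     fst (\<gamma> i s) = fst (\<gamma> j t) \<and> snd (\<gamma> i s) > snd (\<gamma> j t)}"

definition velocity :: "(nat \<Rightarrow> real \<Rightarrow> complex \<times> real) \<Rightarrow> nat \<times> real \<Rightarrow> complex" where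
  "velocity \<gamma> = (\<lambda>(i, t). vector_derivative (fst \<circ> \<gamma> i) (at t within {0..1}))"

text \<open>The direction in which the projection of \<open>a\<^sub>i\<close> leaves its end point \<open>v\<close>.\<close>

definition exit_direction :: "(nat \<Rightarrow> real \<Rightarrow> complex \<times> real) \<Rightarrow> nat \<Rightarrow> nat \<Rightarrow> complex" where
  "exit_direction \<gamma> v i = (if tail i = v then velocity \<gamma> (i, 0) else - velocity \<gamma> (i, 1))"

text \<open>
  Regular projections: finitely many multiple points, all of them transversal double points away
  from the vertices of the graph and the corners of the edges, and the three edges at a vertex leave
  it in different directions.
\<close>

definition regular_projection :: "(nat \<Rightarrow> real \<Rightarrow> complex \<times> real) \<Rightarrow> bool" where
  "regular_projection \<gamma> \<longleftrightarrow>
     finite (graph_crossings \<gamma>) \<and>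
     (\<forall>((i, s), (j, t))\<in>graph_crossings \<gamma>.
        0 < s \<and> s < 1 \<and> 0 < t \<and> t < 1 \<and>
        (fst \<circ> \<gamma> i) differentiable (at s) \<and> (fst \<circ> \<gamma> j) differentiable (at t) \<and>
        Im (cnj (velocity \<gamma> (i, s)) * velocity \<gamma> (j, t)) \<noteq> 0) \<and>
     (\<forall>x\<in>graph_crossings \<gamma>. \<forall>y\<in>graph_crossings \<gamma>.
        {fst x, snd x} \<inter> {fst y, snd y} \<noteq> {} \<longrightarrow> x = y) \<and>
     (\<forall>v\<in>{0..3}. inj_on (\<lambda>i. Arg2pi (exit_direction \<gamma> v i)) (incident {1..6} v) \<and>
        (\<forall>i\<in>incident {1..6} v. exit_direction \<gamma> v i \<noteq> 0))"

definition K4_diagram :: "(nat \<Rightarrow> real \<Rightarrow> complex \<times> real) \<Rightarrow> bool" where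
  "K4_diagram \<gamma> \<longleftrightarrow> spatial_K4 \<gamma> \<and> regular_projection \<gamma>"

text \<open>The imaginary part is the determinant of the directions of the over- and the understrand.\<close>

definition graph_crossing_sign ::
    "(nat \<Rightarrow> real \<Rightarrow> complex \<times> real) \<Rightarrow> graph_crossing \<Rightarrow> int" where
  "graph_crossing_sign \<gamma> = (\<lambda>(p, q). if Im (cnj (velocity \<gamma> p) * velocity \<gamma> q) > 0 then 1 else -1)"

definition sign_sum :: "(nat \<Rightarrow> real \<Rightarrow> complex \<times> real) \<Rightarrow> nat \<Rightarrow> nat \<Rightarrow> int" where
  "sign_sum \<gamma> i j = (\<Sum>x | x \<in> graph_crossings \<gamma> \<and> {fst (fst x), fst (snd x)} = {i, j}.
     graph_crossing_sign \<gamma> x)"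

definition twist_parameter :: "(nat \<Rightarrow> real \<Rightarrow> complex \<times> real) \<Rightarrow> nat \<Rightarrow> int" where
  "twist_parameter \<gamma> k = (let w = sign_sum \<gamma> in
     if k = 1 then -2 * w 1 1 - w 2 3 - w 2 5 + w 1 2 + w 1 3 + w 1 5 + w 3 6 - w 1 6 + w 5 6
     else if k = 2 then -2 * w 2 2 - w 2 4 + w 1 4 + w 4 6 + w 2 3 - w 1 3 - w 3 6 + w 1 2 + w 2 6
     else if k = 3 then -2 * w 3 3 + w 3 4 - w 1 4 + w 4 5 + w 2 3 + w 2 5 - w 1 2 + w 1 3 - w 3 5
     else if k = 4 then -2 * w 4 4 - w 2 4 + w 3 4 - w 4 6 + w 3 6 - w 2 6 - w 4 5 - w 2 5 + w 3 5
     else if k = 5 then -2 * w 5 5 - w 3 5 + w 1 5 - w 3 6 + w 1 6 - w 5 6 - w 3 4 + w 1 4 - w 4 5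
     else if k = 6 then -2 * w 6 6 - w 1 6 + w 2 6 + w 2 5 - w 1 5 - w 5 6 + w 2 4 - w 1 4 - w 4 6
     else 0)"


section \<open>Band diagrams\<close>

text \<open>
  \<open>band_diagram \<gamma> E n\<close> is the band diagram of the sub-diagram formed by the edges in \<open>E\<close>, with
  \<open>n i\<close> half twists inserted in the band of \<open>a\<^sub>i\<close>.

  Going along the band of \<open>a\<^sub>i\<close> from tail to head one meets first \<open>|n i|\<close> half twists and then the
  crossings of \<open>a\<^sub>i\<close> in the sub-diagram. \<open>Rung i m \<sigma>\<close> is the arc on side \<open>\<sigma>\<close> of the band after
  the first \<open>m\<close> of these. \<open>OverMid x \<sigma>\<close> and \<open>UnderMid x \<sigma>\<close> are the short arcs inside the crossing
  \<open>x\<close>, between the two sides of the other band, on side \<open>\<sigma>\<close> of the upper, respectively lower, band.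
\<close>

datatype side = LeftSide | RightSide

datatype band_arc =
    Rung nat nat side
  | OverMid graph_crossing side
  | UnderMid graph_crossing side

definition sub_crossings ::
    "(nat \<Rightarrow> real \<Rightarrow> complex \<times> real) \<Rightarrow> nat set \<Rightarrow> graph_crossing set" where
  "sub_crossings \<gamma> E = {x\<in>graph_crossings \<gamma>. fst (fst x) \<in> E \<and> fst (snd x) \<in> E}"

definition crossing_times ::
    "(nat \<Rightarrow> real \<Rightarrow> complex \<times> real) \<Rightarrow> nat set \<Rightarrow> nat \<Rightarrow> real set" where
  "crossing_times \<gamma> E i = {t. \<exists>x\<in>sub_crossings \<gamma> E. (i, t) \<in> {fst x, snd x}}"

definition position ::
    "(nat \<Rightarrow> real \<Rightarrow> complex \<times> real) \<Rightarrow> nat set \<Rightarrow> (nat \<Rightarrow> int) \<Rightarrow> nat \<times> real \<Rightarrow> nat" where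
  "position \<gamma> E n = (\<lambda>(i, t). nat \<bar>n i\<bar> + card {u\<in>crossing_times \<gamma> E i. u < t})"

definition last_rung ::
    "(nat \<Rightarrow> real \<Rightarrow> complex \<times> real) \<Rightarrow> nat set \<Rightarrow> (nat \<Rightarrow> int) \<Rightarrow> nat \<Rightarrow> nat" where
  "last_rung \<gamma> E n i = nat \<bar>n i\<bar> + card (crossing_times \<gamma> E i)"

text \<open>
  A positive half twist has its overstrand from SW to NE when the band runs upwards, so that
  its crossing is negative for oppositely directed sides.
\<close>

definition twist_crossing :: "(nat \<Rightarrow> int) \<Rightarrow> nat \<Rightarrow> nat \<Rightarrow> band_arc crossing" where
  "twist_crossing n i k =
     (let SW = Rung i k LeftSide; SE = Rung i k RightSide;
          NE = Rung i (Suc k) RightSide; NW = Rung i (Suc k) LeftSide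
      in if n i > 0 then (SW, SE, NE, NW) else (SE, NE, NW, SW))"

text \<open>
  The crossing, at a crossing \<open>x\<close> of the graph diagram, of side \<open>\<sigma>\<close> of the upper band with side
  \<open>\<tau>\<close> of the lower band. If \<open>x\<close> is positive, the lower band crosses the upper one from right to
  left and the upper band crosses the lower one from left to right; otherwise it is the other way
  round.
\<close>

definition band_crossing ::
    "(nat \<Rightarrow> real \<Rightarrow> complex \<times> real) \<Rightarrow> nat set \<Rightarrow> (nat \<Rightarrow> int) \<Rightarrow> graph_crossing \<Rightarrow>
     side \<Rightarrow> side \<Rightarrow> band_arc crossing" where
  "band_crossing \<gamma> E n x \<sigma> \<tau> =
     (let i = fst (fst x); k = position \<gamma> E n (fst x);
          j = fst (snd x); l = position \<gamma> E n (snd x);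
          positive = (graph_crossing_sign \<gamma> x = 1);
          over_first = (\<tau> = (if positive then LeftSide else RightSide));
          under_first = (\<sigma> = (if positive then RightSide else LeftSide));
          over_in = (if over_first then Rung i k \<sigma> else OverMid x \<sigma>);
          over_out = (if over_first then OverMid x \<sigma> else Rung i (Suc k) \<sigma>);
          under_in = (if under_first then Rung j l \<tau> else UnderMid x \<tau>);
          under_out = (if under_first then UnderMid x \<tau> else Rung j (Suc l) \<tau>)
      in if positive then (over_in, under_in, over_out, under_out)
         else (over_in, under_out, over_out, under_in))"

text \<open>The sides of a band at its end on the disk at \<open>v\<close>, looking away from \<open>v\<close>.\<close>

definition left_end ::
    "(nat \<Rightarrow> real \<Rightarrow> complex \<times> real) \<Rightarrow> nat set \<Rightarrow> (nat \<Rightarrow> int) \<Rightarrow> nat \<Rightarrow> nat \<Rightarrow> band_arc" where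
  "left_end \<gamma> E n v i =
     (if tail i = v then Rung i 0 LeftSide else Rung i (last_rung \<gamma> E n i) RightSide)"

definition right_end ::
    "(nat \<Rightarrow> real \<Rightarrow> complex \<times> real) \<Rightarrow> nat set \<Rightarrow> (nat \<Rightarrow> int) \<Rightarrow> nat \<Rightarrow> nat \<Rightarrow> band_arc" where
  "right_end \<gamma> E n v i =
     (if tail i = v then Rung i 0 RightSide else Rung i (last_rung \<gamma> E n i) LeftSide)"

text \<open>
  The counterclockwise angle, in the interval from 0 (exclusive) to \<open>2\<pi>\<close> (inclusive), from a
  direction with argument \<open>a\<close> to one with argument \<open>b\<close>.
\<close>

definition turn :: "real \<Rightarrow> real \<Rightarrow> real" where
  "turn a b = (if a < b then b - a else b - a + 2 * pi)"

definition next_edge ::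
    "(nat \<Rightarrow> real \<Rightarrow> complex \<times> real) \<Rightarrow> nat set \<Rightarrow> nat \<Rightarrow> nat \<Rightarrow> nat \<Rightarrow> bool" where
  "next_edge \<gamma> E v i j \<longleftrightarrow> i \<in> incident E v \<and> j \<in> incident E v \<and>
     (let \<theta> = (\<lambda>k. Arg2pi (exit_direction \<gamma> v k))
      in \<forall>k\<in>incident E v. turn (\<theta> i) (\<theta> j) \<le> turn (\<theta> i) (\<theta> k))"

text \<open>The free boundary arcs of the disk at \<open>v\<close>, directed counterclockwise around the disk.\<close>

definition disk_arcs ::
    "(nat \<Rightarrow> real \<Rightarrow> complex \<times> real) \<Rightarrow> nat set \<Rightarrow> (nat \<Rightarrow> int) \<Rightarrow> nat \<Rightarrow>
     (band_arc \<times> band_arc) set" where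
  "disk_arcs \<gamma> E n v = {(left_end \<gamma> E n v i, right_end \<gamma> E n v j) | i j. next_edge \<gamma> E v i j}"

definition band_diagram ::
    "(nat \<Rightarrow> real \<Rightarrow> complex \<times> real) \<Rightarrow> nat set \<Rightarrow> (nat \<Rightarrow> int) \<Rightarrow> band_arc link_diagram" where
  "band_diagram \<gamma> E n =
     \<lparr>labels = {Rung i m \<sigma> | i m \<sigma>. i \<in> E \<and> m \<le> last_rung \<gamma> E n i} \<union>
               {OverMid x \<sigma> | x \<sigma>. x \<in> sub_crossings \<gamma> E} \<union>
               {UnderMid x \<sigma> | x \<sigma>. x \<in> sub_crossings \<gamma> E},
      crossings = {twist_crossing n i k | i k. i \<in> E \<and> k < nat \<bar>n i\<bar>} \<union>
                  {band_crossing \<gamma> E n x \<sigma> \<tau> | x \<sigma> \<tau>. x \<in> sub_crossings \<gamma> E},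
      joins = (\<Union>v\<in>{0..3}. disk_arcs \<gamma> E n v)\<rparr>"

text \<open>
  \<open>flat_bands \<gamma> E\<close> is the band diagram, without twists, of the sub-diagram with edges \<open>E\<close>;
  \<open>twisted_bands \<gamma> n\<close> is the link diagram \<open>L(n\<^sub>1, \<dots>, n\<^sub>6)\<close>.
\<close>

abbreviation flat_bands ::
    "(nat \<Rightarrow> real \<Rightarrow> complex \<times> real) \<Rightarrow> nat set \<Rightarrow> band_arc link_diagram" where
  "flat_bands \<gamma> E \<equiv> band_diagram \<gamma> E (\<lambda>_. 0)"

abbreviation twisted_bands ::
    "(nat \<Rightarrow> real \<Rightarrow> complex \<times> real) \<Rightarrow> (nat \<Rightarrow> int) \<Rightarrow> band_arc link_diagram" where
  "twisted_bands \<gamma> n \<equiv> band_diagram \<gamma> {1..6} n"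

text \<open>
  The link \<open>L(n\<^sub>1, \<dots>, n\<^sub>6)\<close> is oriented as the boundary of the band surface if its arcs run around
  each disk in one and the same sense. The two sides of each band are then
  oppositely directed, at the disks and hence all along the band. There are two such orientations,
  opposite to each other, according to the orientation of the connected surface.
\<close>

definition boundary_orientation ::
    "(nat \<Rightarrow> real \<Rightarrow> complex \<times> real) \<Rightarrow> (nat \<Rightarrow> int) \<Rightarrow> (band_arc \<times> band_arc) set \<Rightarrow> bool" where
  "boundary_orientation \<gamma> n ori \<longleftrightarrow> link_orientation (twisted_bands \<gamma> n) ori \<and>
     (\<forall>v\<in>{0..3}. disk_arcs \<gamma> {1..6} n v \<subseteq> ori \<or> (disk_arcs \<gamma> {1..6} n v)\<inverse> \<subseteq> ori)"


section \<open>Existence of the boundary orientation\<close>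

text \<open>
  For the twist parameters of a diagram the band surface is orientable, as the number of half twists
  along each cycle of the graph is even, and its boundary orientation is an orientation of
  \<open>L(n\<^sub>1, \<dots>, n\<^sub>6)\<close> in the sense above.
\<close>

lemma tail_head_simple:
  assumes "i \<in> {1..6}" "j \<in> {1..6}" "{tail i, head i} = {tail j, head j}"
  shows "i = j"
proof -
  have "i = 1 \<or> i = 2 \<or> i = 3 \<or> i = 4 \<or> i = 5 \<or> i = 6" using assms(1) by auto
  moreover have "j = 1 \<or> j = 2 \<or> j = 3 \<or> j = 4 \<or> j = 5 \<or> j = 6" using assms(2) by auto
  ultimately show ?thesis using assms(3) by (auto simp: tail_def head_def doubleton_eq_iff)
qed

lemma tail_neq_head: "i \<in> {1..6} \<Longrightarrow> tail i \<noteq> head i"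
  by (auto simp: tail_def head_def)

lemma tail_head_range: "i \<in> {1..6} \<Longrightarrow> tail i \<in> {0..3} \<and> head i \<in> {0..3}"
  by (auto simp: tail_def head_def)

lemma other_edge: "\<exists>j\<in>incident {1..6} v. j \<noteq> i" if "v \<in> {0..3}"
proof -
  have "\<exists>a\<in>incident {1..6} v. \<exists>b\<in>incident {1..6} v. a \<noteq> b"
  proof -
    have "1 \<in> incident {1..6} 0" "2 \<in> incident {1..6} 0" "1 \<in> incident {1..6} 1" "6 \<in> incident {1..6} 1"
      "2 \<in> incident {1..6} 2" "4 \<in> incident {1..6} 2" "3 \<in> incident {1..6} 3" "5 \<in> incident {1..6} 3"
      by (auto simp: incident_def tail_def head_def)
    moreover have "v = 0 \<or> v = 1 \<or> v = 2 \<or> v = 3" using that by auto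
    moreover have "(1::nat) \<noteq> 2" "(1::nat) \<noteq> 6" "(2::nat) \<noteq> 4" "(3::nat) \<noteq> 5" by auto
    ultimately show ?thesis by blast
  qed
  then show ?thesis by metis
qed

lemma turn_range: "a \<in> {0..<2*pi} \<Longrightarrow> b \<in> {0..<2*pi} \<Longrightarrow> 0 < turn a b \<and> turn a b \<le> 2 * pi"
  by (auto simp: turn_def)

lemma turn_swap:
  assumes "a \<in> {0..<2*pi}" "b \<in> {0..<2*pi}" "c \<in> {0..<2*pi}" "a \<noteq> c \<or> a \<noteq> b" "c \<noteq> b"
    "turn a b \<le> turn a c"
  shows "turn a b \<le> turn c b"
  using assms by (auto simp: turn_def split: if_splits)

lemma turn_swap':
  assumes "a \<in> {0..<2*pi}" "b \<in> {0..<2*pi}" "c \<in> {0..<2*pi}" "a \<noteq> c" 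
    "turn a b \<le> turn c b"
  shows "turn a b \<le> turn a c"
  using assms by (auto simp: turn_def split: if_splits)

lemma turn_inj:
  assumes "a \<in> {0..<2*pi}" "b \<in> {0..<2*pi}" "c \<in> {0..<2*pi}" "turn a b = turn a c \<or> turn b a = turn c a"
  shows "b = c"
  using assms by (auto simp: turn_def split: if_splits)

lemma ex1_min:
  fixes f :: "'a \<Rightarrow> real"
  assumes "finite S" "S \<noteq> {}" "inj_on f S"
  shows "\<exists>!x. x \<in> S \<and> (\<forall>y\<in>S. f x \<le> f y)"
proof -
  have "Min (f ` S) \<in> f ` S" using assms by auto
  then obtain x where "x \<in> S" "f x = Min (f ` S)" by auto
  then have x: "x \<in> S" "\<forall>y\<in>S. f x \<le> f y" using assms(1) by auto
  show ?thesis
  proof (rule ex1I[of _ x])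
    fix z assume z: "z \<in> S \<and> (\<forall>y\<in>S. f z \<le> f y)"
    then have "f z = f x" using x by (auto intro: antisym)
    then show "z = x" using inj_onD[OF assms(3)] z x by blast
  qed (use x in blast)
qed

lemma next_edge_ex1:
  assumes "regular_projection \<gamma>" "v \<in> {0..3}" "i \<in> incident {1..6} v"
  shows "\<exists>!j. next_edge \<gamma> {1..6} v i j" "\<exists>!j. next_edge \<gamma> {1..6} v j i"
    "next_edge \<gamma> {1..6} v i j \<Longrightarrow> i \<noteq> j"
proof -
  define I where "I = incident {1..6} v"
  define \<theta> where "\<theta> k = Arg2pi (exit_direction \<gamma> v k)" for k
  have fin: "finite I" by (auto simp: I_def incident_def)
  have i: "i \<in> I" using assms by (simp add: I_def)
  have inj: "inj_on \<theta> I" using assms unfolding regular_projection_def I_def \<theta>_def by auto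
  have r: "\<theta> k \<in> {0..<2*pi}" for k using Arg2pi_ge_0 Arg2pi_lt_2pi by (auto simp: \<theta>_def)
  have n: "next_edge \<gamma> {1..6} v i j \<longleftrightarrow> i \<in> I \<and> j \<in> I \<and> (\<forall>k\<in>I. turn (\<theta> i) (\<theta> j) \<le> turn (\<theta> i) (\<theta> k))"
    for i j by (simp add: next_edge_def I_def \<theta>_def)
  have ninj: "\<theta> a \<noteq> \<theta> b" if "a \<in> I" "b \<in> I" "a \<noteq> b" for a b using inj that by (auto dest: inj_onD)
  have ne: "I \<noteq> {}" using i by auto
  have "inj_on (\<lambda>j. turn (\<theta> i) (\<theta> j)) I"
    by (rule inj_onI) (metis turn_inj[OF r r r] inj_onD[OF inj])
  from ex1_min[OF fin ne this] show "\<exists>!j. next_edge \<gamma> {1..6} v i j" unfolding n by (simp add: i)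
  have ne: "i \<noteq> j" if "next_edge \<gamma> {1..6} v i j" for i j
  proof
    assume "i = j"
    obtain k where k: "k \<in> I" "k \<noteq> i" using other_edge[OF assms(2), of i] by (auto simp: I_def)
    with that[unfolded n] \<open>i = j\<close> have "turn (\<theta> i) (\<theta> i) \<le> turn (\<theta> i) (\<theta> k)" by blast
    moreover have "\<theta> i \<noteq> \<theta> k" using ninj k that[unfolded n] \<open>i = j\<close> by metis
    ultimately show False using r[of i] r[of k] by (auto simp: turn_def split: if_splits)
  qed
  then show "next_edge \<gamma> {1..6} v i j \<Longrightarrow> i \<noteq> j" .
  have eq: "next_edge \<gamma> {1..6} v j i \<longleftrightarrow> j \<in> I \<and> (\<forall>k\<in>I. turn (\<theta> j) (\<theta> i) \<le> turn (\<theta> k) (\<theta> i))" for j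
  proof
    assume a: "next_edge \<gamma> {1..6} v j i"
    then have "j \<noteq> i" by (rule ne)
    have "turn (\<theta> j) (\<theta> i) \<le> turn (\<theta> k) (\<theta> i)" if "k \<in> I" for k
    proof (cases "k = i")
      case True then show ?thesis using turn_range[of "\<theta> j" "\<theta> i"] r[of i] r[of j] by (simp add: turn_def)
    next
      case False
      then show ?thesis using turn_swap[of "\<theta> j" "\<theta> i" "\<theta> k"] r ninj[OF that i] ninj[of j i] a[unfolded n] that \<open>j \<noteq> i\<close>
        by blast
    qed
    then show "j \<in> I \<and> (\<forall>k\<in>I. turn (\<theta> j) (\<theta> i) \<le> turn (\<theta> k) (\<theta> i))" using a[unfolded n] by blast
  next
    assume a: "j \<in> I \<and> (\<forall>k\<in>I. turn (\<theta> j) (\<theta> i) \<le> turn (\<theta> k) (\<theta> i))"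
    have "turn (\<theta> j) (\<theta> i) \<le> turn (\<theta> j) (\<theta> k)" if "k \<in> I" for k
    proof (cases "k = j")
      case True then show ?thesis using turn_range[of "\<theta> j" "\<theta> i"] r[of i] r[of j] by (simp add: turn_def)
    next
      case False
      then show ?thesis using turn_swap'[of "\<theta> j" "\<theta> i" "\<theta> k"] r a that ninj[of j k] by auto
    qed
    then show "next_edge \<gamma> {1..6} v j i" unfolding n using a i by blast
  qed
  have "inj_on (\<lambda>j. turn (\<theta> j) (\<theta> i)) I"
    by (rule inj_onI) (metis turn_inj[OF r r r] inj_onD[OF inj])
  from ex1_min[OF fin \<open>I \<noteq> {}\<close> this] show "\<exists>!j. next_edge \<gamma> {1..6} v j i" unfolding eq .
qed

lemma ex1_card_below:
  fixes T :: "real set"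
  assumes "finite T" "m < card T"
  shows "\<exists>!t. t \<in> T \<and> card {u\<in>T. u < t} = m"
proof -
  have lt: "card {u\<in>T. u < s} < card {u\<in>T. u < t}" if "s \<in> T" "s < t" for s t
    using assms(1) that by (intro psubset_card_mono) auto
  have inj: "inj_on (\<lambda>t. card {u\<in>T. u < t}) T"
    proof (rule inj_onI)
    fix s t assume "s \<in> T" "t \<in> T" "card {u\<in>T. u < s} = card {u\<in>T. u < t}"
    then show "s = t" using lt[of s t] lt[of t s] by (cases s t rule: linorder_cases) auto
  qed
  have "(\<lambda>t. card {u\<in>T. u < t}) ` T \<subseteq> {..<card T}"
    using assms(1) by (auto intro!: psubset_card_mono)
  then have "(\<lambda>t. card {u\<in>T. u < t}) ` T = {..<card T}"
    using inj by (intro card_subset_eq) (auto simp: card_image)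
  moreover have "m \<in> {..<card T}" using assms(2) by simp
  ultimately obtain t where t: "t \<in> T" "card {u\<in>T. u < t} = m" by (metis (no_types, lifting) imageE)
  show ?thesis
  proof (rule ex1I[of _ t])
    fix t' assume "t' \<in> T \<and> card {u\<in>T. u < t'} = m"
    then show "t' = t" using inj_onD[OF inj, of t' t] t by simp
  qed (use t in simp)
qed

declare One_nat_def [simp del]

fun opposite_side :: "side \<Rightarrow> side" where
  "opposite_side LeftSide = RightSide"
| "opposite_side RightSide = LeftSide"

fun crossing_point :: "graph_crossing \<Rightarrow> bool \<Rightarrow> nat \<times> real" where
  "crossing_point x over = (if over then fst x else snd x)"

fun mid :: "graph_crossing \<Rightarrow> bool \<Rightarrow> side \<Rightarrow> band_arc" where
  "mid x over \<sigma> = (if over then OverMid x \<sigma> else UnderMid x \<sigma>)"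

text \<open>The passages along the bands, in the direction of the edges.\<close>

inductive forward_step ::
    "(nat \<Rightarrow> real \<Rightarrow> complex \<times> real) \<Rightarrow> (nat \<Rightarrow> int) \<Rightarrow> band_arc \<Rightarrow> band_arc \<Rightarrow> bool"
  for \<gamma> n where
  twist: "i \<in> {1..6} \<Longrightarrow> k < nat \<bar>n i\<bar> \<Longrightarrow>
    forward_step \<gamma> n (Rung i k \<sigma>) (Rung i (Suc k) (opposite_side \<sigma>))"
| enter: "x \<in> graph_crossings \<gamma> \<Longrightarrow> i = fst (crossing_point x b) \<Longrightarrow>
    m = position \<gamma> {1..6} n (crossing_point x b) \<Longrightarrow>
    forward_step \<gamma> n (Rung i m \<sigma>) (mid x b \<sigma>)"
| leave: "x \<in> graph_crossings \<gamma> \<Longrightarrow> i = fst (crossing_point x b) \<Longrightarrow>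
    m = position \<gamma> {1..6} n (crossing_point x b) \<Longrightarrow>
    forward_step \<gamma> n (mid x b \<sigma>) (Rung i (Suc m) \<sigma>)"

lemma mid_inject [simp]: "mid x b \<sigma> = mid y c \<tau> \<longleftrightarrow> x = y \<and> b = c \<and> \<sigma> = \<tau>"
  by auto

lemma mid_neq [simp]: "mid x b \<sigma> \<noteq> Rung i m \<tau>" "Rung i m \<tau> \<noteq> mid x b \<sigma>"
  by auto

declare mid.simps [simp del] crossing_point.simps [simp del]

lemma opposite_side_simps [simp]: "opposite_side (opposite_side \<sigma>) = \<sigma>"
  "opposite_side \<sigma> = RightSide \<longleftrightarrow> \<sigma> \<noteq> RightSide" "opposite_side \<sigma> \<noteq> \<sigma>"
  by (cases \<sigma>; simp)+

lemma sub_crossings_all: "sub_crossings \<gamma> {1..6} = graph_crossings \<gamma>"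
  by (auto simp: sub_crossings_def graph_crossings_def)

lemma crossing_times_all:
  "crossing_times \<gamma> {1..6} i = {t. \<exists>x\<in>graph_crossings \<gamma>. \<exists>b. (i, t) = crossing_point x b}"
proof -
  have "(i, t) \<in> {fst x, snd x} \<longleftrightarrow> (\<exists>b. (i, t) = crossing_point x b)" for t x
    by (auto simp: crossing_point.simps intro: exI[of _ True] exI[of _ False])
  then show ?thesis by (simp add: crossing_times_def sub_crossings_all)
qed

lemma crossing_point_edge: "x \<in> graph_crossings \<gamma> \<Longrightarrow> fst (crossing_point x b) \<in> {1..6}"
  by (auto simp: graph_crossings_def crossing_point.simps)

lemma crossing_point_inj:
  assumes "regular_projection \<gamma>" "x \<in> graph_crossings \<gamma>" "y \<in> graph_crossings \<gamma>"
    "crossing_point x b = crossing_point y c"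
  shows "x = y \<and> b = c"
proof -
  have "{fst x, snd x} \<inter> {fst y, snd y} \<noteq> {}"
    using assms(4) by (cases b; cases c; auto simp: crossing_point.simps)
  then have "x = y" using assms unfolding regular_projection_def by blast
  moreover have "fst x \<noteq> snd x" using assms(2) by (auto simp: graph_crossings_def)
  ultimately show ?thesis using assms(4) by (cases b; cases c; auto simp: crossing_point.simps)
qed

lemma finite_crossing_times:
  assumes "regular_projection \<gamma>"
  shows "finite (crossing_times \<gamma> {1..6} i)"
proof -
  have "crossing_times \<gamma> {1..6} i \<subseteq> (\<lambda>(x, b). snd (crossing_point x b)) ` (graph_crossings \<gamma> \<times> UNIV)"
  proof
    fix t assume "t \<in> crossing_times \<gamma> {1..6} i"
    then obtain x b where x: "x \<in> graph_crossings \<gamma>" "(i, t) = crossing_point x b"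
      unfolding crossing_times_all by blast
    have "t = snd (crossing_point x b)" using x(2) by (metis snd_conv)
    then show "t \<in> (\<lambda>(x, b). snd (crossing_point x b)) ` (graph_crossings \<gamma> \<times> UNIV)"
      using x(1) by (intro image_eqI[of _ _ "(x, b)"]) auto
  qed
  moreover have "finite (graph_crossings \<gamma> \<times> (UNIV :: bool set))"
    using assms by (simp add: regular_projection_def)
  ultimately show ?thesis by (meson finite_imageI finite_subset)
qed

lemma position_range:
  fixes b :: bool
  assumes "regular_projection \<gamma>" "x \<in> graph_crossings \<gamma>"
  defines "p \<equiv> crossing_point x b"
  shows "nat \<bar>n (fst p)\<bar> \<le> position \<gamma> {1..6} n p \<and> position \<gamma> {1..6} n p < last_rung \<gamma> {1..6} n (fst p)"
proof -
  obtain i t where p: "p = (i, t)" by fastforce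
  then have "t \<in> crossing_times \<gamma> {1..6} i" using assms unfolding crossing_times_all by force
  then have "card {u \<in> crossing_times \<gamma> {1..6} i. u < t} < card (crossing_times \<gamma> {1..6} i)"
    using finite_crossing_times[OF assms(1)] by (intro psubset_card_mono) auto
  then show ?thesis by (simp add: p position_def last_rung_def)
qed

lemma position_ex1:
  assumes "regular_projection \<gamma>" "nat \<bar>n i\<bar> \<le> m" "m < last_rung \<gamma> {1..6} n i"
  shows "\<exists>!(x, b). x \<in> graph_crossings \<gamma> \<and> i = fst (crossing_point x b) \<and>
    m = position \<gamma> {1..6} n (crossing_point x b)"
proof -
  let ?T = "crossing_times \<gamma> {1..6} i"
  have "m - nat \<bar>n i\<bar> < card ?T" using assms by (simp add: last_rung_def)
  from ex1_card_below[OF finite_crossing_times[OF assms(1)] this]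
  obtain t where t: "t \<in> ?T" "card {u\<in>?T. u < t} = m - nat \<bar>n i\<bar>"
    and u: "\<And>t'. t' \<in> ?T \<Longrightarrow> card {u\<in>?T. u < t'} = m - nat \<bar>n i\<bar> \<Longrightarrow> t' = t" by blast
  from t(1) obtain x b where x: "x \<in> graph_crossings \<gamma>" "crossing_point x b = (i, t)"
    unfolding crossing_times_all by force
  have m: "m = position \<gamma> {1..6} n (crossing_point x b)"
    using t assms by (simp add: position_def x)
  have "y = x \<and> c = b" if y: "y \<in> graph_crossings \<gamma>" "i = fst (crossing_point y c)"
    "m = position \<gamma> {1..6} n (crossing_point y c)" for y c
  proof -
    obtain t' where t': "crossing_point y c = (i, t')" using y(2) by (metis prod.collapse)
    then have "t' \<in> ?T" using y unfolding crossing_times_all by force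
    moreover have "card {u\<in>?T. u < t'} = m - nat \<bar>n i\<bar>" using y(3) by (simp add: t' position_def)
    ultimately have "t' = t" by (rule u)
    then show ?thesis using crossing_point_inj[OF assms(1) y(1) x(1), of c b] t' x(2) by auto
  qed
  note uniq = this
  show ?thesis
  proof (rule ex1I[of _ "(x, b)"])
    show "case (x, b) of (x, b) \<Rightarrow> x \<in> graph_crossings \<gamma> \<and> i = fst (crossing_point x b) \<and>
        m = position \<gamma> {1..6} n (crossing_point x b)"
      using x m by simp
    fix yc assume "case yc of (x, b) \<Rightarrow> x \<in> graph_crossings \<gamma> \<and> i = fst (crossing_point x b) \<and>
        m = position \<gamma> {1..6} n (crossing_point x b)"
    then show "yc = (x, b)" using uniq by (cases yc) blast
  qed
qed

lemma forward_step_Rung_ex1: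
  assumes "regular_projection \<gamma>" "i \<in> {1..6}" "m < last_rung \<gamma> {1..6} n i"
  shows "\<exists>!q. forward_step \<gamma> n (Rung i m \<sigma>) q" "\<exists>!p. forward_step \<gamma> n p (Rung i (Suc m) \<sigma>)"
proof -
  have "(\<exists>!q. forward_step \<gamma> n (Rung i m \<sigma>) q) \<and> (\<exists>!p. forward_step \<gamma> n p (Rung i (Suc m) \<sigma>))"
  proof (cases "m < nat \<bar>n i\<bar>")
    case True
    have no: False if "x \<in> graph_crossings \<gamma>" "i = fst (crossing_point x b)"
      "m = position \<gamma> {1..6} n (crossing_point x b)" for x b
      using position_range[OF assms(1) that(1), where b=b and n=n] that True by simp
    show ?thesis
    proof
      have "q = Rung i (Suc m) (opposite_side \<sigma>)" if "forward_step \<gamma> n (Rung i m \<sigma>) q" for q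
        using that
      proof cases
        case (enter x b)
        then show ?thesis using no by blast
      qed simp_all
      then show "\<exists>!q. forward_step \<gamma> n (Rung i m \<sigma>) q"
        using twist[where n=n, OF assms(2) True] by blast
      have "p = Rung i m (opposite_side \<sigma>)" if "forward_step \<gamma> n p (Rung i (Suc m) \<sigma>)" for p
        using that
      proof cases
        case (leave x b)
        then show ?thesis using no by blast
      qed auto
      moreover have "forward_step \<gamma> n (Rung i m (opposite_side \<sigma>)) (Rung i (Suc m) \<sigma>)"
        using twist[where n=n, OF assms(2) True, of \<gamma> "opposite_side \<sigma>"] by simp
      ultimately show "\<exists>!p. forward_step \<gamma> n p (Rung i (Suc m) \<sigma>)" by blast
    qed
  next
    case False
    then have "nat \<bar>n i\<bar> \<le> m" by simp
    from position_ex1[OF assms(1) this assms(3)] obtain x b where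
      x: "x \<in> graph_crossings \<gamma>" "i = fst (crossing_point x b)" "m = position \<gamma> {1..6} n (crossing_point x b)"
      and u: "\<And>y c. y \<in> graph_crossings \<gamma> \<Longrightarrow> i = fst (crossing_point y c) \<Longrightarrow>
        m = position \<gamma> {1..6} n (crossing_point y c) \<Longrightarrow> (y, c) = (x, b)"
      by (auto simp del: prod.inject)
    show ?thesis
    proof
      show "\<exists>!q. forward_step \<gamma> n (Rung i m \<sigma>) q"
        by (rule ex1I, rule enter[OF x], erule forward_step.cases) (use False u in auto)
      show "\<exists>!p. forward_step \<gamma> n p (Rung i (Suc m) \<sigma>)"
        by (rule ex1I, rule leave[OF x], erule forward_step.cases) (use False u in auto)
    qed
  qed
  then show "\<exists>!q. forward_step \<gamma> n (Rung i m \<sigma>) q" "\<exists>!p. forward_step \<gamma> n p (Rung i (Suc m) \<sigma>)"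
    by auto
qed

lemma forward_step_mid_ex1:
  assumes "x \<in> graph_crossings \<gamma>"
  shows "\<exists>!q. forward_step \<gamma> n (mid x b \<sigma>) q" "\<exists>!p. forward_step \<gamma> n p (mid x b \<sigma>)"
proof -
  show "\<exists>!q. forward_step \<gamma> n (mid x b \<sigma>) q"
    by (rule ex1I, rule leave[OF assms refl refl], erule forward_step.cases) auto
  show "\<exists>!p. forward_step \<gamma> n p (mid x b \<sigma>)"
    by (rule ex1I, rule enter[OF assms refl refl], erule forward_step.cases) auto
qed

lemma forward_step_Rung_less:
  assumes "regular_projection \<gamma>"
  shows "forward_step \<gamma> n (Rung i m \<sigma>) q \<Longrightarrow> m < last_rung \<gamma> {1..6} n i"
    "forward_step \<gamma> n p (Rung i m \<sigma>) \<Longrightarrow> 0 < m"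
  using position_range[OF assms, where n=n]
  by (auto elim!: forward_step.cases simp: last_rung_def)

text \<open>
  Given orientations \<open>s\<close> of the disks that fit together along the bands, the arc \<open>p\<close> is directed
  along its edge in the boundary orientation.
\<close>

fun runs_forward :: "(nat \<Rightarrow> bool) \<Rightarrow> (nat \<Rightarrow> int) \<Rightarrow> band_arc \<Rightarrow> bool" where
  "runs_forward s n (Rung i m \<sigma>) \<longleftrightarrow> (\<sigma> = RightSide) = (s (tail i) = even (min m (nat \<bar>n i\<bar>)))"
| "runs_forward s n (OverMid x \<sigma>) \<longleftrightarrow> (\<sigma> = RightSide) = s (head (fst (fst x)))"
| "runs_forward s n (UnderMid x \<sigma>) \<longleftrightarrow> (\<sigma> = RightSide) = s (head (fst (snd x)))"

definition surface_orientation :: "(nat \<Rightarrow> int) \<Rightarrow> (nat \<Rightarrow> bool) \<Rightarrow> bool" where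
  "surface_orientation n s \<longleftrightarrow> (\<forall>i\<in>{1..6}. s (head i) = (s (tail i) = even (n i)))"

lemma runs_forward_mid [simp]:
  "runs_forward s n (mid x b \<sigma>) \<longleftrightarrow> (\<sigma> = RightSide) = s (head (fst (crossing_point x b)))"
  by (simp add: mid.simps crossing_point.simps)

lemma even_nat_abs [simp]: "even (nat \<bar>k\<bar>) = even k"
  by (simp add: even_nat_iff)

lemma forward_step_runs:
  assumes "regular_projection \<gamma>" "surface_orientation n s" "forward_step \<gamma> n p q"
  shows "runs_forward s n p = runs_forward s n q"
  using assms(3)
proof cases
  case (twist i k \<sigma>)
  then show ?thesis by (auto simp: min_def)
next
  case (enter x i b m \<sigma>)
  then have "nat \<bar>n i\<bar> \<le> m" using position_range[OF assms(1), of x n b] by simp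
  then show ?thesis using enter assms(2) crossing_point_edge[OF enter(3), of b]
    by (auto simp: min_def surface_orientation_def)
next
  case (leave x i b m \<sigma>)
  then have "nat \<bar>n i\<bar> \<le> m" using position_range[OF assms(1), of x n b] by simp
  then show ?thesis using leave assms(2) crossing_point_edge[OF leave(3), of b]
    by (auto simp: min_def surface_orientation_def)
qed

definition disk_step ::
    "(nat \<Rightarrow> real \<Rightarrow> complex \<times> real) \<Rightarrow> (nat \<Rightarrow> int) \<Rightarrow> (nat \<Rightarrow> bool) \<Rightarrow> band_arc \<Rightarrow> band_arc \<Rightarrow> bool" where
  "disk_step \<gamma> n s p q \<longleftrightarrow> (\<exists>v\<in>{0..3}. if s v then (p, q) \<in> disk_arcs \<gamma> {1..6} n v
                                          else (q, p) \<in> disk_arcs \<gamma> {1..6} n v)"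

definition boundary_of ::
    "(nat \<Rightarrow> real \<Rightarrow> complex \<times> real) \<Rightarrow> (nat \<Rightarrow> int) \<Rightarrow> (nat \<Rightarrow> bool) \<Rightarrow> (band_arc \<times> band_arc) set" where
  "boundary_of \<gamma> n s = {(p, q). (forward_step \<gamma> n p q \<and> runs_forward s n p) \<or>
     (forward_step \<gamma> n q p \<and> \<not> runs_forward s n p) \<or> disk_step \<gamma> n s p q}"

lemma end_eq:
  assumes "i \<in> incident {1..6} v"
  shows "left_end \<gamma> E n v i = Rung j m \<sigma> \<longleftrightarrow> j = i \<and>
      ((\<sigma> = LeftSide \<and> m = 0 \<and> v = tail i) \<or> (\<sigma> = RightSide \<and> m = last_rung \<gamma> E n i \<and> v = head i))"
    and "right_end \<gamma> E n v i = Rung j m \<sigma> \<longleftrightarrow> j = i \<and>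
      ((\<sigma> = RightSide \<and> m = 0 \<and> v = tail i) \<or> (\<sigma> = LeftSide \<and> m = last_rung \<gamma> E n i \<and> v = head i))"
  using assms tail_neq_head[of i] by (auto simp: left_end_def right_end_def incident_def)

lemma end_Rung:
  "\<exists>m \<sigma>. left_end \<gamma> E n v i = Rung i m \<sigma>" "\<exists>m \<sigma>. right_end \<gamma> E n v i = Rung i m \<sigma>"
  by (auto simp: left_end_def right_end_def)

lemma next_edge_incident: "next_edge \<gamma> E v i j \<Longrightarrow> i \<in> incident E v \<and> j \<in> incident E v"
  by (simp add: next_edge_def)

lemma disk_arcs_Rung:
  "(Rung i m \<sigma>, q) \<in> disk_arcs \<gamma> {1..6} n v \<longleftrightarrow>
     ((\<sigma> = LeftSide \<and> m = 0 \<and> v = tail i) \<or> (\<sigma> = RightSide \<and> m = last_rung \<gamma> {1..6} n i \<and> v = head i)) \<and>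
     (\<exists>j. next_edge \<gamma> {1..6} v i j \<and> q = right_end \<gamma> {1..6} n v j)"
  "(q, Rung i m \<sigma>) \<in> disk_arcs \<gamma> {1..6} n v \<longleftrightarrow>
     ((\<sigma> = RightSide \<and> m = 0 \<and> v = tail i) \<or> (\<sigma> = LeftSide \<and> m = last_rung \<gamma> {1..6} n i \<and> v = head i)) \<and>
     (\<exists>j. next_edge \<gamma> {1..6} v j i \<and> q = left_end \<gamma> {1..6} n v j)"
proof -
  have l: "(\<exists>i'. Rung i m \<sigma> = left_end \<gamma> {1..6} n v i' \<and> next_edge \<gamma> {1..6} v i' j) \<longleftrightarrow>
      ((\<sigma> = LeftSide \<and> m = 0 \<and> v = tail i) \<or> (\<sigma> = RightSide \<and> m = last_rung \<gamma> {1..6} n i \<and> v = head i)) \<and>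
      next_edge \<gamma> {1..6} v i j" for j
    using end_eq(1)[of _ v \<gamma> "{1..6}" n i m \<sigma>] next_edge_incident by metis
  have r: "(\<exists>i'. Rung i m \<sigma> = right_end \<gamma> {1..6} n v i' \<and> next_edge \<gamma> {1..6} v j i') \<longleftrightarrow>
      ((\<sigma> = RightSide \<and> m = 0 \<and> v = tail i) \<or> (\<sigma> = LeftSide \<and> m = last_rung \<gamma> {1..6} n i \<and> v = head i)) \<and>
      next_edge \<gamma> {1..6} v j i" for j
    using end_eq(2)[of _ v \<gamma> "{1..6}" n i m \<sigma>] next_edge_incident by metis
  show "(Rung i m \<sigma>, q) \<in> disk_arcs \<gamma> {1..6} n v \<longleftrightarrow>
     ((\<sigma> = LeftSide \<and> m = 0 \<and> v = tail i) \<or> (\<sigma> = RightSide \<and> m = last_rung \<gamma> {1..6} n i \<and> v = head i)) \<and>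
     (\<exists>j. next_edge \<gamma> {1..6} v i j \<and> q = right_end \<gamma> {1..6} n v j)"
    unfolding disk_arcs_def using l by blast
  show "(q, Rung i m \<sigma>) \<in> disk_arcs \<gamma> {1..6} n v \<longleftrightarrow>
     ((\<sigma> = RightSide \<and> m = 0 \<and> v = tail i) \<or> (\<sigma> = LeftSide \<and> m = last_rung \<gamma> {1..6} n i \<and> v = head i)) \<and>
     (\<exists>j. next_edge \<gamma> {1..6} v j i \<and> q = left_end \<gamma> {1..6} n v j)"
    unfolding disk_arcs_def using r by blast
qed

lemma disk_arcs_not_mid:
  "(mid x b \<sigma>, q) \<notin> disk_arcs \<gamma> E n v" "(q, mid x b \<sigma>) \<notin> disk_arcs \<gamma> E n v"
  by (auto simp: disk_arcs_def left_end_def right_end_def)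

lemma disk_step_not_mid: "\<not> disk_step \<gamma> n s (mid x b \<sigma>) q" "\<not> disk_step \<gamma> n s q (mid x b \<sigma>)"
  by (auto simp: disk_step_def disk_arcs_not_mid)

lemma runs_forward_end:
  assumes "surface_orientation n s" "i \<in> {1..6}"
  shows "runs_forward s n (Rung i 0 \<sigma>) \<longleftrightarrow> (\<sigma> = RightSide) = s (tail i)"
    "runs_forward s n (Rung i (last_rung \<gamma> E n i) \<sigma>) \<longleftrightarrow> (\<sigma> = RightSide) = s (head i)"
  using assms by (auto simp: surface_orientation_def last_rung_def)

declare runs_forward.simps [simp del]

lemma disk_step_Rung:
  assumes "regular_projection \<gamma>" "surface_orientation n s" "i \<in> {1..6}"
  shows "disk_step \<gamma> n s (Rung i m \<sigma>) q \<Longrightarrow>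
      if runs_forward s n (Rung i m \<sigma>) then m = last_rung \<gamma> {1..6} n i else m = 0"
    and "(if runs_forward s n (Rung i m \<sigma>) then m = last_rung \<gamma> {1..6} n i else m = 0) \<Longrightarrow>
      \<exists>!q. disk_step \<gamma> n s (Rung i m \<sigma>) q"
proof -
  let ?l = "last_rung \<gamma> {1..6} n i"
  have v: "tail i \<in> {0..3}" "head i \<in> {0..3}" using tail_head_range[OF assms(3)] by auto
  have inc: "i \<in> incident {1..6} (tail i)" "i \<in> incident {1..6} (head i)"
    using assms(3) by (auto simp: incident_def)
  have d: "disk_step \<gamma> n s (Rung i m \<sigma>) q \<longleftrightarrow>
     (\<sigma> = LeftSide \<and> m = 0 \<and> s (tail i) \<and> (\<exists>j. next_edge \<gamma> {1..6} (tail i) i j \<and> q = right_end \<gamma> {1..6} n (tail i) j)) \<or>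
     (\<sigma> = RightSide \<and> m = ?l \<and> s (head i) \<and> (\<exists>j. next_edge \<gamma> {1..6} (head i) i j \<and> q = right_end \<gamma> {1..6} n (head i) j)) \<or>
     (\<sigma> = RightSide \<and> m = 0 \<and> \<not> s (tail i) \<and> (\<exists>j. next_edge \<gamma> {1..6} (tail i) j i \<and> q = left_end \<gamma> {1..6} n (tail i) j)) \<or>
     (\<sigma> = LeftSide \<and> m = ?l \<and> \<not> s (head i) \<and> (\<exists>j. next_edge \<gamma> {1..6} (head i) j i \<and> q = left_end \<gamma> {1..6} n (head i) j))" for q
  proof -
    have "disk_step \<gamma> n s (Rung i m \<sigma>) q \<longleftrightarrow>
      (\<exists>v\<in>{0..3}. s v \<and> (Rung i m \<sigma>, q) \<in> disk_arcs \<gamma> {1..6} n v) \<or>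
      (\<exists>v\<in>{0..3}. \<not> s v \<and> (q, Rung i m \<sigma>) \<in> disk_arcs \<gamma> {1..6} n v)"
      unfolding disk_step_def by metis
    then show ?thesis unfolding disk_arcs_Rung using v by blast
  qed
  note e = runs_forward_end[OF assms(2,3)]
  show "if runs_forward s n (Rung i m \<sigma>) then m = ?l else m = 0" if "disk_step \<gamma> n s (Rung i m \<sigma>) q"
  proof -
    from that[unfolded d] consider "\<sigma> = LeftSide" "m = 0" "s (tail i)" | "\<sigma> = RightSide" "m = ?l" "s (head i)"
      | "\<sigma> = RightSide" "m = 0" "\<not> s (tail i)" | "\<sigma> = LeftSide" "m = ?l" "\<not> s (head i)" by blast
    then show ?thesis using e(1)[of \<sigma>] e(2)[of \<gamma> "{1..6}" \<sigma>] by cases auto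
  qed
  note n1 = next_edge_ex1(1)[OF assms(1)] and n2 = next_edge_ex1(2)[OF assms(1)]
  assume a: "if runs_forward s n (Rung i m \<sigma>) then m = ?l else m = 0"
  show "\<exists>!q. disk_step \<gamma> n s (Rung i m \<sigma>) q"
  proof (cases "runs_forward s n (Rung i m \<sigma>)")
    case True
    then have m: "m = ?l" using a by simp
    with True e(2)[of \<gamma> "{1..6}" \<sigma>] have h: "(\<sigma> = RightSide) = s (head i)" by simp
    have t: "(\<sigma> = RightSide) = s (tail i)" if "m = 0" using True e(1)[of \<sigma>] that by simp
    show ?thesis
    proof (cases \<sigma>)
      case LeftSide
      have "disk_step \<gamma> n s (Rung i m \<sigma>) q \<longleftrightarrow> (\<exists>j. next_edge \<gamma> {1..6} (head i) j i \<and> q = left_end \<gamma> {1..6} n (head i) j)" for q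
        unfolding d using LeftSide m h t by auto
      then show ?thesis using n2[OF v(2) inc(2)] by metis
    next
      case RightSide
      have "disk_step \<gamma> n s (Rung i m \<sigma>) q \<longleftrightarrow> (\<exists>j. next_edge \<gamma> {1..6} (head i) i j \<and> q = right_end \<gamma> {1..6} n (head i) j)" for q
        unfolding d using RightSide m h t by auto
      then show ?thesis using n1[OF v(2) inc(2)] by metis
    qed
  next
    case False
    then have m: "m = 0" using a by simp
    with False e(1)[of \<sigma>] have h: "(\<sigma> = RightSide) \<noteq> s (tail i)" by simp
    have t: "(\<sigma> = RightSide) \<noteq> s (head i)" if "m = ?l" using False e(2)[of \<gamma> "{1..6}" \<sigma>] that by simp
    show ?thesis
    proof (cases \<sigma>)
      case LeftSide
      have "disk_step \<gamma> n s (Rung i m \<sigma>) q \<longleftrightarrow> (\<exists>j. next_edge \<gamma> {1..6} (tail i) i j \<and> q = right_end \<gamma> {1..6} n (tail i) j)" for q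
        unfolding d using LeftSide m h t by auto
      then show ?thesis using n1[OF v(1) inc(1)] by metis
    next
      case RightSide
      have "disk_step \<gamma> n s (Rung i m \<sigma>) q \<longleftrightarrow> (\<exists>j. next_edge \<gamma> {1..6} (tail i) j i \<and> q = left_end \<gamma> {1..6} n (tail i) j)" for q
        unfolding d using RightSide m h t by auto
      then show ?thesis using n2[OF v(1) inc(1)] by metis
    qed
  qed
qed

lemma labels_cases:
  assumes "p \<in> labels (twisted_bands \<gamma> n)"
  obtains i m \<sigma> where "p = Rung i m \<sigma>" "i \<in> {1..6}" "m \<le> last_rung \<gamma> {1..6} n i"
  | x b \<sigma> where "p = mid x b \<sigma>" "x \<in> graph_crossings \<gamma>"
proof -
  from assms consider i m \<sigma> where "p = Rung i m \<sigma>" "i \<in> {1..6}" "m \<le> last_rung \<gamma> {1..6} n i"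
    | x \<sigma> where "p = OverMid x \<sigma>" "x \<in> graph_crossings \<gamma>"
    | x \<sigma> where "p = UnderMid x \<sigma>" "x \<in> graph_crossings \<gamma>"
    unfolding band_diagram_def link_diagram.simps sub_crossings_all by blast
  then show thesis
  proof cases
    case 1 then show thesis by (rule that(1))
  next
    case 2 then show thesis using that(2)[of x True] by (simp add: mid.simps)
  next
    case 3 then show thesis using that(2)[of x False] by (simp add: mid.simps)
  qed
qed

lemma boundary_of_ex1:
  assumes "regular_projection \<gamma>" "surface_orientation n s" "p \<in> labels (twisted_bands \<gamma> n)"
  shows "\<exists>!q. (p, q) \<in> boundary_of \<gamma> n s"
proof (cases rule: labels_cases[OF assms(3)])
  case (1 i m \<sigma>)
  note d = disk_step_Rung[OF assms(1,2) 1(2), of m \<sigma>]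
  show ?thesis
  proof (cases "if runs_forward s n p then m = last_rung \<gamma> {1..6} n i else m = 0")
    case True
    have "\<not> forward_step \<gamma> n p q" if "runs_forward s n p" for q
    proof -
      have "m = last_rung \<gamma> {1..6} n i" using True that by simp
      then show ?thesis using forward_step_Rung_less(1)[OF assms(1), of n i m \<sigma> q] unfolding 1(1) by (metis less_irrefl)
    qed
    moreover have "\<not> forward_step \<gamma> n q p" if "\<not> runs_forward s n p" for q
    proof -
      have "m = 0" using True that by simp
      then show ?thesis using forward_step_Rung_less(2)[OF assms(1), of n q i m \<sigma>] unfolding 1(1) by (metis less_irrefl)
    qed
    ultimately have "(p, q) \<in> boundary_of \<gamma> n s \<longleftrightarrow> disk_step \<gamma> n s p q" for q
      by (auto simp: boundary_of_def)
    then show ?thesis using d(2) True unfolding 1(1) by simp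
  next
    case False
    then have nd: "\<not> disk_step \<gamma> n s p q" for q using d(1) 1(1) by blast
    show ?thesis
    proof (cases "runs_forward s n p")
      case True
      then have "(p, q) \<in> boundary_of \<gamma> n s \<longleftrightarrow> forward_step \<gamma> n p q" for q
        using nd by (auto simp: boundary_of_def)
      moreover have "m < last_rung \<gamma> {1..6} n i" using True False 1(3) by auto
      ultimately show ?thesis using forward_step_Rung_ex1(1)[OF assms(1) 1(2), of m n \<sigma>] unfolding 1(1) by simp
    next
      case F: False
      then have "(p, q) \<in> boundary_of \<gamma> n s \<longleftrightarrow> forward_step \<gamma> n q p" for q
        using nd by (auto simp: boundary_of_def)
      moreover obtain k where "m = Suc k" "k < last_rung \<gamma> {1..6} n i"
        using F False 1(3) by (cases m) auto
      ultimately show ?thesis using forward_step_Rung_ex1(2)[OF assms(1) 1(2), of k n \<sigma>] unfolding 1(1) by simp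
    qed
  qed
next
  case (2 x b \<sigma>)
  then show ?thesis using forward_step_mid_ex1[OF 2(2), of n b \<sigma>] disk_step_not_mid
    by (cases "runs_forward s n p") (simp_all add: boundary_of_def)
qed

lemma runs_forward_Not: "runs_forward (\<lambda>v. \<not> s v) n p = (\<not> runs_forward s n p)"
  by (cases p) (auto simp: runs_forward.simps)

lemma boundary_of_Not:
  assumes "regular_projection \<gamma>" "surface_orientation n s"
  shows "boundary_of \<gamma> n (\<lambda>v. \<not> s v) = (boundary_of \<gamma> n s)\<inverse>"
proof -
  have "disk_step \<gamma> n (\<lambda>v. \<not> s v) p q = disk_step \<gamma> n s q p" for p q
    unfolding disk_step_def by (intro bex_cong) auto
  then show ?thesis
    using forward_step_runs[OF assms] by (auto simp: boundary_of_def runs_forward_Not)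
qed

lemma crossing_passages:
  assumes "(a, b, c, d) \<in> crossings (twisted_bands \<gamma> n)"
  shows "forward_step \<gamma> n a c \<or> forward_step \<gamma> n c a" "forward_step \<gamma> n b d \<or> forward_step \<gamma> n d b"
proof -
  from assms consider i k where "(a, b, c, d) = twist_crossing n i k" "i \<in> {1..6}" "k < nat \<bar>n i\<bar>"
    | x \<sigma> \<tau> where "(a, b, c, d) = band_crossing \<gamma> {1..6} n x \<sigma> \<tau>" "x \<in> graph_crossings \<gamma>"
    unfolding band_diagram_def link_diagram.simps sub_crossings_all by blast
  then have "(forward_step \<gamma> n a c \<or> forward_step \<gamma> n c a) \<and> (forward_step \<gamma> n b d \<or> forward_step \<gamma> n d b)"
  proof cases
    case 1
    then show ?thesis using twist[where n=n, OF 1(2,3), of \<gamma> LeftSide] twist[where n=n, OF 1(2,3), of \<gamma> RightSide]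
      by (auto simp: twist_crossing_def Let_def split: if_splits)
  next
    case 2
    show ?thesis
      using 2(1) enter[OF 2(2) refl refl, of n True \<sigma>] enter[OF 2(2) refl refl, of n False \<tau>]
        leave[OF 2(2) refl refl, of n True \<sigma>] leave[OF 2(2) refl refl, of n False \<tau>]
      by (auto simp: band_crossing_def Let_def mid.simps crossing_point.simps split: if_splits)
  qed
  then show "forward_step \<gamma> n a c \<or> forward_step \<gamma> n c a" "forward_step \<gamma> n b d \<or> forward_step \<gamma> n d b" by auto
qed

lemma band_crossing_passages:
  assumes "x \<in> graph_crossings \<gamma>"
  shows "case band_crossing \<gamma> {1..6} n x \<sigma> \<tau> of (a, b, c, d) \<Rightarrow>
    (a, c) \<in> passages (twisted_bands \<gamma> n) \<and> (b, d) \<in> passages (twisted_bands \<gamma> n)"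
proof -
  obtain a b c d where e: "band_crossing \<gamma> {1..6} n x \<sigma> \<tau> = (a, b, c, d)" by (rule prod_cases4)
  have "band_crossing \<gamma> {1..6} n x \<sigma> \<tau> \<in> crossings (twisted_bands \<gamma> n)"
    unfolding band_diagram_def link_diagram.simps sub_crossings_all using assms by blast
  then show ?thesis unfolding e passages_def by auto
qed

lemma forward_step_passage:
  assumes "forward_step \<gamma> n p q"
  shows "(p, q) \<in> passages (twisted_bands \<gamma> n) \<or> (q, p) \<in> passages (twisted_bands \<gamma> n)"
  using assms
proof cases
  case (twist i k \<sigma>)
  obtain a b c d where e: "twist_crossing n i k = (a, b, c, d)" by (rule prod_cases4)
  have "twist_crossing n i k \<in> crossings (twisted_bands \<gamma> n)"
    unfolding band_diagram_def link_diagram.simps using twist by blast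
  then have "(a, c) \<in> passages (twisted_bands \<gamma> n)" "(b, d) \<in> passages (twisted_bands \<gamma> n)"
    unfolding e passages_def by auto
  then show ?thesis using twist(1,2) e
    by (cases \<sigma>) (auto simp: twist_crossing_def Let_def split: if_splits)
next
  case (enter x i b m \<sigma>)
  show ?thesis
  proof (cases b)
    case True
    then show ?thesis using enter(1,2,4,5)
        band_crossing_passages[OF enter(3), of n \<sigma> "if graph_crossing_sign \<gamma> x = 1 then LeftSide else RightSide"]
      by (auto simp: band_crossing_def Let_def mid.simps crossing_point.simps split: if_splits)
  next
    case False
    then show ?thesis using enter(1,2,4,5)
        band_crossing_passages[OF enter(3), of n "if graph_crossing_sign \<gamma> x = 1 then RightSide else LeftSide" \<sigma>]
      by (auto simp: band_crossing_def Let_def mid.simps crossing_point.simps split: if_splits)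
  qed
next
  case (leave x i b m \<sigma>)
  show ?thesis
  proof (cases b)
    case True
    then show ?thesis using leave(1,2,4,5)
        band_crossing_passages[OF leave(3), of n \<sigma> "if graph_crossing_sign \<gamma> x = 1 then RightSide else LeftSide"]
      by (auto simp: band_crossing_def Let_def mid.simps crossing_point.simps split: if_splits)
  next
    case False
    then show ?thesis using leave(1,2,4,5)
        band_crossing_passages[OF leave(3), of n "if graph_crossing_sign \<gamma> x = 1 then LeftSide else RightSide" \<sigma>]
      by (auto simp: band_crossing_def Let_def mid.simps crossing_point.simps split: if_splits)
  qed
qed

lemma disk_arcs_not_forward:
  assumes "regular_projection \<gamma>" "v \<in> {0..3}" "(p, q) \<in> disk_arcs \<gamma> {1..6} n v"
  shows "\<not> forward_step \<gamma> n p q" "\<not> forward_step \<gamma> n q p"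
proof -
  obtain i j where ij: "next_edge \<gamma> {1..6} v i j" "p = left_end \<gamma> {1..6} n v i" "q = right_end \<gamma> {1..6} n v j"
    using assms(3) by (auto simp: disk_arcs_def)
  have "i \<noteq> j" using next_edge_ex1(3)[OF assms(1,2) _ ij(1)] next_edge_incident[OF ij(1)] by blast
  moreover obtain m \<sigma> m' \<sigma>' where "p = Rung i m \<sigma>" "q = Rung j m' \<sigma>'"
    using ij end_Rung by metis
  ultimately show "\<not> forward_step \<gamma> n p q" "\<not> forward_step \<gamma> n q p"
    by (auto elim: forward_step.cases)
qed

lemma disk_step_asym:
  assumes "regular_projection \<gamma>" "disk_step \<gamma> n s p q"
  shows "\<not> disk_step \<gamma> n s q p"
proof
  assume a: "disk_step \<gamma> n s q p"
  have *: False if v: "v \<in> {0..3}" "v' \<in> {0..3}" and d: "(p, q) \<in> disk_arcs \<gamma> {1..6} n v"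
    and d': "(q, p) \<in> disk_arcs \<gamma> {1..6} n v'" for v v' p q
  proof -
    obtain i j where ij: "next_edge \<gamma> {1..6} v i j" "p = left_end \<gamma> {1..6} n v i" "q = right_end \<gamma> {1..6} n v j"
      using d by (auto simp: disk_arcs_def)
    obtain i' j' where ij': "next_edge \<gamma> {1..6} v' j' i'" "q = left_end \<gamma> {1..6} n v' j'" "p = right_end \<gamma> {1..6} n v' i'"
      using d' by (auto simp: disk_arcs_def)
    note I = next_edge_incident[OF ij(1)] next_edge_incident[OF ij'(1)]
    have ne: "i \<noteq> j" using next_edge_ex1(3)[OF assms(1) v(1) _ ij(1)] I by blast
    obtain m \<sigma> where p: "p = Rung i m \<sigma>" using ij end_Rung by metis
    obtain m' \<tau> where q: "q = Rung j m' \<tau>" using ij end_Rung by metis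
    have "i' = i" "{v, v'} = {tail i, head i}"
      using end_eq(1)[of i v \<gamma> "{1..6}" n i m \<sigma>] end_eq(2)[of i' v' \<gamma> "{1..6}" n i m \<sigma>] I ij ij' p by auto
    moreover have "j' = j" "{v, v'} = {tail j, head j}"
      using end_eq(2)[of j v \<gamma> "{1..6}" n j m' \<tau>] end_eq(1)[of j' v' \<gamma> "{1..6}" n j m' \<tau>] I ij ij' q by auto
    ultimately show False using tail_head_simple[of i j] I ne by (auto simp: incident_def)
  qed
  have **: "v = v'" if v: "v \<in> {0..3}" "v' \<in> {0..3}" and d: "(p, q) \<in> disk_arcs \<gamma> {1..6} n v"
    and d': "(p, q) \<in> disk_arcs \<gamma> {1..6} n v'" for v v' p q
  proof -
    obtain i j where ij: "next_edge \<gamma> {1..6} v i j" "p = left_end \<gamma> {1..6} n v i"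
      using d by (auto simp: disk_arcs_def)
    obtain i' j' where ij': "next_edge \<gamma> {1..6} v' i' j'" "p = left_end \<gamma> {1..6} n v' i'"
      using d' by (auto simp: disk_arcs_def)
    note I = next_edge_incident[OF ij(1)] next_edge_incident[OF ij'(1)]
    obtain m \<sigma> where p: "p = Rung i m \<sigma>" using ij end_Rung by metis
    show ?thesis
      using end_eq(1)[of i v \<gamma> "{1..6}" n i m \<sigma>] end_eq(1)[of i' v' \<gamma> "{1..6}" n i m \<sigma>] I ij ij' p by auto
  qed
  show False using assms(2) a * ** unfolding disk_step_def by (metis (full_types))
qed

lemma boundary_of_orientation:
  assumes "regular_projection \<gamma>" "surface_orientation n s"
  shows "boundary_orientation \<gamma> n (boundary_of \<gamma> n s)"
proof -
  let ?O = "boundary_of \<gamma> n s" and ?D = "twisted_bands \<gamma> n"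
  have J: "joins ?D = (\<Union>v\<in>{0..3}. disk_arcs \<gamma> {1..6} n v)" by (simp add: band_diagram_def)
  have "?O \<subseteq> passages ?D \<union> (passages ?D)\<inverse>"
  proof -
    have "disk_step \<gamma> n s p q \<Longrightarrow> (p, q) \<in> joins ?D \<union> (joins ?D)\<inverse>" for p q
      unfolding J disk_step_def by (auto split: if_splits)
    then have "disk_step \<gamma> n s p q \<Longrightarrow> (p, q) \<in> passages ?D \<union> (passages ?D)\<inverse>" for p q
      unfolding passages_def by blast
    then show ?thesis using forward_step_passage[of \<gamma> n] unfolding boundary_of_def by blast
  qed
  moreover have "(p, q) \<in> ?O \<longleftrightarrow> (q, p) \<notin> ?O" if pq: "(p, q) \<in> passages ?D" for p q
  proof -
    have f: "(p, q) \<in> ?O \<longleftrightarrow> (q, p) \<notin> ?O" if "forward_step \<gamma> n p q" for p q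
    proof -
      have "\<not> forward_step \<gamma> n q p" using that by (auto elim!: forward_step.cases)
      moreover have "\<not> disk_step \<gamma> n s p q" "\<not> disk_step \<gamma> n s q p"
        using that disk_arcs_not_forward[OF assms(1)] unfolding disk_step_def by (metis (full_types))+
      ultimately show ?thesis using that forward_step_runs[OF assms that] by (auto simp: boundary_of_def)
    qed
    from pq consider v where "v \<in> {0..3}" "(p, q) \<in> disk_arcs \<gamma> {1..6} n v"
      | "forward_step \<gamma> n p q" | "forward_step \<gamma> n q p"
      unfolding passages_def J using crossing_passages by blast
    then show ?thesis
    proof cases
      case 1
      then have "disk_step \<gamma> n s p q \<or> disk_step \<gamma> n s q p"
        unfolding disk_step_def by (cases "s v") (metis (full_types))+
      then show ?thesis
        using disk_step_asym[OF assms(1), of n s] disk_arcs_not_forward[OF assms(1) 1]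
        by (auto simp: boundary_of_def)
    qed (use f in blast)+
  qed
  moreover have "(\<exists>!q. (p, q) \<in> ?O) \<and> (\<exists>!q. (q, p) \<in> ?O)" if "p \<in> labels ?D" for p
  proof -
    have "surface_orientation n (\<lambda>v. \<not> s v)" using assms(2) by (auto simp: surface_orientation_def)
    from boundary_of_ex1[OF assms(1) this that] boundary_of_ex1[OF assms that]
    show ?thesis by (simp add: boundary_of_Not[OF assms])
  qed
  moreover have "disk_arcs \<gamma> {1..6} n v \<subseteq> ?O \<or> (disk_arcs \<gamma> {1..6} n v)\<inverse> \<subseteq> ?O" if "v \<in> {0..3}" for v
  proof (cases "s v")
    case True
    then have "disk_arcs \<gamma> {1..6} n v \<subseteq> ?O" using that by (auto simp: boundary_of_def disk_step_def)
    then show ?thesis ..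
  next
    case False
    then have "(disk_arcs \<gamma> {1..6} n v)\<inverse> \<subseteq> ?O" using that by (auto simp: boundary_of_def disk_step_def)
    then show ?thesis ..
  qed
  ultimately show ?thesis unfolding boundary_orientation_def link_orientation_def by blast
qed

theorem boundary_orientation_exists:
  assumes "K4_diagram \<gamma>"
  shows "\<exists>ori. boundary_orientation \<gamma> (twist_parameter \<gamma>) ori"
proof -
  let ?n = "twist_parameter \<gamma>"
  define s where "s v = (v = 0 \<or> even (?n v))" for v
  have "sign_sum \<gamma> i j = sign_sum \<gamma> j i" for i j by (simp add: sign_sum_def insert_commute)
  then have "even (?n 1 + ?n 2 + ?n 6)" "even (?n 2 + ?n 3 + ?n 4)" "even (?n 1 + ?n 3 + ?n 5)"
    by (simp_all add: twist_parameter_def Let_def)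
  then have "surface_orientation ?n s"
    unfolding surface_orientation_def s_def
    by (auto simp: tail_def head_def)
  then show ?thesis using boundary_of_orientation assms unfolding K4_diagram_def by blast
qed

declare One_nat_def [simp]

end

theory Submission
  imports Defs
begin

text \<open>
  A half twist is resolved into an uncut band and a band cut at its tail. The stubs of a cut band,
  like a band ending on a disk that carries no other band, can be retracted: the tip of the band
  is pulled across every strand it meets by Reidemeister moves of type II, until only a disk is left.
  So the bracket of \<open>L(n\<^sub>1, \<dots>, n\<^sub>6)\<close> is a sum over the sets \<open>E\<close> of uncut bands, where an edge that
  is a leaf of \<open>E\<close> may be dropped at the price of a factor \<open>- 1 / \<phi>\<close> if the vertices off the edges are counted as
  disks; only the cycles, the \<open>\<Theta>\<close>-graphs and the whole graph survive. The crossings of two bands do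
  not contribute to the writhe, as the sides of a band are oppositely directed.

  A type II move is not carried out by deleting arcs: the two crossings are replaced by
  joins along the strands, as at a virtual crossing, so that the labels of the diagram stay fixed while
  a band is retracted. No planarity is needed.
\<close>

section \<open>Moves on planar-diagram codes\<close>

text \<open>A state enters the bracket only through the number of classes of the relation generated
  by its joins. So every move is a question of connectedness, and a label may be met by any number
  of joins: a retracted band is simply a large class of labels. On the other hand crossings form a
  set, so each relabelling has to be injective on them. The main obstacle is the numbering. Rungs
  are counted along each band, so taking out a crossing renumbers both bands through it, or one band
  at two places if it is a self-crossing. Virtual joins postpone this until the whole band is gone;
  a single quotient then does all the renumbering. Half twists sit at the tail, before all
  crossings, so a cut leaves a stub without crossings and a capped remainder. The further twists of
  the remainder are kinks, a positive one with factor \<open>- (\<A> powi (-3))\<close>. Divided by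
  the factor \<open>\<A>\<close> of an uncut positive twist this is -A^(-4), the base of the powers
  \<open>y i\<close>, and a geometric series in it produces (1 - y) / \<phi>.\<close>

abbreviation over :: "'p set \<Rightarrow> 'p crossing set" where
  "over P \<equiv> P \<times> P \<times> P \<times> P"

section \<open>Classes of the relation generated by the joins\<close>

definition conn :: "('p \<times> 'p) set \<Rightarrow> ('p \<times> 'p) set" where
  "conn J = (J \<union> J\<inverse>)\<^sup>*"

lemma conn_refl [simp]: "(p, p) \<in> conn J"
  by (simp add: conn_def)

lemma conn_trans: "(p, q) \<in> conn J \<Longrightarrow> (q, r) \<in> conn J \<Longrightarrow> (p, r) \<in> conn J"
  unfolding conn_def by (rule rtrancl_trans)

lemma conn_sym: "(p, q) \<in> conn J \<Longrightarrow> (q, p) \<in> conn J"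
  unfolding conn_def by (rule symD[OF sym_rtrancl[OF sym_Un_converse]])

lemma conn_base: "(p, q) \<in> J \<or> (q, p) \<in> J \<Longrightarrow> (p, q) \<in> conn J"
  unfolding conn_def by (rule r_into_rtrancl) blast

lemma conn_map:
  assumes "(p, q) \<in> conn J" "\<And>p q. (p, q) \<in> J \<Longrightarrow> (f p, f q) \<in> conn K"
  shows "(f p, f q) \<in> conn K"
  using assms(1) unfolding conn_def[of J]
proof induction
  case (step q r)
  then have "(f q, f r) \<in> conn K" using assms(2)[of q r] assms(2)[of r q, THEN conn_sym] by blast
  then show ?case by (rule conn_trans[OF step.IH])
qed simp

lemma conn_subset: "(p, q) \<in> conn J \<Longrightarrow> (\<And>p q. (p, q) \<in> J \<Longrightarrow> (p, q) \<in> conn K) \<Longrightarrow> (p, q) \<in> conn K"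
  using conn_map[of p q J "\<lambda>p. p" K] by simp

lemma conn_mono: "(p, q) \<in> conn J \<Longrightarrow> J \<subseteq> K \<Longrightarrow> (p, q) \<in> conn K"
  by (erule conn_subset, rule conn_base) blast

lemma components_conn: "components P J = (\<lambda>p. {q\<in>P. (p, q) \<in> conn J}) ` P"
  by (auto simp: components_def quotient_def conn_def)

lemma conn_class_eq:
  assumes "p \<in> P" "q \<in> P"
  shows "{r\<in>P. (p, r) \<in> conn J} = {r\<in>P. (q, r) \<in> conn J} \<longleftrightarrow> (p, q) \<in> conn J"
proof
  assume "{r\<in>P. (p, r) \<in> conn J} = {r\<in>P. (q, r) \<in> conn J}"
  then have "q \<in> {r\<in>P. (p, r) \<in> conn J}" using assms by auto
  then show "(p, q) \<in> conn J" by simp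
next
  assume "(p, q) \<in> conn J"
  then have "(p, r) \<in> conn J \<longleftrightarrow> (q, r) \<in> conn J" for r by (meson conn_sym conn_trans)
  then show "{r\<in>P. (p, r) \<in> conn J} = {r\<in>P. (q, r) \<in> conn J}" by simp
qed

text \<open>Both images are copies of the quotient of \<open>P\<close> by the common kernel. This
  saves an explicit bijection between the classes of two codes.\<close>

lemma card_image_same_kernel:
  assumes "\<And>p q. p \<in> P \<Longrightarrow> q \<in> P \<Longrightarrow> F p = F q \<longleftrightarrow> G p = G q"
  shows "card (F ` P) = card (G ` P)"
proof (rule bij_betw_same_card)
  define h where "h c = G (SOME p. p \<in> P \<and> F p = c)" for c
  have h: "h (F p) = G p" if "p \<in> P" for p
  proof -
    have "(SOME q. q \<in> P \<and> F q = F p) \<in> P \<and> F (SOME q. q \<in> P \<and> F q = F p) = F p"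
      by (rule someI) (use that in simp)
    then show ?thesis unfolding h_def using assms that by blast
  qed
  show "bij_betw h (F ` P) (G ` P)"
    unfolding bij_betw_def inj_on_def using h assms by (auto simp: image_image)
qed

text \<open>\<open>f\<close> and \<open>g\<close> induce mutually inverse maps of classes, as a
  homotopy equivalence of graphs does: joins go to connections, and the composites move each label
  within its class. Neither map has to be injective, so one code may have many more labels than the
  other.\<close>

lemma card_components_equiv:
  assumes "f ` P \<subseteq> P'" "g ` P' \<subseteq> P"
    and "\<And>p q. (p, q) \<in> J \<Longrightarrow> (f p, f q) \<in> conn J'"
    and "\<And>p q. (p, q) \<in> J' \<Longrightarrow> (g p, g q) \<in> conn J"
    and "\<And>p. p \<in> P \<Longrightarrow> (g (f p), p) \<in> conn J"
    and "\<And>p. p \<in> P' \<Longrightarrow> (f (g p), p) \<in> conn J'"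
  shows "card (components P J) = card (components P' J')"
proof -
  let ?F = "\<lambda>p. {q\<in>P. (p, q) \<in> conn J}" and ?G = "\<lambda>p. {q\<in>P'. (p, q) \<in> conn J'}"
  have k: "(p, q) \<in> conn J \<longleftrightarrow> (f p, f q) \<in> conn J'" if "p \<in> P" "q \<in> P" for p q
  proof
    assume "(f p, f q) \<in> conn J'"
    then have "(g (f p), g (f q)) \<in> conn J" using assms(4) by (rule conn_map)
    then show "(p, q) \<in> conn J" using assms(5) that by (meson conn_sym conn_trans)
  qed (rule conn_map, assumption, rule assms(3))
  have "card (?F ` P) = card ((?G \<circ> f) ` P)"
  proof (rule card_image_same_kernel)
    fix p q assume "p \<in> P" "q \<in> P"
    moreover from this have "f p \<in> P'" "f q \<in> P'" using assms(1) by auto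
    ultimately show "?F p = ?F q \<longleftrightarrow> (?G \<circ> f) p = (?G \<circ> f) q"
      by (simp add: conn_class_eq k)
  qed
  also have "(?G \<circ> f) ` P = ?G ` P'"
  proof
    show "?G ` P' \<subseteq> (?G \<circ> f) ` P"
    proof
      fix C assume "C \<in> ?G ` P'"
      then obtain p where p: "p \<in> P'" "C = ?G p" by auto
      have "g p \<in> P" "f (g p) \<in> P'" using p assms(1,2) by auto
      then have "?G (f (g p)) = ?G p" using p assms(6) by (simp add: conn_class_eq)
      then show "C \<in> (?G \<circ> f) ` P" using p \<open>g p \<in> P\<close> by (auto intro!: image_eqI[of _ _ "g p"])
    qed
  qed (use assms(1) in auto)
  finally show ?thesis by (simp add: components_conn)
qed

section \<open>The bracket under relabelling\<close>

abbreviation br :: "'p set \<Rightarrow> 'p crossing set \<Rightarrow> ('p \<times> 'p) set \<Rightarrow> int poly fract" where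
  "br P X J \<equiv> bracket \<lparr>labels = P, crossings = X, joins = J\<rparr>"

fun map_crossing :: "('p \<Rightarrow> 'q) \<Rightarrow> 'p crossing \<Rightarrow> 'q crossing" where
  "map_crossing f (a, b, c, d) = (f a, f b, f c, f d)"

lemma smoothing_map_crossing:
  "plus_smoothing (map_crossing f x) = map_prod f f ` plus_smoothing x"
  "minus_smoothing (map_crossing f x) = map_prod f f ` minus_smoothing x"
  by (cases x; auto)+

lemma smoothing_labels:
  assumes "x \<in> over P" "(p, q) \<in> plus_smoothing x \<union> minus_smoothing x"
  shows "p \<in> P \<and> q \<in> P"
  using assms by (cases x) auto

text \<open>Smoothing commutes with relabelling, so a state \<open>S\<close> corresponds to its
  image under \<open>map_crossing f\<close>, and both have the same number of circles by
  \<open>card_components_equiv\<close>. Injectivity on \<open>X\<close> keeps two crossings from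
  merging, which would lose states.\<close>

theorem br_equiv:
  assumes fP: "f ` P \<subseteq> P'" and gP: "g ` P' \<subseteq> P"
    and X: "X \<subseteq> over P" "inj_on (map_crossing f) X"
    and fJ: "\<And>p q. (p, q) \<in> J \<Longrightarrow> (f p, f q) \<in> conn J'"
    and gJ: "\<And>p q. (p, q) \<in> J' \<Longrightarrow> (g p, g q) \<in> conn J"
    and gf: "\<And>p. p \<in> P \<Longrightarrow> (g (f p), p) \<in> conn J"
    and fg: "\<And>p. p \<in> P' \<Longrightarrow> (f (g p), p) \<in> conn J'"
  shows "br P X J = br P' (map_crossing f ` X) J'"
proof -
  let ?m = "map_crossing f"
  let ?D = "\<lparr>labels = P, crossings = X, joins = J\<rparr>" and ?D' = "\<lparr>labels = P', crossings = ?m ` X, joins = J'\<rparr>"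
  have c: "state_circles ?D S = state_circles ?D' (?m ` S)" if S: "S \<subseteq> X" for S
  proof -
    let ?s = "(\<Union>x\<in>S. plus_smoothing x) \<union> (\<Union>x\<in>X - S. minus_smoothing x)"
    have "?m ` X - ?m ` S = ?m ` (X - S)" using X(2) S by (simp add: inj_on_image_set_diff)
    then have e: "(\<Union>x\<in>?m ` S. plus_smoothing x) \<union> (\<Union>x\<in>?m ` X - ?m ` S. minus_smoothing x) = map_prod f f ` ?s"
      by (auto simp: smoothing_map_crossing)
    have s: "p \<in> P \<and> q \<in> P" if "(p, q) \<in> ?s" for p q
      using that S X(1) smoothing_labels[of _ P p q] by blast
    have "card (components P (J \<union> ?s)) = card (components P' (J' \<union> map_prod f f ` ?s))"
    proof (rule card_components_equiv[OF fP gP])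
      fix p q assume "(p, q) \<in> J \<union> ?s"
      then show "(f p, f q) \<in> conn (J' \<union> map_prod f f ` ?s)"
      proof
        assume "(p, q) \<in> J" then show ?thesis by (rule conn_mono[OF fJ]) blast
      next
        assume "(p, q) \<in> ?s"
        then have "(f p, f q) \<in> map_prod f f ` ?s" by (rule map_prod_imageI)
        then show ?thesis by (intro conn_base) blast
      qed
    next
      fix p q assume "(p, q) \<in> J' \<union> map_prod f f ` ?s"
      then show "(g p, g q) \<in> conn (J \<union> ?s)"
      proof
        assume "(p, q) \<in> J'" then show ?thesis by (rule conn_mono[OF gJ]) blast
      next
        assume "(p, q) \<in> map_prod f f ` ?s"
        then obtain p' q' where pq: "(p', q') \<in> ?s" "p = f p'" "q = f q'" by auto
        \<comment> \<open>\<open>g\<close> undoes \<open>f\<close> only up to connection, so the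
          path goes from \<open>g p\<close> to \<open>p'\<close>, across the smoothing, and back
          from \<open>q'\<close> to \<open>g q\<close>.\<close>
        have "(g p, p') \<in> conn (J \<union> ?s)" "(g q, q') \<in> conn (J \<union> ?s)"
          unfolding pq using s[OF pq(1)] by (auto intro!: conn_mono[OF gf])
        moreover have "(p', q') \<in> conn (J \<union> ?s)" using pq(1) by (intro conn_base) blast
        ultimately show ?thesis by (meson conn_sym conn_trans)
      qed
    next
      show "p \<in> P \<Longrightarrow> (g (f p), p) \<in> conn (J \<union> ?s)" for p by (rule conn_mono[OF gf]) auto
      show "p \<in> P' \<Longrightarrow> (f (g p), p) \<in> conn (J' \<union> map_prod f f ` ?s)" for p by (rule conn_mono[OF fg]) auto
    qed
    then show ?thesis using e by (simp add: state_circles_def Un_assoc)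
  qed
  have "bracket ?D' = (\<Sum>S\<in>(`) ?m ` Pow X. \<A> powi (int (card S) - int (card (?m ` X - S))) *
     (- \<A>\<^sup>2 - \<A> powi (-2)) powi (int (state_circles ?D' S) - 1))"
    by (simp add: bracket_def image_Pow_surj)
  also have "\<dots> = (\<Sum>S\<in>Pow X. \<A> powi (int (card (?m ` S)) - int (card (?m ` X - ?m ` S))) *
     (- \<A>\<^sup>2 - \<A> powi (-2)) powi (int (state_circles ?D' (?m ` S)) - 1))"
    using X(2) by (subst sum.reindex) (auto intro: inj_on_image_Pow)
  also have "\<dots> = bracket ?D"
    unfolding bracket_def link_diagram.simps
  proof (intro sum.cong refl)
    fix S assume "S \<in> Pow X"
    then have S: "S \<subseteq> X" by simp
    then have "?m ` X - ?m ` S = ?m ` (X - S)" using X(2) by (simp add: inj_on_image_set_diff)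
    moreover have "card (?m ` S) = card S" "card (?m ` (X - S)) = card (X - S)"
      using X(2) S by (meson card_image inj_on_subset Diff_subset)+
    ultimately show "\<A> powi (int (card (?m ` S)) - int (card (?m ` X - ?m ` S))) *
        (- \<A>\<^sup>2 - \<A> powi (-2)) powi (int (state_circles ?D' (?m ` S)) - 1) =
        \<A> powi (int (card S) - int (card (X - S))) *
        (- \<A>\<^sup>2 - \<A> powi (-2)) powi (int (state_circles ?D S) - 1)"
      using c[OF S] by simp
  qed
  finally show ?thesis by simp
qed

lemma map_crossing_ident: "x \<in> over P \<Longrightarrow> (\<And>p. p \<in> P \<Longrightarrow> f p = p) \<Longrightarrow> map_crossing f x = x"
  by (cases x) auto

text \<open>A deformation retraction: labels outside \<open>P0\<close> carry no crossing and are
  slid along joins into \<open>P0\<close>; the inclusion is the inverse.\<close>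

lemma br_contract:
  assumes "P0 \<subseteq> P" "f ` P \<subseteq> P0" "\<And>p. p \<in> P0 \<Longrightarrow> f p = p" "X \<subseteq> over P0"
    and "\<And>p q. (p, q) \<in> J \<Longrightarrow> (f p, f q) \<in> conn J'"
    and "\<And>p q. (p, q) \<in> J' \<Longrightarrow> (p, q) \<in> conn J"
    and "\<And>p. p \<in> P \<Longrightarrow> (f p, p) \<in> conn J"
  shows "br P X J = br P0 X J'"
proof -
  have m: "map_crossing f x = x" if "x \<in> X" for x
    using assms(3,4) that by (intro map_crossing_ident[of _ P0]) auto
  have "br P X J = br P0 (map_crossing f ` X) J'"
  proof (rule br_equiv[where g = "\<lambda>p. p"])
    show "X \<subseteq> over P" using assms(1,4) by blast
    show "inj_on (map_crossing f) X" using m by (simp add: inj_on_def)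
  qed (use assms in auto)
  also have "map_crossing f ` X = X" using m by simp
  finally show ?thesis .
qed

text \<open>Only the equivalence relation generated by the joins enters the state sum.\<close>

lemma br_joins_cong:
  assumes "X \<subseteq> over P"
    and "\<And>p q. (p, q) \<in> J \<Longrightarrow> (p, q) \<in> conn J'"
    and "\<And>p q. (p, q) \<in> J' \<Longrightarrow> (p, q) \<in> conn J"
  shows "br P X J = br P X J'"
  by (rule br_contract[where f = "\<lambda>p. p"]) (use assms in auto)

text \<open>For a map that identifies labels instead of sliding them into a subset. The fibres are
  connected, so any choice of representatives is an inverse up to connection.\<close>

lemma br_quotient:
  assumes fP: "f ` P = P'" and X: "X \<subseteq> over P" "inj_on (map_crossing f) X" "map_crossing f ` X = X'"
    and fJ: "\<And>p q. (p, q) \<in> J \<Longrightarrow> (f p, f q) \<in> conn J'"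
    and gJ: "\<And>p' q'. (p', q') \<in> J' \<Longrightarrow> \<exists>p\<in>P. \<exists>q\<in>P. f p = p' \<and> f q = q' \<and> (p, q) \<in> conn J"
    and fib: "\<And>p q. p \<in> P \<Longrightarrow> q \<in> P \<Longrightarrow> f p = f q \<Longrightarrow> (p, q) \<in> conn J"
  shows "br P X J = br P' X' J'"
proof -
  define g where "g = inv_into P f"
  have g: "g p \<in> P" "f (g p) = p" if "p \<in> P'" for p
    using that fP by (auto simp: g_def inv_into_into f_inv_into_f)
  have gf: "(g (f p), p) \<in> conn J" if "p \<in> P" for p
    using that g[of "f p"] fP by (intro fib) auto
  have "br P X J = br P' (map_crossing f ` X) J'"
  proof (rule br_equiv[where g = g])
    fix p' q' assume "(p', q') \<in> J'"
    then obtain p q where "p \<in> P" "q \<in> P" "f p = p'" "f q = q'" "(p, q) \<in> conn J" using gJ by metis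
    then show "(g p', g q') \<in> conn J" using gf by (metis conn_sym conn_trans)
  qed (use assms g gf in auto)
  then show ?thesis using X(3) by simp
qed

section \<open>Split circles, the skein relation and the type II move\<close>

abbreviation \<delta> :: "int poly fract" where "\<delta> \<equiv> - \<A>\<^sup>2 - \<A> powi (-2)"

text \<open>\<open>Q\<close> counts as one circle as soon as it is connected and closed off from
  \<open>P\<close>, whatever the number of joins at its labels. A whole retracted band can be split
  off in this way.\<close>

lemma br_circle:
  assumes "finite P" "J \<subseteq> P \<times> P" "X \<subseteq> over P"
    and Q: "P \<inter> Q = {}" "Z \<subseteq> Q \<times> Q" "c \<in> Q" "\<And>q. q \<in> Q \<Longrightarrow> (c, q) \<in> conn Z"
  shows "br (P \<union> Q) X (J \<union> Z) = \<delta> * br P X J"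
proof -
  have "(p, q) \<in> conn Z" if "p \<in> Q" "q \<in> Q" for p q
    using Q(4)[OF that(1)] Q(4)[OF that(2)] by (meson conn_sym conn_trans)
  then have "{q\<in>Q. (p, q) \<in> conn Z} = Q" if "p \<in> Q" for p using that by blast
  then have "components Q Z = {Q}" using Q(3) unfolding components_conn by force
  then show ?thesis
    using bracket_disjoint_circle[of "\<lparr>labels = P, crossings = X, joins = J\<rparr>" Q Z] assms
    by (simp add: link_arcs_valid_def)
qed

text \<open>\<open>shape b x u w u' w'\<close>: the smoothing of sign \<open>b\<close> joins \<open>u\<close> with \<open>w\<close> and \<open>u'\<close> with \<open>w'\<close>,
  and the strands are \<open>u u'\<close> and \<open>w w'\<close>.\<close>

fun shape :: "bool \<Rightarrow> 'p crossing \<Rightarrow> 'p \<Rightarrow> 'p \<Rightarrow> 'p \<Rightarrow> 'p \<Rightarrow> bool" where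
  "shape True (a, b, c, d) u w u' w' \<longleftrightarrow>
     (u, w, u', w') \<in> {(a, d, c, b), (d, a, b, c), (c, b, a, d), (b, c, d, a)}"
| "shape False (a, b, c, d) u w u' w' \<longleftrightarrow>
     (u, w, u', w') \<in> {(a, b, c, d), (b, a, d, c), (c, d, a, b), (d, c, b, a)}"

fun virtual_joins :: "'p crossing \<Rightarrow> ('p \<times> 'p) set" where
  "virtual_joins (a, b, c, d) = {(a, c), (b, d)}"

definition weight :: "bool \<Rightarrow> int poly fract" where
  "weight b = \<A> powi (if b then 1 else -1)"

text \<open>Running backwards along one strand exchanges its ends and with them the two smoothings.
  This serves a band that is retracted from its head.\<close>

lemma shape_reverse: "shape b x u w u' w' \<Longrightarrow> shape (\<not> b) x u' w u w'"
  by (cases x; cases b) auto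

lemma shape_labels: "shape b x u w u' w' \<Longrightarrow> x \<in> over P \<longleftrightarrow> {u, w, u', w'} \<subseteq> P"
  by (cases x; cases b) auto

lemma shape_virtual: "shape b x u w u' w' \<Longrightarrow>
   virtual_joins x \<union> (virtual_joins x)\<inverse> = {(u, u'), (w, w')} \<union> {(u, u'), (w, w')}\<inverse>"
  by (cases x; cases b) auto

lemma conn_Un_symcl:
  assumes "S \<union> S\<inverse> = T \<union> T\<inverse>"
  shows "conn (J \<union> S) = conn (J \<union> T)"
proof -
  have "(J \<union> S) \<union> (J \<union> S)\<inverse> = (J \<union> T) \<union> (J \<union> T)\<inverse>" using assms by blast
  then show ?thesis by (simp add: conn_def)
qed

lemma br_conn_cong:
  assumes "X \<subseteq> over P" "conn J = conn J'"
  shows "br P X J = br P X J'"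
proof (rule br_joins_cong[OF assms(1)])
  show "(p, q) \<in> J \<Longrightarrow> (p, q) \<in> conn J'" for p q
    unfolding assms(2)[symmetric] by (rule conn_base) simp
  show "(p, q) \<in> J' \<Longrightarrow> (p, q) \<in> conn J" for p q
    unfolding assms(2) by (rule conn_base) simp
qed

text \<open>Phrased through \<open>shape\<close>, so that at the place of use neither the position
  of the overstrand nor the sign of a smoothing has to be known.\<close>

lemma br_skein:
  assumes X: "finite X" "x \<notin> X" "X \<subseteq> over P" "shape b x u w u' w'"
  shows "br P (insert x X) J = weight b * br P X (J \<union> {(u, w), (u', w')})
                        + weight (\<not> b) * br P X (J \<union> {(u, w'), (u', w)})"
proof -
  let ?D = "\<lparr>labels = P, crossings = insert x X, joins = J\<rparr>"
  have X': "insert x X - {x} = X" using X by auto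
  have sk: "bracket ?D = \<A> * br P X (J \<union> plus_smoothing x) + \<A> powi (-1) * br P X (J \<union> minus_smoothing x)"
    using bracket_skein[of ?D x] X(1) X' by (simp add: smooth_plus_def smooth_minus_def)
  obtain a b' c d where x: "x = (a, b', c, d)" by (rule prod_cases4)
  have pm: "plus_smoothing x \<union> (plus_smoothing x)\<inverse> =
      (if b then {(u, w), (u', w')} \<union> {(u, w), (u', w')}\<inverse> else {(u, w'), (u', w)} \<union> {(u, w'), (u', w)}\<inverse>)"
    "minus_smoothing x \<union> (minus_smoothing x)\<inverse> =
      (if b then {(u, w'), (u', w)} \<union> {(u, w'), (u', w)}\<inverse> else {(u, w), (u', w')} \<union> {(u, w), (u', w')}\<inverse>)"
    using X(4) unfolding x by (cases b; auto)+
  note cong = br_conn_cong[OF X(3) conn_Un_symcl]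
  show ?thesis
  proof (cases b)
    case True
    have "br P X (J \<union> plus_smoothing x) = br P X (J \<union> {(u, w), (u', w')})"
      by (rule cong) (simp only: pm True if_True)
    moreover have "br P X (J \<union> minus_smoothing x) = br P X (J \<union> {(u, w'), (u', w)})"
      by (rule cong) (simp only: pm True if_True)
    ultimately show ?thesis using sk True by (simp add: weight_def)
  next
    case False
    have "br P X (J \<union> plus_smoothing x) = br P X (J \<union> {(u, w'), (u', w)})"
      by (rule cong) (simp only: pm False if_False)
    moreover have "br P X (J \<union> minus_smoothing x) = br P X (J \<union> {(u, w), (u', w')})"
      by (rule cong) (simp only: pm False if_False)
    ultimately show ?thesis using sk False by (simp add: weight_def)
  qed
qed

text \<open>The two relations behind invariance under type II moves, A A^(-1) = 1 and A^2 + A^(-2) =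
  -\<delta>, in a form that is symmetric in the two smoothings.\<close>

lemma weight_identities:
  "weight b * weight (\<not> b) = 1" "weight b * weight b + weight (\<not> b) * weight (\<not> b) = - \<delta>"
  using A_nonzero by (auto simp: weight_def power_int_minus power2_eq_square field_simps)

text \<open>No join straddles \<open>A\<close> and \<open>K\<close>, so a path that starts in
  \<open>K\<close> never leaves it.\<close>

lemma conn_component:
  assumes "(p, q) \<in> conn J" "p \<in> K" "J \<subseteq> A \<times> A \<union> K \<times> K" "A \<inter> K = {}"
  shows "(p, q) \<in> conn (J \<inter> K \<times> K)"
proof -
  let ?K = "J \<inter> K \<times> K" and ?A = "J \<inter> A \<times> A"
  have "J \<union> J\<inverse> = (?K \<union> ?K\<inverse>) \<union> (?A \<union> ?A\<inverse>)" using assms(3) by blast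
  then have "(p, q) \<in> ((?K \<union> ?K\<inverse>) \<union> (?A \<union> ?A\<inverse>))\<^sup>*" using assms(1) by (simp only: conn_def)
  then have "(p, q) \<in> (?K \<union> ?K\<inverse>)\<^sup>*"
    by (rule rtrancl_in_component[where P = K and Q = A, THEN conjunct2]) (use assms in auto)
  then show ?thesis by (simp add: conn_def)
qed

text \<open>The tip of the band is the connected set \<open>K\<close>; its sides go on from
  \<open>n1\<close> to \<open>f1\<close> and from \<open>n2\<close> to \<open>f2\<close>, and the
  strand \<open>s0 s1 s2\<close> passes across both. Three of the four states reconnect the ends as
  \<open>E1\<close>, one of them with an extra circle, and their weights add up to 0. The fourth has
  weight 1 and reconnects the ends as two virtual crossings do. The common \<open>b\<close>
  expresses that the strand lies over both sides or under both.\<close>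

theorem br_reidemeister2:
  assumes fin: "finite X" "finite P" and xy: "x \<notin> X" "y \<notin> X" "x \<noteq> y"
    and K: "K \<subseteq> P" "s1 \<in> P" "s1 \<notin> K" and P0: "P0 = P - insert s1 K"
    and X: "X \<subseteq> over P0" and J: "J \<subseteq> P0 \<times> P0 \<union> K \<times> K"
    and cK: "\<And>p. p \<in> K \<Longrightarrow> (n1, p) \<in> conn J"
    and ends: "n1 \<in> K" "n2 \<in> K" "s0 \<in> P0" "s2 \<in> P0" "f1 \<in> P0" "f2 \<in> P0"
    and sx: "shape b x n1 s0 f1 s1" and sy: "shape b y n2 s1 f2 s2"
  shows "br P (insert x (insert y X)) J = br P X (J \<union> virtual_joins x \<union> virtual_joins y)"
proof -
  define E1 where "E1 = br P0 X (J \<inter> P0 \<times> P0 \<union> {(s0, f1), (f2, s2)})"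
  define E2 where "E2 = br P0 X (J \<inter> P0 \<times> P0 \<union> {(s0, s2), (f1, f2)})"
  \<comment> \<open>In all states but \<open>ba\<close>, and in the virtual one, tip and middle arc
    hang on the rest of the diagram: \<open>h a c\<close> slides \<open>K\<close> to
    \<open>a\<close> and \<open>s1\<close> to \<open>c\<close>.\<close>
  define h where "h a c p = (if p \<in> K then a else if p = s1 then c else p)" for a c p
  have h: "h a c p = p" if "p \<in> P0" for a c p using that by (simp add: h_def P0)
  have hK: "h a c p = a" if "p \<in> K" for a c p using that by (simp add: h_def)
  have hs: "h a c s1 = c" for a c using K by (simp add: h_def)
  have PP: "P0 \<subseteq> P" "X \<subseteq> over P" "s1 \<in> P" "n1 \<in> P" "n2 \<in> P" using P0 X K ends by blast+
  have x4: "insert y X \<subseteq> over P" using PP ends shape_labels[OF sy, of P] by auto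
  have con: "br P X (J \<union> Z) = br P0 X (J \<inter> P0 \<times> P0 \<union> Z')"
    if "a \<in> P0" "c \<in> P0" "\<And>p q. (p, q) \<in> Z \<Longrightarrow> (h a c p, h a c q) \<in> conn Z'"
      "\<And>p q. (p, q) \<in> Z' \<Longrightarrow> (p, q) \<in> conn (J \<union> Z)"
      "(a, n1) \<in> conn (J \<union> Z)" "(c, s1) \<in> conn (J \<union> Z)" for Z Z' a c
  proof (rule br_contract[where f = "h a c", OF PP(1) _ h X])
    note ZZ = that(4) and ZZ3 = that(3) and ca = that(5) and cs = that(6)
    show "h a c ` P \<subseteq> P0" using that by (auto simp: h_def P0)
    fix p q
    show "(h a c p, h a c q) \<in> conn (J \<inter> P0 \<times> P0 \<union> Z')" if pq: "(p, q) \<in> J \<union> Z"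
      using pq
    proof
      assume "(p, q) \<in> J"
      then consider "p \<in> P0" "q \<in> P0" "(p, q) \<in> J" | "p \<in> K" "q \<in> K" using J by blast
      then show ?thesis by cases (auto simp: h hK intro: conn_base)
    next
      assume "(p, q) \<in> Z" then show ?thesis by (rule conn_mono[OF ZZ3]) blast
    qed
    show "(p, q) \<in> conn (J \<union> Z)" if "(p, q) \<in> J \<inter> P0 \<times> P0 \<union> Z'"
      using that by (auto intro: ZZ conn_base)
    show "(h a c p, p) \<in> conn (J \<union> Z)" if pP: "p \<in> P"
    proof -
      consider "p \<in> K" | "p = s1" | "p \<in> P0" using pP P0 by blast
      then show ?thesis
      proof cases
        case 1
        then have "(n1, p) \<in> conn (J \<union> Z)" by (rule conn_mono[OF cK]) blast
        then show ?thesis unfolding hK[OF 1] by (rule conn_trans[OF ca])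
      qed (use cs in \<open>simp_all add: h hs\<close>)
    qed
  qed
  have n12: "(n1, n2) \<in> conn (J \<union> Z)" for Z
    by (rule conn_mono[OF cK[OF ends(2)]]) simp
  note n12 = n12 n12[THEN conn_sym]
  have st: "(p, q) \<in> conn (J \<union> Z)" if "(p, q) \<in> Z \<or> (q, p) \<in> Z" for p q Z
    using that by (intro conn_base) auto
  note ct = conn_trans[of _ _ "J \<union> Z" for Z]
  have aa: "br P X (J \<union> {(n1, s0), (f1, s1)} \<union> {(n2, s1), (f2, s2)}) = E1"
    unfolding E1_def Un_assoc
  proof (rule con[of s0 s0])
    let ?Z = "{(n1, s0), (f1, s1)} \<union> {(n2, s1), (f2, s2)}"
    have 1: "(s0, n1) \<in> conn (J \<union> ?Z)" "(n2, s1) \<in> conn (J \<union> ?Z)" "(s1, f1) \<in> conn (J \<union> ?Z)" "(f2, s2) \<in> conn (J \<union> ?Z)"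
      by (rule st; simp)+
    show "(s0, n1) \<in> conn (J \<union> ?Z)" by fact
    show s: "(s0, s1) \<in> conn (J \<union> ?Z)" using ct[OF ct[OF 1(1) n12(1)] 1(2)] .
    show "(p, q) \<in> conn (J \<union> ?Z)" if "(p, q) \<in> {(s0, f1), (f2, s2)}" for p q
      using that ct[OF s 1(3)] 1(4) by auto
  qed (use ends in \<open>auto simp: h hs hK intro: conn_base\<close>)
  have bb: "br P X (J \<union> {(n1, s1), (f1, s0)} \<union> {(n2, s2), (f2, s1)}) = E1"
    unfolding E1_def Un_assoc
  proof (rule con[of s2 s2])
    let ?Z = "{(n1, s1), (f1, s0)} \<union> {(n2, s2), (f2, s1)}"
    have 1: "(s2, n2) \<in> conn (J \<union> ?Z)" "(n1, s1) \<in> conn (J \<union> ?Z)" "(s1, f2) \<in> conn (J \<union> ?Z)" "(s0, f1) \<in> conn (J \<union> ?Z)"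
      by (rule st; simp)+
    show n: "(s2, n1) \<in> conn (J \<union> ?Z)" using ct[OF 1(1) n12(2)] .
    show s: "(s2, s1) \<in> conn (J \<union> ?Z)" using ct[OF n 1(2)] .
    show "(p, q) \<in> conn (J \<union> ?Z)" if "(p, q) \<in> {(s0, f1), (f2, s2)}" for p q
      using that conn_sym[OF ct[OF s 1(3)]] 1(4) by auto
  qed (use ends in \<open>auto simp: h hs hK intro: conn_base\<close>)
  have ab: "br P X (J \<union> {(n1, s0), (f1, s1)} \<union> {(n2, s2), (f2, s1)}) = E2"
    unfolding E2_def Un_assoc
  proof (rule con[of s0 f1])
    let ?Z = "{(n1, s0), (f1, s1)} \<union> {(n2, s2), (f2, s1)}"
    have 1: "(s0, n1) \<in> conn (J \<union> ?Z)" "(n2, s2) \<in> conn (J \<union> ?Z)" "(f1, s1) \<in> conn (J \<union> ?Z)" "(s1, f2) \<in> conn (J \<union> ?Z)"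
      by (rule st; simp)+
    show "(s0, n1) \<in> conn (J \<union> ?Z)" "(f1, s1) \<in> conn (J \<union> ?Z)" by fact+
    show "(p, q) \<in> conn (J \<union> ?Z)" if "(p, q) \<in> {(s0, s2), (f1, f2)}" for p q
      using that ct[OF ct[OF 1(1) n12(1)] 1(2)] ct[OF 1(3,4)] by auto
  qed (use ends in \<open>auto simp: h hs hK intro: conn_base\<close>)
  have virt: "br P X (J \<union> {(n1, f1), (s0, s1)} \<union> {(n2, f2), (s1, s2)}) = E2"
    unfolding E2_def Un_assoc
  proof (rule con[of f1 s0])
    let ?Z = "{(n1, f1), (s0, s1)} \<union> {(n2, f2), (s1, s2)}"
    have 1: "(f1, n1) \<in> conn (J \<union> ?Z)" "(s0, s1) \<in> conn (J \<union> ?Z)" "(n2, f2) \<in> conn (J \<union> ?Z)" "(s1, s2) \<in> conn (J \<union> ?Z)"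
      by (rule st; simp)+
    show "(f1, n1) \<in> conn (J \<union> ?Z)" "(s0, s1) \<in> conn (J \<union> ?Z)" by fact+
    show "(p, q) \<in> conn (J \<union> ?Z)" if "(p, q) \<in> {(s0, s2), (f1, f2)}" for p q
      using that ct[OF ct[OF 1(1) n12(1)] 1(3)] ct[OF 1(2,4)] by auto
  qed (use ends in \<open>auto simp: h hs hK intro: conn_base\<close>)
  \<comment> \<open>Here \<open>K\<close> and \<open>s1\<close> are connected with each other and
    with nothing else: this is the extra circle.\<close>
  have ba: "br P X (J \<union> {(n1, s1), (f1, s0)} \<union> {(n2, s1), (f2, s2)}) = \<delta> * E1"
  proof -
    let ?Q = "insert s1 K" and ?Z = "J \<inter> K \<times> K \<union> {(n1, s1), (n2, s1)}"
    have JJ: "J = J \<inter> P0 \<times> P0 \<union> J \<inter> K \<times> K" using J by blast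
    have P: "P = P0 \<union> ?Q" using P0 K by blast
    have cZ: "(n1, q) \<in> conn ?Z" if "q \<in> K" for q
    proof -
      have "(n1, q) \<in> conn (J \<inter> K \<times> K)"
        by (rule conn_component[OF cK[OF that] ends(1) J]) (auto simp: P0)
      then show ?thesis by (rule conn_mono) blast
    qed
    have "br (P0 \<union> ?Q) X ((J \<inter> P0 \<times> P0 \<union> {(s0, f1), (f2, s2)}) \<union> ?Z) = \<delta> * E1"
      unfolding E1_def
    proof (rule br_circle[where c = n1])
      show "finite P0" using fin P0 by simp
      show "(n1, q) \<in> conn ?Z" if "q \<in> ?Q" for q
        using that cZ by (auto intro: conn_base)
    qed (use ends X K P0 in auto)
    moreover have "br P X (J \<union> {(n1, s1), (f1, s0)} \<union> {(n2, s1), (f2, s2)}) =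
        br P X ((J \<inter> P0 \<times> P0 \<union> {(s0, f1), (f2, s2)}) \<union> ?Z)"
      by (rule br_joins_cong[OF PP(2)]) (use JJ in \<open>auto intro: conn_base\<close>)
    ultimately show ?thesis using P by simp
  qed
  have Xx: "finite (insert y X)" "x \<notin> insert y X" using fin xy by auto
  note y = br_skein[OF fin(1) xy(2) PP(2) sy]
  have "br P (insert x (insert y X)) J =
      weight b * weight b * E1 + weight b * weight (\<not> b) * E2
    + (weight b * weight (\<not> b) * (\<delta> * E1) + weight (\<not> b) * weight (\<not> b) * E1)"
    unfolding br_skein[OF Xx x4 sx] y aa bb ab ba by (simp only: ring_distribs mult.assoc mult.commute mult.left_commute)
  also have "\<dots> = (weight b * weight b + weight (\<not> b) * weight (\<not> b)) * E1 + (weight b * weight (\<not> b)) * (E2 + \<delta> * E1)"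
    by (simp only: ring_distribs mult.assoc mult.commute mult.left_commute add_ac)
  also have "\<dots> = E2"
  proof -
    have "- d * E1 + 1 * (E2 + d * E1) = E2" for d by simp
    then show ?thesis unfolding weight_identities .
  qed
  also have "\<dots> = br P X (J \<union> virtual_joins x \<union> virtual_joins y)"
  proof -
    have "conn ((J \<union> {(n1, f1), (s0, s1)}) \<union> {(n2, f2), (s1, s2)}) = conn ((J \<union> {(n1, f1), (s0, s1)}) \<union> virtual_joins y)"
      by (intro conn_Un_symcl) (rule shape_virtual[OF sy, symmetric])
    also have "\<dots> = conn ((J \<union> virtual_joins y) \<union> {(n1, f1), (s0, s1)})" by (simp add: Un_ac)
    also have "\<dots> = conn ((J \<union> virtual_joins y) \<union> virtual_joins x)"
      by (intro conn_Un_symcl) (rule shape_virtual[OF sx, symmetric])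
    finally show ?thesis unfolding virt[symmetric] by (intro br_conn_cong[OF PP(2)]) (simp add: Un_ac)
  qed
  finally show ?thesis .
qed

section \<open>The structure of band diagrams\<close>

declare split_paired_Ex [simp del] split_paired_All [simp del]

type_synonym spatial_graph = "nat \<Rightarrow> real \<Rightarrow> complex \<times> real"

definition band_labels :: "spatial_graph \<Rightarrow> nat set \<Rightarrow> (nat \<Rightarrow> int) \<Rightarrow> band_arc set" where
  "band_labels \<gamma> E n = labels (band_diagram \<gamma> E n)"

definition twists :: "nat set \<Rightarrow> (nat \<Rightarrow> int) \<Rightarrow> band_arc crossing set" where
  "twists E n = {twist_crossing n i k | i k. i \<in> E \<and> k < nat \<bar>n i\<bar>}"

definition band_crossings :: "spatial_graph \<Rightarrow> nat set \<Rightarrow> (nat \<Rightarrow> int) \<Rightarrow>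
    graph_crossing set \<Rightarrow> band_arc crossing set" where
  "band_crossings \<gamma> E n Y = {band_crossing \<gamma> E n x \<sigma> \<tau> | x \<sigma> \<tau>. x \<in> Y}"

text \<open>The successor relation \<open>W\<close> at the vertices is a parameter:
  \<open>next_edge\<close> gives the joins of the band diagram, \<open>detached\<close> those of the
  diagram in which one band ends on a cap.\<close>

definition vertex_joins :: "spatial_graph \<Rightarrow> nat set \<Rightarrow> (nat \<Rightarrow> int) \<Rightarrow>
    (nat \<Rightarrow> nat \<Rightarrow> nat \<Rightarrow> bool) \<Rightarrow> (band_arc \<times> band_arc) set" where
  "vertex_joins \<gamma> E n W =
     {(left_end \<gamma> E n u a, right_end \<gamma> E n u b) | u a b. u \<in> {0..3} \<and> W u a b}"

lemma bracket_band_diagram: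
  "bracket (band_diagram \<gamma> E n) =
     br (band_labels \<gamma> E n) (twists E n \<union> band_crossings \<gamma> E n (sub_crossings \<gamma> E)) (vertex_joins \<gamma> E n (next_edge \<gamma> E))"
proof -
  have "vertex_joins \<gamma> E n (next_edge \<gamma> E) = (\<Union>v\<in>{0..3}. disk_arcs \<gamma> E n v)"
    unfolding vertex_joins_def disk_arcs_def by blast
  then show ?thesis
    by (simp add: band_labels_def twists_def band_crossings_def band_diagram_def)
qed

lemma Rung_band_labels [simp]: "Rung j m \<sigma> \<in> band_labels \<gamma> E n \<longleftrightarrow> j \<in> E \<and> m \<le> last_rung \<gamma> E n j"
  by (simp add: band_labels_def band_diagram_def)

lemma mid_band_labels [simp]: "mid x b \<sigma> \<in> band_labels \<gamma> E n \<longleftrightarrow> x \<in> sub_crossings \<gamma> E"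
  by (simp add: band_labels_def band_diagram_def mid.simps)

lemma band_labels_cases:
  assumes "p \<in> band_labels \<gamma> E n"
  obtains j m \<sigma> where "p = Rung j m \<sigma>" "j \<in> E" "m \<le> last_rung \<gamma> E n j"
  | x b \<sigma> where "p = mid x b \<sigma>" "x \<in> sub_crossings \<gamma> E"
proof -
  from assms consider j m \<sigma> where "p = Rung j m \<sigma>" "j \<in> E" "m \<le> last_rung \<gamma> E n j"
    | x \<sigma> where "p = OverMid x \<sigma>" "x \<in> sub_crossings \<gamma> E"
    | x \<sigma> where "p = UnderMid x \<sigma>" "x \<in> sub_crossings \<gamma> E"
    unfolding band_labels_def band_diagram_def link_diagram.simps by blast
  then show thesis
  proof cases
    case 1 then show thesis by (rule that(1))
  next
    case 2 then show thesis using that(2)[of x True] by (simp add: mid.simps)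
  next
    case 3 then show thesis using that(2)[of x False] by (simp add: mid.simps)
  qed
qed

lemma finite_sub_crossings: "regular_projection \<gamma> \<Longrightarrow> finite (sub_crossings \<gamma> E)"
  by (simp add: sub_crossings_def regular_projection_def)

lemma finite_side [simp]: "finite (UNIV :: side set)"
proof -
  have "(UNIV :: side set) = {LeftSide, RightSide}" using side.exhaust by blast
  then show ?thesis by (metis finite.emptyI finite.insertI)
qed

lemma finite_band_labels:
  assumes "regular_projection \<gamma>" "finite E"
  shows "finite (band_labels \<gamma> E n)"
proof -
  have "band_labels \<gamma> E n \<subseteq> (\<lambda>((j, m), \<sigma>). Rung j m \<sigma>) ` ((SIGMA j:E. {..last_rung \<gamma> E n j}) \<times> UNIV)
      \<union> (\<lambda>(x, b, \<sigma>). mid x b \<sigma>) ` (sub_crossings \<gamma> E \<times> UNIV \<times> UNIV)"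
  proof
    fix p assume "p \<in> band_labels \<gamma> E n"
    then show "p \<in> (\<lambda>((j, m), \<sigma>). Rung j m \<sigma>) ` ((SIGMA j:E. {..last_rung \<gamma> E n j}) \<times> UNIV)
      \<union> (\<lambda>(x, b, \<sigma>). mid x b \<sigma>) ` (sub_crossings \<gamma> E \<times> UNIV \<times> UNIV)"
    proof (cases rule: band_labels_cases)
      case (1 j m \<sigma>)
      then show ?thesis by (intro UnI1 image_eqI[of _ _ "((j, m), \<sigma>)"]) auto
    next
      case (2 x b \<sigma>)
      then show ?thesis by (intro UnI2 image_eqI[of _ _ "(x, b, \<sigma>)"]) auto
    qed
  qed
  then show ?thesis
    by (rule finite_subset) (intro finite_UnI finite_imageI finite_cartesian_product finite_SigmaI
      finite_sub_crossings[OF assms(1)] assms(2) finite_side finite_atMost finite)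
qed

lemma twists_image: "twists E n = (\<lambda>(i, k). twist_crossing n i k) ` (SIGMA i:E. {..<nat \<bar>n i\<bar>})"
  unfolding twists_def by auto

lemma finite_twists: "finite E \<Longrightarrow> finite (twists E n)"
  by (simp add: twists_image)

lemma finite_band_crossings: "finite Y \<Longrightarrow> finite (band_crossings \<gamma> E n Y)"
proof -
  assume "finite Y"
  have "band_crossings \<gamma> E n Y = (\<Union>x\<in>Y. \<Union>\<sigma>. \<Union>\<tau>. {band_crossing \<gamma> E n x \<sigma> \<tau>})"
    unfolding band_crossings_def by blast
  then show ?thesis using \<open>finite Y\<close> by simp
qed

section \<open>The four crossings of two bands\<close>

definition strand_in :: "spatial_graph \<Rightarrow> nat set \<Rightarrow> (nat \<Rightarrow> int) \<Rightarrow>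
    graph_crossing \<Rightarrow> bool \<Rightarrow> side \<Rightarrow> band_arc" where
  "strand_in \<gamma> E n x b \<sigma> = Rung (fst (crossing_point x b)) (position \<gamma> E n (crossing_point x b)) \<sigma>"

definition strand_out :: "spatial_graph \<Rightarrow> nat set \<Rightarrow> (nat \<Rightarrow> int) \<Rightarrow>
    graph_crossing \<Rightarrow> bool \<Rightarrow> side \<Rightarrow> band_arc" where
  "strand_out \<gamma> E n x b \<sigma> = Rung (fst (crossing_point x b)) (Suc (position \<gamma> E n (crossing_point x b))) \<sigma>"

text \<open>The crossing of side \<open>\<sigma>\<close> of the strand \<open>b\<close> with side \<open>\<tau>\<close> of the other one.\<close>

definition side_crossing :: "spatial_graph \<Rightarrow> nat set \<Rightarrow> (nat \<Rightarrow> int) \<Rightarrow>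
    graph_crossing \<Rightarrow> bool \<Rightarrow> side \<Rightarrow> side \<Rightarrow> band_arc crossing" where
  "side_crossing \<gamma> E n x b \<sigma> \<tau> = band_crossing \<gamma> E n x (if b then \<sigma> else \<tau>) (if b then \<tau> else \<sigma>)"

text \<open>The side of the other band that the strand \<open>b\<close> meets first.\<close>

definition first_side :: "spatial_graph \<Rightarrow> graph_crossing \<Rightarrow> bool \<Rightarrow> side" where
  "first_side \<gamma> x b = (if (graph_crossing_sign \<gamma> x = 1) = b then LeftSide else RightSide)"

text \<open>Directed along their edges, the sides of two flat bands cross with the sign of the graph
  crossing. So at all four crossings, and whichever strand is taken first, the same kind of
  smoothing joins the two incoming arcs, namely the minus smoothing at a positive crossing. This is
  the common \<open>b\<close> that \<open>br_reidemeister2\<close> asks for.\<close>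

lemma side_crossing_shape:
  "shape (graph_crossing_sign \<gamma> x \<noteq> 1) (side_crossing \<gamma> E n x b \<sigma> \<tau>)
     (if \<tau> = first_side \<gamma> x b then strand_in \<gamma> E n x b \<sigma> else mid x b \<sigma>)
     (if \<sigma> = first_side \<gamma> x (\<not> b) then strand_in \<gamma> E n x (\<not> b) \<tau> else mid x (\<not> b) \<tau>)
     (if \<tau> = first_side \<gamma> x b then mid x b \<sigma> else strand_out \<gamma> E n x b \<sigma>)
     (if \<sigma> = first_side \<gamma> x (\<not> b) then mid x (\<not> b) \<tau> else strand_out \<gamma> E n x (\<not> b) \<tau>)"
  by (cases b; cases "graph_crossing_sign \<gamma> x = 1"; cases \<sigma>; cases \<tau>)
    (simp_all add: side_crossing_def band_crossing_def Let_def first_side_def strand_in_def strand_out_def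
      mid.simps crossing_point.simps)

lemma band_crossing_side: "band_crossing \<gamma> E n x \<sigma> \<tau> = side_crossing \<gamma> E n x True \<sigma> \<tau>"
  by (simp add: side_crossing_def)

lemma side_crossing_in: "x \<in> Y \<Longrightarrow> side_crossing \<gamma> E n x b \<sigma> \<tau> \<in> band_crossings \<gamma> E n Y"
  unfolding side_crossing_def band_crossings_def by blast

definition strand_arcs :: "spatial_graph \<Rightarrow> nat set \<Rightarrow> (nat \<Rightarrow> int) \<Rightarrow>
    graph_crossing \<Rightarrow> bool \<Rightarrow> band_arc set" where
  "strand_arcs \<gamma> E n x b = range (strand_in \<gamma> E n x b) \<union> range (mid x b) \<union> range (strand_out \<gamma> E n x b)"

lemma band_crossing_arcs:
  assumes "\<And>c. strand_arcs \<gamma> E n x c \<subseteq> A"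
  shows "band_crossing \<gamma> E n x \<sigma> \<tau> \<in> over A"
  unfolding band_crossing_side shape_labels[OF side_crossing_shape]
  using assms[of True] assms[of False] unfolding strand_arcs_def by auto

lemma virtual_joins_sides:
  assumes "(p, q) \<in> virtual_joins (band_crossing \<gamma> E n x \<sigma> \<tau>)"
  obtains c \<rho> where "{p, q} \<subseteq> {strand_in \<gamma> E n x c \<rho>, mid x c \<rho>, strand_out \<gamma> E n x c \<rho>}"
proof -
  note s = shape_virtual[OF side_crossing_shape[of \<gamma> x E n True \<sigma> \<tau>]]
  have "(p, q) \<in> virtual_joins (side_crossing \<gamma> E n x True \<sigma> \<tau>) \<union> (virtual_joins (side_crossing \<gamma> E n x True \<sigma> \<tau>))\<inverse>"
    using assms by (simp add: band_crossing_side)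
  then have "{p, q} \<subseteq> {strand_in \<gamma> E n x True \<sigma>, mid x True \<sigma>, strand_out \<gamma> E n x True \<sigma>} \<or>
      {p, q} \<subseteq> {strand_in \<gamma> E n x False \<tau>, mid x False \<tau>, strand_out \<gamma> E n x False \<tau>}"
    unfolding s by (auto split: if_splits)
  then show thesis using that by blast
qed

text \<open>Each side of a band has two of the four crossings. One ties the incoming rung to the mid
  arc, the other the mid arc to the outgoing rung; \<open>first_side\<close> tells which.\<close>

lemma virtual_joins_strand:
  assumes "x \<in> Y" and J_def: "J = \<Union>(virtual_joins ` band_crossings \<gamma> E n Y)"
  shows "(strand_in \<gamma> E n x b \<sigma>, mid x b \<sigma>) \<in> conn J" "(mid x b \<sigma>, strand_out \<gamma> E n x b \<sigma>) \<in> conn J"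
proof -
  have s: "(u, u') \<in> conn J" if "shape c (side_crossing \<gamma> E n x b \<sigma> \<tau>) u w u' w'" for c u w u' w' \<tau>
  proof (rule conn_base)
    have "(u, u') \<in> virtual_joins (side_crossing \<gamma> E n x b \<sigma> \<tau>) \<union> (virtual_joins (side_crossing \<gamma> E n x b \<sigma> \<tau>))\<inverse>"
      unfolding shape_virtual[OF that] by blast
    then show "(u, u') \<in> J \<or> (u', u) \<in> J"
      using side_crossing_in[OF assms(1), of \<gamma> E n b \<sigma> \<tau>] unfolding J_def by blast
  qed
  show "(strand_in \<gamma> E n x b \<sigma>, mid x b \<sigma>) \<in> conn J"
    using s[OF side_crossing_shape[of \<gamma> x E n b \<sigma> "first_side \<gamma> x b"]] by simp
  show "(mid x b \<sigma>, strand_out \<gamma> E n x b \<sigma>) \<in> conn J"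
    using s[OF side_crossing_shape[of \<gamma> x E n b \<sigma> "opposite_side (first_side \<gamma> x b)"]] by simp
qed

section \<open>The order of the crossings along a band\<close>

lemma crossing_times_point:
  "crossing_times \<gamma> E i = {t. \<exists>x\<in>sub_crossings \<gamma> E. \<exists>b. (i, t) = crossing_point x b}"
proof -
  have "(i, t) \<in> {fst x, snd x} \<longleftrightarrow> (\<exists>b. (i, t) = crossing_point x b)" for t x
    by (auto simp: crossing_point.simps intro: exI[of _ True] exI[of _ False])
  then show ?thesis by (simp add: crossing_times_def)
qed

lemma crossing_timesI:
  "x \<in> sub_crossings \<gamma> E \<Longrightarrow> crossing_point x b = (i, t) \<Longrightarrow> t \<in> crossing_times \<gamma> E i"
  unfolding crossing_times_point mem_Collect_eq by (intro bexI exI) (rule sym)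

lemma sub_crossings_sub: "x \<in> sub_crossings \<gamma> E \<Longrightarrow> x \<in> graph_crossings \<gamma>"
  by (simp add: sub_crossings_def)

lemma sub_crossings_iff:
  "x \<in> sub_crossings \<gamma> E \<longleftrightarrow> x \<in> graph_crossings \<gamma> \<and> (\<forall>b. fst (crossing_point x b) \<in> E)"
  by (auto simp: sub_crossings_def crossing_point.simps)

lemma finite_crossing_times_sub:
  assumes "regular_projection \<gamma>"
  shows "finite (crossing_times \<gamma> E i)"
proof -
  have "crossing_times \<gamma> E i \<subseteq> (\<lambda>(x, b). snd (crossing_point x b)) ` (sub_crossings \<gamma> E \<times> UNIV)"
  proof
    fix t assume "t \<in> crossing_times \<gamma> E i"
    then obtain x b where x: "x \<in> sub_crossings \<gamma> E" "(i, t) = crossing_point x b"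
      unfolding crossing_times_point by blast
    have "t = snd (crossing_point x b)" using x(2) by (metis snd_conv)
    then show "t \<in> (\<lambda>(x, b). snd (crossing_point x b)) ` (sub_crossings \<gamma> E \<times> UNIV)"
      using x(1) by (intro image_eqI[of _ _ "(x, b)"]) auto
  qed
  then show ?thesis by (rule finite_subset) (simp add: finite_sub_crossings[OF assms])
qed

lemma position_bounds:
  assumes "regular_projection \<gamma>" "x \<in> sub_crossings \<gamma> E" "fst (crossing_point x b) = i"
  shows "nat \<bar>n i\<bar> \<le> position \<gamma> E n (crossing_point x b) \<and>
    position \<gamma> E n (crossing_point x b) < last_rung \<gamma> E n i"
proof -
  obtain t where p: "crossing_point x b = (i, t)" using assms(3) by (metis prod.collapse)
  then have "t \<in> crossing_times \<gamma> E i" using crossing_timesI[OF assms(2)] by blast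
  then have "card {u \<in> crossing_times \<gamma> E i. u < t} < card (crossing_times \<gamma> E i)"
    using finite_crossing_times_sub[OF assms(1)] by (intro psubset_card_mono) auto
  then show ?thesis by (simp add: p position_def last_rung_def)
qed

lemma position_inject:
  assumes "regular_projection \<gamma>" "s \<in> crossing_times \<gamma> E i" "t \<in> crossing_times \<gamma> E i"
  shows "position \<gamma> E n (i, s) < position \<gamma> E n (i, t) \<longleftrightarrow> s < t"
proof -
  have "position \<gamma> E n (i, s) < position \<gamma> E n (i, t)" if "s < t" "s \<in> crossing_times \<gamma> E i" for s t
    unfolding position_def using finite_crossing_times_sub[OF assms(1), of E i] that
    by (auto intro!: psubset_card_mono)
  from this[of s t] this[of t s] show ?thesis using assms(2,3) by (cases s t rule: linorder_cases) auto
qed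

lemma position_sub_ex1:
  assumes "regular_projection \<gamma>" "nat \<bar>n i\<bar> \<le> m" "m < last_rung \<gamma> E n i"
  obtains x b where "x \<in> sub_crossings \<gamma> E" "fst (crossing_point x b) = i" "position \<gamma> E n (crossing_point x b) = m"
proof -
  let ?T = "crossing_times \<gamma> E i"
  have "m - nat \<bar>n i\<bar> < card ?T" using assms by (simp add: last_rung_def)
  from ex1_card_below[OF finite_crossing_times_sub[OF assms(1)] this]
  obtain t where t: "t \<in> ?T" "card {u\<in>?T. u < t} = m - nat \<bar>n i\<bar>" by blast
  from t(1) obtain x b where x: "x \<in> sub_crossings \<gamma> E" "crossing_point x b = (i, t)"
    unfolding crossing_times_point by force
  show thesis by (rule that[OF x(1), of b]) (use x(2) t assms in \<open>simp_all add: position_def\<close>)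
qed

lemma position_unique:
  assumes "regular_projection \<gamma>" "x \<in> sub_crossings \<gamma> E" "y \<in> sub_crossings \<gamma> E"
    "fst (crossing_point x b) = fst (crossing_point y c)"
    "position \<gamma> E n (crossing_point x b) = position \<gamma> E n (crossing_point y c)"
  shows "x = y \<and> b = c"
proof -
  obtain i s where s: "crossing_point x b = (i, s)" by fastforce
  obtain t where t: "crossing_point y c = (i, t)" using assms(4) s by (metis fst_conv prod.collapse)
  have "s \<in> crossing_times \<gamma> E i" "t \<in> crossing_times \<gamma> E i"
    using crossing_timesI[OF assms(2) s] crossing_timesI[OF assms(3) t] by auto
  from position_inject[OF assms(1) this, of n] position_inject[OF assms(1) this(2,1), of n]
  have "s = t" using assms(5) unfolding s t by auto
  then have "crossing_point x b = crossing_point y c" using s t by simp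
  then show ?thesis
    by (rule crossing_point_inj[OF assms(1) sub_crossings_sub[OF assms(2)] sub_crossings_sub[OF assms(3)]])
qed

lemma strand_arcs_labels:
  assumes "regular_projection \<gamma>" "x \<in> sub_crossings \<gamma> E"
  shows "strand_arcs \<gamma> E n x c \<subseteq> band_labels \<gamma> E n"
proof -
  have "fst (crossing_point x c) \<in> E" using assms(2) sub_crossings_iff by blast
  then show ?thesis
    using position_bounds[OF assms refl, of n c] assms(2)
    by (auto simp: strand_arcs_def strand_in_def strand_out_def)
qed

lemma band_crossings_labels:
  assumes "regular_projection \<gamma>" "Y \<subseteq> sub_crossings \<gamma> E" "L = band_labels \<gamma> E n"
  shows "band_crossings \<gamma> E n Y \<subseteq> over L"
proof
  fix c assume "c \<in> band_crossings \<gamma> E n Y"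
  then obtain x \<sigma> \<tau> where c: "c = band_crossing \<gamma> E n x \<sigma> \<tau>" "x \<in> sub_crossings \<gamma> E"
    using assms(2) unfolding band_crossings_def by blast
  then show "c \<in> over L"
    unfolding c(1) by (intro band_crossing_arcs) (use strand_arcs_labels[OF assms(1) c(2)] assms(3) in auto)
qed

lemma twists_labels:
  assumes "L = band_labels \<gamma> E n"
  shows "twists E n \<subseteq> over L"
  using assms by (auto simp: twists_def twist_crossing_def Let_def last_rung_def)

section \<open>Telling crossings apart by their arcs\<close>

fun crossing_arcs :: "'p crossing \<Rightarrow> 'p set" where
  "crossing_arcs (a, b, c, d) = {a, b, c, d}"

lemma crossing_arcs_shape: "shape b c u w u' w' \<Longrightarrow> crossing_arcs c = {u, w, u', w'}"
  by (cases c; cases b) auto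

lemma crossing_arcs_map: "crossing_arcs (map_crossing f c) = f ` crossing_arcs c"
  by (cases c) auto

text \<open>The mid arcs are a fingerprint of a band crossing: they recover the graph crossing and
  both sides. Rungs would not do, as neighbouring crossings share them.\<close>

lemma mid_crossing_arcs:
  "mid y b \<rho> \<in> crossing_arcs (band_crossing \<gamma> E n x \<sigma> \<tau>) \<longleftrightarrow> y = x \<and> \<rho> = (if b then \<sigma> else \<tau>)"
  unfolding band_crossing_side crossing_arcs_shape[OF side_crossing_shape]
  by (cases b) (auto simp: strand_in_def strand_out_def)

lemma twist_crossing_arcs: "crossing_arcs (twist_crossing n i k) = {Rung i m \<sigma> | m \<sigma>. m \<in> {k, Suc k}}"
proof -
  have "\<sigma> = LeftSide \<or> \<sigma> = RightSide" for \<sigma> by (cases \<sigma>) auto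
  then show ?thesis by (auto simp: twist_crossing_def Let_def)
qed

text \<open>\<open>f\<close> fixes the mid arcs and produces no new ones, so the fingerprint of a
  band crossing survives. A half twist has no mid arc and cannot be confused with a band crossing;
  half twists are told apart by the left inverse \<open>g\<close>.\<close>

lemma inj_on_band_crossings:
  assumes T: "T \<subseteq> twists E n" and g: "\<And>c. c \<in> T \<Longrightarrow> map_crossing g (map_crossing f c) = c"
    and mid: "\<And>x b \<sigma>. x \<in> Y \<Longrightarrow> f (mid x b \<sigma>) = mid x b \<sigma>"
    and rung: "\<And>p c y b \<rho>. c \<in> T \<union> band_crossings \<gamma> E n Y \<Longrightarrow> p \<in> crossing_arcs c \<Longrightarrow> f p = mid y b \<rho> \<Longrightarrow> \<exists>x b \<sigma>. p = mid x b \<sigma>"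
  shows "inj_on (map_crossing f) (T \<union> band_crossings \<gamma> E n Y)"
proof -
  let ?m = "map_crossing f" and ?B = "band_crossings \<gamma> E n Y"
  have B: "mid y b \<rho> \<in> crossing_arcs (?m (band_crossing \<gamma> E n x \<sigma> \<tau>)) \<longleftrightarrow> y = x \<and> \<rho> = (if b then \<sigma> else \<tau>)"
    if "x \<in> Y" for y b \<rho> x \<sigma> \<tau>
  proof
    have cB: "band_crossing \<gamma> E n x \<sigma> \<tau> \<in> T \<union> ?B" using that unfolding band_crossings_def by blast
    assume "mid y b \<rho> \<in> crossing_arcs (?m (band_crossing \<gamma> E n x \<sigma> \<tau>))"
    then obtain p where p: "p \<in> crossing_arcs (band_crossing \<gamma> E n x \<sigma> \<tau>)" "f p = mid y b \<rho>"
      unfolding crossing_arcs_map by force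
    then obtain x' b' \<sigma>' where "p = mid x' b' \<sigma>'" using rung[OF cB] by blast
    then show "y = x \<and> \<rho> = (if b then \<sigma> else \<tau>)" using p mid that by (auto simp: mid_crossing_arcs)
  next
    assume "y = x \<and> \<rho> = (if b then \<sigma> else \<tau>)"
    then have "mid y b \<rho> \<in> crossing_arcs (band_crossing \<gamma> E n x \<sigma> \<tau>)" "f (mid y b \<rho>) = mid y b \<rho>"
      using mid that by (auto simp: mid_crossing_arcs)
    then show "mid y b \<rho> \<in> crossing_arcs (?m (band_crossing \<gamma> E n x \<sigma> \<tau>))"
      unfolding crossing_arcs_map by (metis imageI)
  qed
  have TB: False if c: "c \<in> T" "x \<in> Y" "?m c = ?m (band_crossing \<gamma> E n x \<sigma> \<tau>)" for c x \<sigma> \<tau>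
  proof -
    have "mid x True \<sigma> \<in> f ` crossing_arcs c"
      using B[OF c(2), of x True \<sigma> \<sigma> \<tau>] c(3) by (simp flip: crossing_arcs_map)
    then obtain p where p: "p \<in> crossing_arcs c" "f p = mid x True \<sigma>" by force
    obtain i k where "c = twist_crossing n i k" using c(1) T by (auto simp: twists_def)
    then show False using p rung[of c p x True \<sigma>] c(1) by (auto simp: twist_crossing_arcs)
  qed
  have BB: "band_crossing \<gamma> E n x \<sigma> \<tau> = band_crossing \<gamma> E n x' \<sigma>' \<tau>'"
    if c: "x \<in> Y" "x' \<in> Y" "?m (band_crossing \<gamma> E n x \<sigma> \<tau>) = ?m (band_crossing \<gamma> E n x' \<sigma>' \<tau>')" for x \<sigma> \<tau> x' \<sigma>' \<tau>'
    using B[OF c(1), of x True \<sigma> \<sigma> \<tau>] B[OF c(1), of x False \<tau> \<sigma> \<tau>] unfolding c(3) B[OF c(2)] by simp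
  show ?thesis
  proof (rule inj_onI)
    fix c d assume cd: "c \<in> T \<union> ?B" "d \<in> T \<union> ?B" "?m c = ?m d"
    consider "c \<in> T" "d \<in> T" | "c \<in> T" "d \<in> ?B" | "c \<in> ?B" "d \<in> T" | "c \<in> ?B" "d \<in> ?B" using cd by blast
    then show "c = d"
    proof cases
      case 1 then show ?thesis using g cd(3) by metis
    next
      case 2 then show ?thesis using TB cd(3) unfolding band_crossings_def by blast
    next
      case 3 then show ?thesis using TB cd(3)[symmetric] unfolding band_crossings_def by blast
    next
      case 4 then show ?thesis using BB cd(3) unfolding band_crossings_def by blast
    qed
  qed
qed

lemma band_crossing_inject:
  "band_crossing \<gamma> E n x \<sigma> \<tau> = band_crossing \<gamma> E n x' \<sigma>' \<tau>' \<longleftrightarrow> x = x' \<and> \<sigma> = \<sigma>' \<and> \<tau> = \<tau>'"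
proof
  assume a: "band_crossing \<gamma> E n x \<sigma> \<tau> = band_crossing \<gamma> E n x' \<sigma>' \<tau>'"
  have "mid x True \<sigma> \<in> crossing_arcs (band_crossing \<gamma> E n x' \<sigma>' \<tau>')"
    "mid x False \<tau> \<in> crossing_arcs (band_crossing \<gamma> E n x' \<sigma>' \<tau>')"
    unfolding a[symmetric] by (simp_all add: mid_crossing_arcs)
  then show "x = x' \<and> \<sigma> = \<sigma>' \<and> \<tau> = \<tau>'" by (simp add: mid_crossing_arcs)
qed simp

lemma twist_crossing_not_band: "twist_crossing n i k \<noteq> band_crossing \<gamma> E n x \<sigma> \<tau>"
proof
  assume "twist_crossing n i k = band_crossing \<gamma> E n x \<sigma> \<tau>"
  then have "mid x True \<sigma> \<in> crossing_arcs (twist_crossing n i k)" by (simp add: mid_crossing_arcs)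
  then show False by (simp add: twist_crossing_arcs)
qed

lemma twist_crossing_inject: "twist_crossing n i k = twist_crossing n j l \<longleftrightarrow> i = j \<and> k = l"
proof
  assume "twist_crossing n i k = twist_crossing n j l"
  then have e: "crossing_arcs (twist_crossing n i k) = crossing_arcs (twist_crossing n j l)" by simp
  have "Rung i k LeftSide \<in> crossing_arcs (twist_crossing n j l)" "Rung i (Suc k) LeftSide \<in> crossing_arcs (twist_crossing n j l)"
    unfolding e[symmetric] unfolding twist_crossing_arcs by auto
  then show "i = j \<and> k = l" unfolding twist_crossing_arcs by auto
qed simp

section \<open>Removing an edge at a vertex\<close>

lemma turn_diff:
  assumes "a \<in> {0..<2*pi}" "b \<in> {0..<2*pi}" "c \<in> {0..<2*pi}" "turn a b < turn a c"
  shows "turn b c = turn a c - turn a b"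
  using assms by (auto simp: turn_def split: if_splits)

lemma incident_Diff: "incident (E - {i}) v = incident E v - {i}"
  by (auto simp: incident_def)

text \<open>The angles do not depend on the set of edges, so one \<theta> serves every
  \<open>F\<close>. This makes the successor relations of \<open>E\<close> and
  \<open>E - {i}\<close> comparable.\<close>

lemma next_edge_turn:
  assumes "regular_projection \<gamma>" "v \<in> {0..3}" "E \<subseteq> {1..6}"
  shows "\<exists>\<theta>. (\<forall>k. \<theta> k \<in> {0..<2*pi}) \<and> inj_on \<theta> (incident E v) \<and>
    (\<forall>F a b. next_edge \<gamma> F v a b \<longleftrightarrow> a \<in> incident F v \<and> b \<in> incident F v \<and>
       (\<forall>k\<in>incident F v. turn (\<theta> a) (\<theta> b) \<le> turn (\<theta> a) (\<theta> k)))"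
proof (intro exI conjI)
  let ?\<theta> = "\<lambda>k. Arg2pi (exit_direction \<gamma> v k)"
  show "\<forall>k. ?\<theta> k \<in> {0..<2*pi}" using Arg2pi_ge_0 Arg2pi_lt_2pi by auto
  have "inj_on ?\<theta> (incident {1..6} v)" using assms by (simp add: regular_projection_def)
  then show "inj_on ?\<theta> (incident E v)" by (rule inj_on_subset) (use assms(3) in \<open>auto simp: incident_def\<close>)
qed (simp add: next_edge_def)

lemma finite_incident: "E \<subseteq> {1..6} \<Longrightarrow> finite (incident E v)"
  by (rule finite_subset[of _ "{1..6}"]) (auto simp: incident_def)

lemma next_edge_total:
  assumes "regular_projection \<gamma>" "v \<in> {0..3}" "E \<subseteq> {1..6}" "a \<in> incident E v"
  shows "\<exists>!b. next_edge \<gamma> E v a b"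
proof -
  obtain \<theta> where r: "\<And>k. \<theta> k \<in> {0..<2*pi}" and inj: "inj_on \<theta> (incident E v)"
    and n: "\<And>F a b. next_edge \<gamma> F v a b \<longleftrightarrow> a \<in> incident F v \<and> b \<in> incident F v \<and>
       (\<forall>k\<in>incident F v. turn (\<theta> a) (\<theta> b) \<le> turn (\<theta> a) (\<theta> k))"
    using next_edge_turn[OF assms(1-3)] by blast
  have "inj_on (\<lambda>b. turn (\<theta> a) (\<theta> b)) (incident E v)"
    by (rule inj_onI) (metis turn_inj[OF r r r] inj_onD[OF inj])
  moreover have "incident E v \<noteq> {}" using assms(4) by blast
  ultimately show ?thesis
    using ex1_min[OF finite_incident[OF assms(3)]] assms(4) unfolding n by simp
qed

text \<open>The turn from a direction to itself is a full one, the largest possible, so an edge can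
  follow itself only without competitors.\<close>

lemma next_edge_self:
  assumes "regular_projection \<gamma>" "v \<in> {0..3}" "E \<subseteq> {1..6}" "next_edge \<gamma> E v i i"
  shows "incident E v = {i}"
proof -
  obtain \<theta> where r: "\<And>k. \<theta> k \<in> {0..<2*pi}" and inj: "inj_on \<theta> (incident E v)"
    and n: "\<And>F a b. next_edge \<gamma> F v a b \<longleftrightarrow> a \<in> incident F v \<and> b \<in> incident F v \<and>
       (\<forall>k\<in>incident F v. turn (\<theta> a) (\<theta> b) \<le> turn (\<theta> a) (\<theta> k))"
    using next_edge_turn[OF assms(1-3)] by blast
  have i: "i \<in> incident E v" using assms(4) n by blast
  have "k = i" if k: "k \<in> incident E v" for k
  proof (rule ccontr)
    assume "k \<noteq> i"
    then have "\<theta> k \<noteq> \<theta> i" using inj_onD[OF inj] i k by blast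
    moreover have "turn (\<theta> i) (\<theta> i) \<le> turn (\<theta> i) (\<theta> k)" using assms(4) n k by blast
    ultimately show False using r[of i] r[of k] by (auto simp: turn_def split: if_splits)
  qed
  then show ?thesis using i by blast
qed

lemma next_edge_single:
  "incident E v = {i} \<Longrightarrow> next_edge \<gamma> E v a b \<longleftrightarrow> a = i \<and> b = i"
  by (auto simp: next_edge_def Let_def)

text \<open>Deleting an element of a cyclic order links its predecessor to its successor. At a
  vertex with two edges these coincide, and the survivor becomes its own successor.\<close>

theorem next_edge_remove:
  assumes "regular_projection \<gamma>" "v \<in> {0..3}" "E \<subseteq> {1..6}"
  shows "next_edge \<gamma> (E - {i}) v a b \<longleftrightarrow> a \<noteq> i \<and> b \<noteq> i \<and>
    (next_edge \<gamma> E v a b \<or> next_edge \<gamma> E v a i \<and> next_edge \<gamma> E v i b)"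
proof -
  obtain \<theta> where r: "\<And>k. \<theta> k \<in> {0..<2*pi}" and inj: "inj_on \<theta> (incident E v)"
    and n: "\<And>F a b. next_edge \<gamma> F v a b \<longleftrightarrow> a \<in> incident F v \<and> b \<in> incident F v \<and>
       (\<forall>k\<in>incident F v. turn (\<theta> a) (\<theta> b) \<le> turn (\<theta> a) (\<theta> k))"
    using next_edge_turn[OF assms] by blast
  let ?I = "incident E v" and ?t = "\<lambda>a b. turn (\<theta> a) (\<theta> b)"
  note d = turn_diff[OF r r r]
  have inj_t: "b = c" if "?t a b = ?t a c" "b \<in> ?I" "c \<in> ?I" for a b c
    using that inj_onD[OF inj] turn_inj[OF r r r] by metis
  have self: "?t i i = 2 * pi" "?t i k \<le> 2 * pi" for k using r turn_range[OF r r] by (auto simp: turn_def)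
  show ?thesis
  proof
    assume a: "next_edge \<gamma> (E - {i}) v a b"
    then have ab: "a \<in> ?I" "b \<in> ?I" "a \<noteq> i" "b \<noteq> i" and m: "\<And>k. k \<in> ?I \<Longrightarrow> k \<noteq> i \<Longrightarrow> ?t a b \<le> ?t a k"
      unfolding n incident_Diff by auto
    have "next_edge \<gamma> E v a i \<and> next_edge \<gamma> E v i b" if no: "\<not> next_edge \<gamma> E v a b"
    proof -
      \<comment> \<open>Only \<open>i\<close> can have prevented \<open>b\<close> from following
        \<open>a\<close> in \<open>E\<close>, so \<open>i\<close> lies strictly between
        them.\<close>
      have i: "i \<in> ?I" "?t a i < ?t a b" using no ab m unfolding n by force+
      have "?t a i \<le> ?t a k" if "k \<in> ?I" for k using m[of k] i that by (cases "k = i") auto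
      moreover have "?t i b \<le> ?t i k" if "k \<in> ?I" for k
      proof (cases "k = i")
        case False
        then have "?t a b \<le> ?t a k" using m that by blast
        then show ?thesis using d[of a i b] d[of a i k] i(2) by linarith
      qed (use self in simp)
      ultimately show ?thesis unfolding n using i(1) ab by blast
    qed
    then show "a \<noteq> i \<and> b \<noteq> i \<and> (next_edge \<gamma> E v a b \<or> next_edge \<gamma> E v a i \<and> next_edge \<gamma> E v i b)"
      using ab by blast
  next
    assume a: "a \<noteq> i \<and> b \<noteq> i \<and> (next_edge \<gamma> E v a b \<or> next_edge \<gamma> E v a i \<and> next_edge \<gamma> E v i b)"
    have "?t a b \<le> ?t a k" if k: "k \<in> ?I" "k \<noteq> i" and ai: "next_edge \<gamma> E v a i" "next_edge \<gamma> E v i b" for k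
    proof -
      have "?t a i \<le> ?t a k" "?t a i \<le> ?t a b" "?t i b \<le> ?t i k" and I: "i \<in> ?I" "b \<in> ?I"
        using ai k unfolding n by auto
      moreover have "?t a i \<noteq> ?t a k" "?t a i \<noteq> ?t a b" using inj_t I k a by metis+
      ultimately show ?thesis using d[of a i b] d[of a i k] by linarith
    qed
    then show "next_edge \<gamma> (E - {i}) v a b" using a unfolding n incident_Diff by blast
  qed
qed

text \<open>The edge \<open>i\<close> ends on a cap of its own instead of the disk at \<open>v\<close>.\<close>

definition detached :: "spatial_graph \<Rightarrow> nat set \<Rightarrow> nat \<Rightarrow> nat \<Rightarrow> nat \<Rightarrow> nat \<Rightarrow> nat \<Rightarrow> bool" where
  "detached \<gamma> E i v u a b \<longleftrightarrow>
     (if u = v then next_edge \<gamma> (E - {i}) u a b \<or> a = i \<and> b = i else next_edge \<gamma> E u a b)"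

text \<open>A disk that carries no other band is already a cap.\<close>

lemma detached_pendant:
  assumes "incident E v = {i}"
  shows "detached \<gamma> E i v = next_edge \<gamma> E"
proof -
  have "\<not> next_edge \<gamma> (E - {i}) v a b" for a b
    using next_edge_incident[of \<gamma> "E - {i}" v a b] assms by (auto simp: incident_Diff)
  then show ?thesis by (intro ext) (auto simp: detached_def next_edge_single[OF assms])
qed

lemma detached_incident:
  "i \<in> incident E v \<Longrightarrow> detached \<gamma> E i v u a b \<Longrightarrow> a \<in> incident E u \<and> b \<in> incident E u"
  using next_edge_incident[of \<gamma> E u a b] next_edge_incident[of \<gamma> "E - {i}" u a b]
  by (auto simp: detached_def incident_Diff split: if_splits)

definition band_bracket :: "spatial_graph \<Rightarrow> nat set \<Rightarrow> (nat \<Rightarrow> int) \<Rightarrow>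
    (nat \<Rightarrow> nat \<Rightarrow> nat \<Rightarrow> bool) \<Rightarrow> int poly fract" where
  "band_bracket \<gamma> E n W =
     br (band_labels \<gamma> E n) (twists E n \<union> band_crossings \<gamma> E n (sub_crossings \<gamma> E)) (vertex_joins \<gamma> E n W)"

section \<open>Resolving the half twists\<close>

text \<open>One half twist, of either sign, is taken out of the band of \<open>i\<close>. It is the
  one next to the disk at the tail, \<open>t0\<close>: no crossing lies between it and the disk, so
  smoothing it leaves a stub without crossings.\<close>

locale half_twist =
  fixes \<gamma> :: spatial_graph and E :: "nat set" and n n' :: "nat \<Rightarrow> int" and i :: nat
  assumes reg: "regular_projection \<gamma>" and EE: "E \<subseteq> {1..6}" and iE: "i \<in> E"
    and ni: "n i \<noteq> 0" and n': "n' = n(i := n i - sgn (n i))"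
begin

abbreviation "L \<equiv> band_labels \<gamma> E n"
abbreviation "L' \<equiv> band_labels \<gamma> E n'"
abbreviation "t0 \<equiv> twist_crossing n i 0"
abbreviation "X \<equiv> (twists E n - {t0}) \<union> band_crossings \<gamma> E n (sub_crossings \<gamma> E)"
abbreviation "X' \<equiv> twists E n' \<union> band_crossings \<gamma> E n' (sub_crossings \<gamma> E)"
abbreviation "Id_joins \<equiv> {(Rung i 0 LeftSide, Rung i 1 LeftSide), (Rung i 1 RightSide, Rung i 0 RightSide)}"
abbreviation "Cut_joins \<equiv> {(Rung i 0 LeftSide, Rung i 0 RightSide), (Rung i 1 RightSide, Rung i 1 LeftSide)}"

lemma finite_E: "finite E" using EE by (rule finite_subset) simp

lemma abs_n: "nat \<bar>n i\<bar> = Suc (nat \<bar>n' i\<bar>)" "j \<noteq> i \<Longrightarrow> n' j = n j"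
  using ni by (auto simp: n' sgn_if)

lemma last_n: "last_rung \<gamma> E n i = Suc (last_rung \<gamma> E n' i)" "j \<noteq> i \<Longrightarrow> last_rung \<gamma> E n' j = last_rung \<gamma> E n j"
  by (simp_all add: last_rung_def abs_n)

lemma position_n: "fst p = i \<Longrightarrow> position \<gamma> E n p = Suc (position \<gamma> E n' p)"
    "fst p \<noteq> i \<Longrightarrow> position \<gamma> E n' p = position \<gamma> E n p"
  by (cases p; simp add: position_def abs_n)+

text \<open>Rungs beyond \<open>t0\<close> move one step towards the tail. The images
  \<open>a \<sigma>\<close> of the two rungs before \<open>t0\<close> are left open because they
  depend on the smoothing: the new first rungs if the band stays whole, an end of the neighbouring
  band if it is cut off a disk with other bands.\<close>

fun shift :: "(side \<Rightarrow> band_arc) \<Rightarrow> band_arc \<Rightarrow> band_arc" where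
  "shift a (Rung j m \<sigma>) = (if j = i then if m = 0 then a \<sigma> else Rung i (m - 1) \<sigma> else Rung j m \<sigma>)"
| "shift a p = p"

fun unshift :: "band_arc \<Rightarrow> band_arc" where
  "unshift (Rung j m \<sigma>) = (if j = i then Rung i (Suc m) \<sigma> else Rung j m \<sigma>)"
| "unshift p = p"

lemma shift_mid [simp]: "shift a (mid x b \<sigma>) = mid x b \<sigma>" "unshift (mid x b \<sigma>) = mid x b \<sigma>"
  by (simp_all add: mid.simps)

lemma shift_unshift: "shift a (unshift p) = p"
  by (cases p) auto

lemma shift_twist:
  "j \<noteq> i \<Longrightarrow> map_crossing (shift a) (twist_crossing n j k) = twist_crossing n' j k"
  "k < nat \<bar>n' i\<bar> \<Longrightarrow> map_crossing (shift a) (twist_crossing n i (Suc k)) = twist_crossing n' i k"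
proof -
  assume "k < nat \<bar>n' i\<bar>"
  \<comment> \<open>A twist is left over, so \<open>n' i\<close> is not 0 and has the sign of
    \<open>n i\<close>; the remaining twists keep their overstrands.\<close>
  then have "n' i > 0 \<longleftrightarrow> n i > 0" using ni by (auto simp: n' sgn_if split: if_splits)
  then show "map_crossing (shift a) (twist_crossing n i (Suc k)) = twist_crossing n' i k"
    by (simp add: twist_crossing_def Let_def)
qed (simp add: twist_crossing_def Let_def abs_n)

lemma shift_strand:
  "shift a (Rung (fst p) (position \<gamma> E n p) \<sigma>) = Rung (fst p) (position \<gamma> E n' p) \<sigma>"
  "shift a (Rung (fst p) (Suc (position \<gamma> E n p)) \<sigma>) = Rung (fst p) (Suc (position \<gamma> E n' p)) \<sigma>"
  by (cases "fst p = i"; simp add: position_n)+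

lemma shift_band: "map_crossing (shift a) (band_crossing \<gamma> E n x \<sigma> \<tau>) = band_crossing \<gamma> E n' x \<sigma> \<tau>"
  by (simp add: band_crossing_def Let_def shift_strand del: shift.simps(1))

lemma twistsI: "j \<in> E \<Longrightarrow> k < nat \<bar>m j\<bar> \<Longrightarrow> twist_crossing m j k \<in> twists E m"
  unfolding twists_def by blast

lemma t0_in: "t0 \<in> twists E n"
  by (rule twistsI) (use iE abs_n(1) in simp_all)

lemma twists_cases:
  assumes "c \<in> twists E n - {t0}"
  obtains j k where "c = twist_crossing n j k" "j \<in> E" "j \<noteq> i" "k < nat \<bar>n' j\<bar>"
  | k where "c = twist_crossing n i (Suc k)" "k < nat \<bar>n' i\<bar>"
proof -
  obtain j k where c: "c = twist_crossing n j k" "j \<in> E" "k < nat \<bar>n j\<bar>" "c \<noteq> t0"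
    using assms by (auto simp: twists_def)
  show thesis
  proof (cases "j = i")
    case True
    then obtain k' where "k = Suc k'" using c by (cases k) auto
    then show ?thesis using that(2)[of k'] c True abs_n by simp
  qed (use that(1) c abs_n(2) in simp)
qed

lemma shift_X: "map_crossing (shift a) ` X = X'"
proof -
  have "map_crossing (shift a) ` (twists E n - {t0}) = twists E n'"
  proof
    show "map_crossing (shift a) ` (twists E n - {t0}) \<subseteq> twists E n'"
    proof
      fix c assume "c \<in> map_crossing (shift a) ` (twists E n - {t0})"
      then obtain d where d: "d \<in> twists E n - {t0}" "c = map_crossing (shift a) d" by blast
      from d(1) show "c \<in> twists E n'"
        by (cases rule: twists_cases) (use d(2) iE in \<open>auto simp: shift_twist twists_def\<close>)
    qed
    show "twists E n' \<subseteq> map_crossing (shift a) ` (twists E n - {t0})"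
    proof
      fix c assume "c \<in> twists E n'"
      then obtain j k where c: "c = twist_crossing n' j k" "j \<in> E" "k < nat \<bar>n' j\<bar>" by (auto simp: twists_def)
      define d where "d = twist_crossing n j (if j = i then Suc k else k)"
      have "d \<in> twists E n" unfolding d_def by (rule twistsI) (use c abs_n in auto)
      moreover have "d \<noteq> t0" by (auto simp: d_def twist_crossing_inject)
      moreover have "c = map_crossing (shift a) d"
      proof (cases "j = i")
        case True
        then have "k < nat \<bar>n' i\<bar>" using c by simp
        from shift_twist(2)[OF this] show ?thesis using c True by (simp add: d_def)
      qed (simp add: d_def c(1) shift_twist(1))
      ultimately show "c \<in> map_crossing (shift a) ` (twists E n - {t0})" by blast
    qed
  qed
  moreover have "map_crossing (shift a) ` band_crossings \<gamma> E n Y = band_crossings \<gamma> E n' Y" for Y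
    unfolding band_crossings_def using shift_band[of a] by (auto simp: image_iff) metis+
  ultimately show ?thesis by (simp add: image_Un)
qed

lemma inj_shift: "inj_on (map_crossing (shift a)) X"
proof (rule inj_on_band_crossings[where g = unshift and n = n])
  fix c assume "c \<in> twists E n - {t0}"
  then show "map_crossing unshift (map_crossing (shift a) c) = c"
    by (cases rule: twists_cases) (auto simp: twist_crossing_def Let_def)
next
  fix p c y b \<rho> assume c: "c \<in> X" "p \<in> crossing_arcs c" "shift a p = mid y b \<rho>"
  show "\<exists>x b \<sigma>. p = mid x b \<sigma>"
  proof (cases p)
    case (Rung j m \<sigma>)
    \<comment> \<open>Only the first rungs could be sent to a mid arc, and no crossing except
      \<open>t0\<close> touches them.\<close>
    have "j = i \<Longrightarrow> m \<noteq> 0"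
    proof -
      assume j: "j = i"
      from c(1) consider "c \<in> twists E n - {t0}" | x \<sigma> \<tau> where "c = band_crossing \<gamma> E n x \<sigma> \<tau>"
        by (auto simp: band_crossings_def)
      then show "m \<noteq> 0"
      proof cases
        case 1 then show ?thesis
          by (cases rule: twists_cases) (use c(2) Rung j in \<open>auto simp: twist_crossing_arcs\<close>)
      next
        case (2 x \<sigma> \<tau>)
        then show ?thesis using c(2) Rung j position_n(1)[of "fst x"] position_n(1)[of "snd x"]
          by (auto simp: band_crossing_def Let_def split: if_splits)
      qed
    qed
    then show ?thesis using Rung c(3) by (auto split: if_splits)
  next
    case (OverMid x \<sigma>)
    then show ?thesis using mid.simps[of x True \<sigma>] by metis
  next
    case (UnderMid x \<sigma>)
    then show ?thesis using mid.simps[of x False \<sigma>] by metis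
  qed
qed auto

lemma X_labels: "X \<subseteq> over L" "insert t0 X \<subseteq> over L"
proof -
  show "insert t0 X \<subseteq> over L"
    using band_crossings_labels[OF reg subset_refl refl, of E n] twists_labels[OF refl, of E n \<gamma>] t0_in
    by (intro insert_subsetI Un_least) blast+
  then show "X \<subseteq> over L" by blast
qed

text \<open>\<open>P\<close> is either \<open>L\<close> or \<open>L\<close> without the two first
  rungs, when these have been split off as a circle.\<close>

lemma br_shift:
  assumes P: "P \<subseteq> L" "L - {Rung i 0 LeftSide, Rung i 0 RightSide} \<subseteq> P" "X \<subseteq> over P"
    and a: "\<And>\<sigma>. Rung i 0 \<sigma> \<in> P \<Longrightarrow> a \<sigma> \<in> L' \<and> (unshift (a \<sigma>), Rung i 0 \<sigma>) \<in> conn J"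
    and "\<And>p q. (p, q) \<in> J \<Longrightarrow> (shift a p, shift a q) \<in> conn J'"
    and "\<And>p q. (p, q) \<in> J' \<Longrightarrow> (unshift p, unshift q) \<in> conn J"
  shows "br P X J = br L' X' J'"
proof -
  have "br P X J = br L' (map_crossing (shift a) ` X) J'"
  proof (rule br_equiv[where g = unshift])
    show "shift a ` P \<subseteq> L'"
    proof
      fix q assume "q \<in> shift a ` P"
      then obtain p where p: "p \<in> P" "q = shift a p" by blast
      then have "p \<in> L" using P(1) by blast
      then show "q \<in> L'"
      proof (cases rule: band_labels_cases)
        case (1 j m \<sigma>)
        then show ?thesis using p a[of \<sigma>] last_n by (cases "j = i"; cases m) auto
      qed (use p in simp)
    qed
    show "unshift ` L' \<subseteq> P"
    proof
      fix q assume "q \<in> unshift ` L'"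
      then obtain p where p: "p \<in> L'" "q = unshift p" by blast
      from p(1) have "q \<in> L - {Rung i 0 LeftSide, Rung i 0 RightSide}"
      proof (cases rule: band_labels_cases)
        case (1 j m \<sigma>)
        then show ?thesis using p last_n by auto
      qed (use p in simp)
      then show "q \<in> P" using P(2) by blast
    qed
    show "(unshift (shift a p), p) \<in> conn J" if "p \<in> P" for p
    proof -
      have "p \<in> L" using that P(1) by blast
      then show ?thesis
      proof (cases rule: band_labels_cases)
        case (1 j m \<sigma>)
        then show ?thesis using that a[of \<sigma>] by auto
      qed simp
    qed
    show "(shift a (unshift p), p) \<in> conn J'" if "p \<in> L'" for p by (simp add: shift_unshift)
  qed (use assms inj_shift in blast)+
  then show ?thesis by (simp add: shift_X)
qed

text \<open>By the convention for half twists, the smoothing that keeps the band whole is the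
  positive one exactly for a positive twist; the opposite smoothing cuts the band.\<close>

lemma t0_shape: "shape (n i > 0) t0 (Rung i 0 LeftSide) (Rung i 1 LeftSide) (Rung i 1 RightSide) (Rung i 0 RightSide)"
  by (simp add: twist_crossing_def Let_def)

lemma band_bracket_skein:
  "band_bracket \<gamma> E n W = weight (n i > 0) * br L X (vertex_joins \<gamma> E n W \<union> Id_joins)
     + weight (\<not> n i > 0) * br L X (vertex_joins \<gamma> E n W \<union> Cut_joins)"
proof -
  have "t0 \<notin> X" using twist_crossing_not_band by (auto simp: band_crossings_def)
  moreover have "finite X" using finite_twists[OF finite_E] finite_band_crossings finite_sub_crossings[OF reg] by blast
  moreover have "insert t0 X = twists E n \<union> band_crossings \<gamma> E n (sub_crossings \<gamma> E)" using t0_in by blast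
  ultimately show ?thesis using br_skein[OF _ _ X_labels(1) t0_shape] by (simp add: band_bracket_def)
qed

lemma end_shift:
  "left_end \<gamma> E n u c \<noteq> Rung i 0 LeftSide \<Longrightarrow> shift a (left_end \<gamma> E n u c) = left_end \<gamma> E n' u c"
  "right_end \<gamma> E n u c \<noteq> Rung i 0 RightSide \<Longrightarrow> shift a (right_end \<gamma> E n u c) = right_end \<gamma> E n' u c"
  "c = i \<Longrightarrow> u = tail i \<Longrightarrow> left_end \<gamma> E n u c = Rung i 0 LeftSide"
  "c = i \<Longrightarrow> u = tail i \<Longrightarrow> right_end \<gamma> E n u c = Rung i 0 RightSide"
  "\<not> (c = i \<and> u = tail i) \<Longrightarrow> left_end \<gamma> E n u c \<noteq> Rung i 0 \<sigma>"
  "\<not> (c = i \<and> u = tail i) \<Longrightarrow> right_end \<gamma> E n u c \<noteq> Rung i 0 \<sigma>"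
  "\<not> (c = i \<and> u = tail i) \<Longrightarrow> unshift (left_end \<gamma> E n' u c) = left_end \<gamma> E n u c"
  "\<not> (c = i \<and> u = tail i) \<Longrightarrow> unshift (right_end \<gamma> E n' u c) = right_end \<gamma> E n u c"
  "c = i \<Longrightarrow> u = tail i \<Longrightarrow> left_end \<gamma> E n' u c = Rung i 0 LeftSide"
  "c = i \<Longrightarrow> u = tail i \<Longrightarrow> right_end \<gamma> E n' u c = Rung i 0 RightSide"
  using last_n by (auto simp: left_end_def right_end_def)

lemma br_Id: "br L X (vertex_joins \<gamma> E n W \<union> Id_joins) = band_bracket \<gamma> E n' W"
  unfolding band_bracket_def
proof (rule br_shift[where a = "Rung i 0"])
  let ?J = "vertex_joins \<gamma> E n W \<union> Id_joins"
  have s: "shift (Rung i 0) (left_end \<gamma> E n u c) = left_end \<gamma> E n' u c"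
    "shift (Rung i 0) (right_end \<gamma> E n u c) = right_end \<gamma> E n' u c" for u c
    using last_n by (auto simp: left_end_def right_end_def)
  have r: "(Rung i 0 \<sigma>, Rung i 1 \<sigma>) \<in> conn ?J" for \<sigma> by (cases \<sigma>) (auto intro: conn_base)
  have u: "(unshift (left_end \<gamma> E n' u c), left_end \<gamma> E n u c) \<in> conn ?J"
    "(unshift (right_end \<gamma> E n' u c), right_end \<gamma> E n u c) \<in> conn ?J" for u c
    using end_shift(3,4,7-10)[of c u] conn_sym[OF r] by (cases "c = i \<and> u = tail i"; simp)+
  show "Rung i 0 \<sigma> \<in> L' \<and> (unshift (Rung i 0 \<sigma>), Rung i 0 \<sigma>) \<in> conn ?J" for \<sigma>
    using iE conn_sym[OF r] by simp
  show "(shift (Rung i 0) p, shift (Rung i 0) q) \<in> conn (vertex_joins \<gamma> E n' W)" if "(p, q) \<in> ?J" for p q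
    using that
  proof
    assume "(p, q) \<in> vertex_joins \<gamma> E n W"
    then show ?thesis by (intro conn_base) (auto simp: vertex_joins_def s)
  qed auto
  show "(unshift p, unshift q) \<in> conn ?J" if pq: "(p, q) \<in> vertex_joins \<gamma> E n' W" for p q
  proof -
    obtain v c d where v: "p = left_end \<gamma> E n' v c" "q = right_end \<gamma> E n' v d" "v \<in> {0..3}" "W v c d"
      using pq unfolding vertex_joins_def by blast
    have "(left_end \<gamma> E n v c, right_end \<gamma> E n v d) \<in> vertex_joins \<gamma> E n W"
      using v unfolding vertex_joins_def by blast
    then have "(left_end \<gamma> E n v c, right_end \<gamma> E n v d) \<in> conn ?J" by (intro conn_base) blast
    then show ?thesis unfolding v(1,2) using u(1)[of v c] u(2)[of v d] by (meson conn_sym conn_trans)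
  qed
qed (use X_labels in auto)

text \<open>The old cap and the stub form a split circle, and the cut end of the band is the new
  cap.\<close>

lemma br_Cut_detached:
  "br L X (vertex_joins \<gamma> E n (detached \<gamma> E i (tail i)) \<union> Cut_joins) = \<delta> * band_bracket \<gamma> E n' (detached \<gamma> E i (tail i))"
proof -
  let ?W = "detached \<gamma> E i (tail i)" and ?Q = "{Rung i 0 LeftSide, Rung i 0 RightSide}"
  have iin: "i \<in> incident E (tail i)" using iE by (simp add: incident_def)
  have vi: "tail i \<in> {0..3}" using tail_head_range iE EE by blast
  have W: "?W (tail i) c d \<longleftrightarrow> next_edge \<gamma> (E - {i}) (tail i) c d \<or> c = i \<and> d = i" for c d by (simp add: detached_def)
  have Wi: "?W (tail i) c i \<longleftrightarrow> c = i" "?W (tail i) i c \<longleftrightarrow> c = i" for c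
    using next_edge_incident[of \<gamma> "E - {i}" "tail i" c i] next_edge_incident[of \<gamma> "E - {i}" "tail i" i c]
    unfolding W by (auto simp: incident_Diff)
  \<comment> \<open>All joins except the one that closes the old cap; none of them touches the first
    rungs.\<close>
  define V where "V = {(left_end \<gamma> E n u c, right_end \<gamma> E n u d) | u c d. u \<in> {0..3} \<and> ?W u c d \<and> \<not> (u = tail i \<and> c = i)}"
  have Vd: "\<not> (u = tail i \<and> d = i)" if "?W u c d" "\<not> (u = tail i \<and> c = i)" for u c d
    using that Wi by blast
  have VJ: "vertex_joins \<gamma> E n ?W = insert (Rung i 0 LeftSide, Rung i 0 RightSide) V" (is "?A = ?B")
  proof
    show "?A \<subseteq> ?B"
    proof (clarify)
      fix p q assume "(p, q) \<in> ?A" "(p, q) \<notin> V"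
      then obtain u c d where "p = left_end \<gamma> E n u c" "q = right_end \<gamma> E n u d" "?W u c d" "u = tail i \<and> c = i"
        unfolding vertex_joins_def V_def by blast
      moreover from this have "d = i" using Wi by blast
      ultimately show "p = Rung i 0 LeftSide \<and> q = Rung i 0 RightSide" by (simp add: end_shift(3,4))
    qed
    have "?W (tail i) i i" using Wi by blast
    then have "(Rung i 0 LeftSide, Rung i 0 RightSide) \<in> ?A"
      unfolding vertex_joins_def using end_shift(3,4)[OF refl refl, symmetric] vi by blast
    then show "?B \<subseteq> ?A" unfolding V_def vertex_joins_def by blast
  qed
  have endL: "left_end \<gamma> E n u c \<in> L" "right_end \<gamma> E n u c \<in> L" if "c \<in> incident E u" for u c
    using that by (auto simp: left_end_def right_end_def incident_def)
  have VL: "V \<subseteq> (L - ?Q) \<times> (L - ?Q)"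
  proof (clarify)
    fix p q assume "(p, q) \<in> V"
    then obtain u c d where *: "p = left_end \<gamma> E n u c" "q = right_end \<gamma> E n u d" "?W u c d" "\<not> (u = tail i \<and> c = i)"
      unfolding V_def by blast
    have noL: "left_end \<gamma> E n u c \<noteq> Rung i 0 \<sigma>" for \<sigma> by (rule end_shift(5)) (use * in blast)
    have noR: "right_end \<gamma> E n u d \<noteq> Rung i 0 \<sigma>" for \<sigma> by (rule end_shift(6)) (use Vd[OF *(3,4)] in blast)
    from * show "p \<in> L - ?Q \<and> q \<in> L - ?Q"
      using endL detached_incident[OF iin *(3)] noL noR by auto
  qed
  have XQ: "X \<subseteq> over (L - ?Q)"
  proof -
    have "crossing_arcs c \<inter> ?Q = {}" if c: "c \<in> X" for c
    proof -
      from c consider "c \<in> twists E n - {t0}" | x \<sigma> \<tau> where "c = band_crossing \<gamma> E n x \<sigma> \<tau>"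
        by (auto simp: band_crossings_def)
      then show ?thesis
      proof cases
        case 1 then show ?thesis
          by (cases rule: twists_cases) (auto simp: twist_crossing_arcs)
      next
        case (2 x \<sigma> \<tau>)
        show ?thesis using position_n(1)[of "fst x"] position_n(1)[of "snd x"]
          unfolding 2 by (auto simp: band_crossing_def Let_def)
      qed
    qed
    moreover have "c \<in> over L" if "c \<in> X" for c using that X_labels by blast
    ultimately show ?thesis by fastforce
  qed
  let ?V1 = "insert (Rung i 1 RightSide, Rung i 1 LeftSide) V"
  have one: "Rung i 1 \<sigma> \<in> L - ?Q" for \<sigma> using iE last_n by simp
  have "vertex_joins \<gamma> E n ?W \<union> Cut_joins = ?V1 \<union> {(Rung i 0 LeftSide, Rung i 0 RightSide)}" unfolding VJ by auto
  moreover have "L = (L - ?Q) \<union> ?Q" using iE by auto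
  ultimately have "br L X (vertex_joins \<gamma> E n ?W \<union> Cut_joins) = br ((L - ?Q) \<union> ?Q) X (?V1 \<union> {(Rung i 0 LeftSide, Rung i 0 RightSide)})"
    by metis
  also have "\<dots> = \<delta> * br (L - ?Q) X ?V1"
  proof (rule br_circle[where c = "Rung i 0 LeftSide"])
    show "finite (L - ?Q)" using finite_band_labels[OF reg finite_E] by simp
    show "?V1 \<subseteq> (L - ?Q) \<times> (L - ?Q)" using VL one by simp
    show "(Rung i 0 LeftSide, q) \<in> conn {(Rung i 0 LeftSide, Rung i 0 RightSide)}" if "q \<in> ?Q" for q
      using that by (auto intro: conn_base)
  qed (use XQ in auto)
  also have "br (L - ?Q) X ?V1 = band_bracket \<gamma> E n' ?W"
    unfolding band_bracket_def
  proof (rule br_shift[where a = "Rung i 0", OF _ _ XQ])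
    show "Rung i 0 \<sigma> \<in> L' \<and> (unshift (Rung i 0 \<sigma>), Rung i 0 \<sigma>) \<in> conn ?V1" if "Rung i 0 \<sigma> \<in> L - ?Q" for \<sigma>
      using that by (cases \<sigma>) auto
    show "(shift (Rung i 0) p, shift (Rung i 0) q) \<in> conn (vertex_joins \<gamma> E n' ?W)" if pq: "(p, q) \<in> ?V1" for p q
      using pq
    proof
      assume "(p, q) = (Rung i 1 RightSide, Rung i 1 LeftSide)"
      moreover have "(Rung i 0 LeftSide, Rung i 0 RightSide) \<in> vertex_joins \<gamma> E n' ?W"
        unfolding vertex_joins_def using end_shift(9,10)[OF refl refl, symmetric] vi Wi(1)[of i] by blast
      ultimately show ?thesis by (auto intro: conn_base)
    next
      assume "(p, q) \<in> V"
      then obtain u c d where *: "p = left_end \<gamma> E n u c" "q = right_end \<gamma> E n u d" "u \<in> {0..3}" "?W u c d" "\<not> (u = tail i \<and> c = i)"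
        unfolding V_def by blast
      have "shift (Rung i 0) p = left_end \<gamma> E n' u c" "shift (Rung i 0) q = right_end \<gamma> E n' u d"
        using end_shift(1)[of u c] end_shift(2)[of u d] end_shift(5)[of c u] end_shift(6)[of d u] * Vd[OF *(4,5)] by auto
      then show ?thesis using * by (intro conn_base) (auto simp: vertex_joins_def)
    qed
    show "(unshift p, unshift q) \<in> conn ?V1" if pq: "(p, q) \<in> vertex_joins \<gamma> E n' ?W" for p q
    proof -
      obtain u c d where *: "p = left_end \<gamma> E n' u c" "q = right_end \<gamma> E n' u d" "u \<in> {0..3}" "?W u c d"
        using pq unfolding vertex_joins_def by blast
      show ?thesis
      proof (cases "u = tail i \<and> c = i")
        case True
        then have "d = i" using Wi * by blast
        then have "p = Rung i 0 LeftSide" "q = Rung i 0 RightSide" using * True end_shift(9,10) by auto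
        then show ?thesis by (auto intro: conn_base)
      next
        case False
        then have "unshift p = left_end \<gamma> E n u c" "unshift q = right_end \<gamma> E n u d"
          using end_shift(7)[of c u] end_shift(8)[of d u] * Vd[OF *(4) False] by auto
        then have "(unshift p, unshift q) \<in> V" unfolding V_def using * False by blast
        then show ?thesis by (intro conn_base) blast
      qed
    qed
  qed (use iE in auto)
  finally show ?thesis .
qed

text \<open>The stub is drawn back into its disk: its two rungs are slid to the right end of the
  successor \<open>z\<close> of \<open>i\<close>. The predecessor of \<open>i\<close> then runs on
  to \<open>z\<close>, in accordance with \<open>next_edge_remove\<close>, and the cut end becomes a
  cap.\<close>

lemma br_Cut_next:
  assumes ne: "incident (E - {i}) (tail i) \<noteq> {}"
  shows "br L X (vertex_joins \<gamma> E n (next_edge \<gamma> E) \<union> Cut_joins) = band_bracket \<gamma> E n' (detached \<gamma> E i (tail i))"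
proof -
  let ?v = "tail i" and ?J = "vertex_joins \<gamma> E n (next_edge \<gamma> E) \<union> Cut_joins"
  let ?W = "detached \<gamma> E i ?v" and ?J' = "vertex_joins \<gamma> E n' (detached \<gamma> E i (tail i))"
  have iin: "i \<in> incident E ?v" using iE by (simp add: incident_def)
  have vi: "?v \<in> {0..3}" using tail_head_range iE EE by blast
  obtain z where z: "next_edge \<gamma> E ?v i z" and zu: "\<And>b. next_edge \<gamma> E ?v i b \<Longrightarrow> b = z"
    using next_edge_total[OF reg vi EE iin] by blast
  have zi: "z \<noteq> i" using next_edge_self[OF reg vi EE] z ne by (auto simp: incident_Diff)
  have zin: "z \<in> incident E ?v" using next_edge_incident[OF z] by blast
  define anc where "anc = right_end \<gamma> E n' ?v z"
  have anc: "anc \<in> L'" "unshift anc = right_end \<gamma> E n ?v z"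
    using zin zi end_shift(8)[of z ?v] unfolding anc_def by (auto simp: right_end_def incident_def)
  show ?thesis
    unfolding band_bracket_def
  proof (rule br_shift[where a = "\<lambda>_. anc", OF _ _ X_labels(1)])
    have L: "(unshift anc, Rung i 0 LeftSide) \<in> conn ?J"
    proof -
      have "(left_end \<gamma> E n ?v i, right_end \<gamma> E n ?v z) \<in> ?J" unfolding vertex_joins_def using z vi by blast
      then show ?thesis unfolding anc(2) end_shift(3)[OF refl refl] by (intro conn_base) blast
    qed
    have LR: "(Rung i 0 LeftSide, Rung i 0 RightSide) \<in> conn ?J" by (intro conn_base) blast
    show a: "anc \<in> L' \<and> (unshift anc, Rung i 0 \<sigma>) \<in> conn ?J" for \<sigma>
      using anc(1) L conn_trans[OF L LR] by (cases \<sigma>) auto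
    have J'I: "(left_end \<gamma> E n' u c, right_end \<gamma> E n' u d) \<in> conn ?J'" if "u \<in> {0..3}" "?W u c d" for u c d
      using that by (intro conn_base) (auto simp: vertex_joins_def)
    show "(shift (\<lambda>_. anc) p, shift (\<lambda>_. anc) q) \<in> conn ?J'" if pq: "(p, q) \<in> ?J" for p q
      using pq
    proof
      assume "(p, q) \<in> vertex_joins \<gamma> E n (next_edge \<gamma> E)"
      then obtain u c d where *: "p = left_end \<gamma> E n u c" "q = right_end \<gamma> E n u d" "u \<in> {0..3}" "next_edge \<gamma> E u c d"
        unfolding vertex_joins_def by blast
      have sl: "shift (\<lambda>_. anc) p = (if c = i \<and> u = ?v then anc else left_end \<gamma> E n' u c)"
        using end_shift(1)[of u c "\<lambda>_. anc"] end_shift(3,5)[of c u] * by auto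
      have sr: "shift (\<lambda>_. anc) q = (if d = i \<and> u = ?v then anc else right_end \<gamma> E n' u d)"
        using end_shift(2)[of u d "\<lambda>_. anc"] end_shift(4,6)[of d u] * by auto
      consider "u \<noteq> ?v \<or> c \<noteq> i \<and> d \<noteq> i" | "u = ?v" "c = i" | "u = ?v" "c \<noteq> i" "d = i" by blast
      then show ?thesis
      proof cases
        case 1
        then have "?W u c d" unfolding detached_def using * next_edge_remove[OF reg vi EE] by auto
        then show ?thesis using J'I[OF *(3)] 1 unfolding sl sr by auto
      next
        case 2
        then have "d = z" using zu * by blast
        then show ?thesis unfolding sl sr using 2 zi by (simp add: anc_def)
      next
        case 3
        then have "next_edge \<gamma> (E - {i}) ?v c z"
          unfolding next_edge_remove[OF reg vi EE] using * z zi by blast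
        then show ?thesis using J'I[OF vi, of c z] 3 unfolding sl sr by (simp add: anc_def detached_def)
      qed
    next
      assume "(p, q) \<in> Cut_joins"
      moreover have "(Rung i 0 LeftSide, Rung i 0 RightSide) \<in> conn ?J'"
        using J'I[OF vi, of i i] end_shift(9,10)[OF refl refl] by (simp add: detached_def)
      ultimately show ?thesis using conn_sym by auto
    qed
    show "(unshift p, unshift q) \<in> conn ?J" if pq: "(p, q) \<in> ?J'" for p q
    proof -
      obtain u c d where *: "p = left_end \<gamma> E n' u c" "q = right_end \<gamma> E n' u d" "u \<in> {0..3}" "?W u c d"
        using pq unfolding vertex_joins_def by blast
      have JI: "(left_end \<gamma> E n u c, right_end \<gamma> E n u d) \<in> conn ?J" if "u \<in> {0..3}" "next_edge \<gamma> E u c d" for u c d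
        using that by (intro conn_base) (auto simp: vertex_joins_def)
      consider "u = ?v" "c = i" "d = i" | "next_edge \<gamma> E u c d" "\<not> (c = i \<and> u = ?v)" "\<not> (d = i \<and> u = ?v)"
        | "u = ?v" "c \<noteq> i" "d \<noteq> i" "next_edge \<gamma> E ?v c i" "next_edge \<gamma> E ?v i d"
        using * next_edge_remove[OF reg vi EE] unfolding detached_def by (auto split: if_splits)
      then show ?thesis
      proof cases
        case 1
        then have "p = Rung i 0 LeftSide" "q = Rung i 0 RightSide" using * end_shift(9,10) by auto
        then show ?thesis by (auto intro: conn_base)
      next
        case 2
        then show ?thesis using JI[OF *(3) 2(1)] end_shift(7)[OF 2(2)] end_shift(8)[OF 2(3)] * by simp
      next
        case 3
        have "unshift p = left_end \<gamma> E n u c" "unshift q = right_end \<gamma> E n u d"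
          using end_shift(7)[of c u] end_shift(8)[of d u] * 3 by auto
        moreover have "(left_end \<gamma> E n u c, Rung i 0 RightSide) \<in> conn ?J" "(Rung i 0 LeftSide, right_end \<gamma> E n u d) \<in> conn ?J"
          using JI[OF vi 3(4)] JI[OF vi 3(5)] 3 end_shift(3,4)[OF refl refl] by auto
        ultimately show ?thesis using conn_trans[OF _ conn_trans[OF conn_sym[OF LR]]] by metis
      qed
    qed
  qed (use iE in auto)
qed

text \<open>A half twist in a band that ends on a cap is a Reidemeister I kink: the factor is
  \<open>- (\<A> powi (-3))\<close> for a positive twist and the inverse of this for a negative
  one.\<close>

lemma band_bracket_detached_step:
  "band_bracket \<gamma> E n (detached \<gamma> E i (tail i)) =
     (weight (n i > 0) + weight (\<not> n i > 0) * \<delta>) * band_bracket \<gamma> E n' (detached \<gamma> E i (tail i))"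
  unfolding band_bracket_skein br_Id br_Cut_detached by (simp only: ring_distribs mult.assoc)

text \<open>If the disk at the tail carries no other band, it splits off together with the stub;
  this is the factor \<delta>.\<close>

lemma band_bracket_next_step:
  "band_bracket \<gamma> E n (next_edge \<gamma> E) = weight (n i > 0) * band_bracket \<gamma> E n' (next_edge \<gamma> E)
     + weight (\<not> n i > 0) * ((if incident (E - {i}) (tail i) = {} then \<delta> else 1) *
         band_bracket \<gamma> E n' (detached \<gamma> E i (tail i)))"
proof (cases "incident (E - {i}) (tail i) = {}")
  case True
  then have "incident E (tail i) = {i}" using iE by (auto simp: incident_def)
  then have "next_edge \<gamma> E = detached \<gamma> E i (tail i)" by (simp add: detached_pendant)
  then show ?thesis using True band_bracket_skein[of "next_edge \<gamma> E"] br_Id[of "next_edge \<gamma> E"] br_Cut_detached by simp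
qed (use br_Cut_next band_bracket_skein[of "next_edge \<gamma> E"] br_Id[of "next_edge \<gamma> E"] in simp)

end

section \<open>Retracting a band that ends on a cap\<close>

text \<open>The cap is at the tail if \<open>d\<close> holds and at the head otherwise. Both occur:
  a cut leaves a cap at the tail, while the leaf of a graph may be at either end of its
  edge.\<close>

locale retraction =
  fixes \<gamma> :: spatial_graph and E :: "nat set" and n :: "nat \<Rightarrow> int" and i :: nat and d :: bool
  assumes reg: "regular_projection \<gamma>" and EE: "E \<subseteq> {1..6}" and iE: "i \<in> E" and ni: "n i = 0"
begin

definition "v = (if d then tail i else head i)"
definition "w = (if d then head i else tail i)"

abbreviation "L \<equiv> band_labels \<gamma> E n"
abbreviation "S \<equiv> sub_crossings \<gamma> E"
abbreviation "len \<equiv> last_rung \<gamma> E n i"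

text \<open>The rungs of the band, and the crossings on it, are counted from the cap.\<close>

definition rg :: "nat \<Rightarrow> side \<Rightarrow> band_arc" where
  "rg e \<sigma> = Rung i (if d then e else len - e) \<sigma>"

definition on :: "graph_crossing \<Rightarrow> bool \<Rightarrow> bool" where
  "on x b \<longleftrightarrow> x \<in> S \<and> fst (crossing_point x b) = i"

definition depth :: "graph_crossing \<Rightarrow> bool \<Rightarrow> nat" where
  "depth x b = (if d then position \<gamma> E n (crossing_point x b) else len - Suc (position \<gamma> E n (crossing_point x b)))"

definition near :: "graph_crossing \<Rightarrow> bool \<Rightarrow> side \<Rightarrow> band_arc" where
  "near x b = (if d then strand_in \<gamma> E n x b else strand_out \<gamma> E n x b)"

definition far :: "graph_crossing \<Rightarrow> bool \<Rightarrow> side \<Rightarrow> band_arc" where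
  "far x b = (if d then strand_out \<gamma> E n x b else strand_in \<gamma> E n x b)"

lemma finite_E: "finite E" using EE by (rule finite_subset) simp

lemma vw: "v \<in> {0..3}" "w \<in> {0..3}" "v \<noteq> w" "i \<in> incident E v" "i \<in> incident E w"
    "i \<in> incident E u \<Longrightarrow> u = v \<or> u = w"
  using tail_head_range[of i] tail_neq_head[of i] iE EE by (auto simp: v_def w_def incident_def)

lemma on_position: "on x b \<Longrightarrow> position \<gamma> E n (crossing_point x b) < len"
  using position_bounds[OF reg, of x E b i n] by (simp add: on_def)

lemma depth_less: "on x b \<Longrightarrow> depth x b < len"
  using on_position[of x b] by (auto simp: depth_def)

lemma near_rg: "on x b \<Longrightarrow> near x b \<sigma> = rg (depth x b) \<sigma>" "on x b \<Longrightarrow> far x b \<sigma> = rg (Suc (depth x b)) \<sigma>"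
  using on_position[of x b] by (auto simp: near_def far_def rg_def depth_def strand_in_def strand_out_def on_def)

lemma rg_inject: "e \<le> len \<Longrightarrow> e' \<le> len \<Longrightarrow> rg e \<sigma> = rg e' \<sigma>' \<longleftrightarrow> e = e' \<and> \<sigma> = \<sigma>'"
  by (auto simp: rg_def)

lemma rg_neq [simp]: "rg e \<sigma> \<noteq> mid x b \<tau>" "mid x b \<tau> \<noteq> rg e \<sigma>"
  by (simp_all add: rg_def)

lemma Rung_rg: "m \<le> len \<Longrightarrow> \<exists>e\<le>len. \<forall>\<sigma>. Rung i m \<sigma> = rg e \<sigma>"
  unfolding rg_def by (rule exI[of _ "if d then m else len - m"]) auto

lemma depth_ex:
  assumes "e < len"
  obtains x b where "on x b" "depth x b = e"
proof -
  let ?m = "if d then e else len - Suc e"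
  have "nat \<bar>n i\<bar> \<le> ?m" "?m < len" using assms ni by auto
  then obtain x b where "x \<in> S" "fst (crossing_point x b) = i" "position \<gamma> E n (crossing_point x b) = ?m"
    by (rule position_sub_ex1[OF reg])
  then show thesis using that[of x b] assms by (auto simp: on_def depth_def)
qed

lemma depth_unique:
  assumes "on x b" "on y c" "depth x b = depth y c"
  shows "x = y \<and> b = c"
proof (rule position_unique[OF reg, where E = E and n = n])
  show "position \<gamma> E n (crossing_point x b) = position \<gamma> E n (crossing_point y c)"
    using assms on_position[OF assms(1)] on_position[OF assms(2)] by (auto simp: depth_def split: if_splits)
qed (use assms in \<open>simp_all add: on_def\<close>)

text \<open>The part of the band swallowed by the cap after \<open>e\<close> crossings. It ends with
  the rungs just before the crossing of depth \<open>e\<close>; the mid arcs of that crossing are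
  still outside.\<close>

definition capped :: "nat \<Rightarrow> band_arc set" where
  "capped e = {rg e' \<sigma> | e' \<sigma>. e' \<le> e} \<union> {mid y c \<sigma> | y c \<sigma>. on y c \<and> depth y c < e}"

text \<open>A self-crossing of the band counts as passed from the first of its two visits
  on.\<close>

definition passed :: "nat \<Rightarrow> graph_crossing set" where
  "passed e = {x\<in>S. \<exists>b. on x b \<and> depth x b < e}"

abbreviation "J0 \<equiv> vertex_joins \<gamma> E n (detached \<gamma> E i v)"
abbreviation "Vj Y \<equiv> \<Union>(virtual_joins ` band_crossings \<gamma> E n Y)"

definition stage :: "nat \<Rightarrow> int poly fract" where
  "stage e = br L (twists E n \<union> band_crossings \<gamma> E n (S - passed e)) (J0 \<union> Vj (passed e))"

lemma strand_arcs_near: "strand_arcs \<gamma> E n x b = range (near x b) \<union> range (mid x b) \<union> range (far x b)"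
  by (auto simp: strand_arcs_def near_def far_def)

lemma strand_capped: "on y c \<Longrightarrow> depth y c < e \<Longrightarrow> strand_arcs \<gamma> E n y c \<subseteq> capped e"
  unfolding strand_arcs_near capped_def using near_rg[of y c] by fastforce

lemma strand_uncapped:
  assumes "e \<le> len" "y \<in> S" "\<not> (on y c \<and> depth y c \<le> e)"
  shows "strand_arcs \<gamma> E n y c \<inter> capped e = {}"
proof (cases "on y c")
  case True
  then have "e < depth y c" "depth y c < len" using assms(3) depth_less by auto
  then show ?thesis unfolding strand_arcs_near capped_def using near_rg[OF True] rg_inject assms(1) by auto
next
  case False
  then have "fst (crossing_point y c) \<noteq> i" using assms(2) by (simp add: on_def)
  then show ?thesis using False
    by (auto simp: strand_arcs_def capped_def strand_in_def strand_out_def rg_def)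
qed

lemma capped_labels: "e \<le> len \<Longrightarrow> capped e \<subseteq> L"
  using iE by (auto simp: capped_def rg_def on_def)

lemma end_labels:
  "a \<in> incident E u \<Longrightarrow> left_end \<gamma> E n u a \<in> L" "a \<in> incident E u \<Longrightarrow> right_end \<gamma> E n u a \<in> L"
  by (auto simp: left_end_def right_end_def incident_def)

lemma end_cap: "\<exists>\<sigma>. left_end \<gamma> E n v i = rg 0 \<sigma>" "\<exists>\<sigma>. right_end \<gamma> E n v i = rg 0 \<sigma>"
    "\<exists>\<sigma>. left_end \<gamma> E n w i = rg len \<sigma>" "\<exists>\<sigma>. right_end \<gamma> E n w i = rg len \<sigma>"
  using vw(3) by (auto simp: left_end_def right_end_def v_def w_def rg_def)

lemma cap_conn: "(rg 0 \<sigma>, rg 0 \<tau>) \<in> conn J0"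
proof -
  have "detached \<gamma> E i v v i i" by (simp add: detached_def)
  then have "(left_end \<gamma> E n v i, right_end \<gamma> E n v i) \<in> J0" using vw(1) unfolding vertex_joins_def by blast
  then have "(rg 0 LeftSide, rg 0 RightSide) \<in> conn J0"
    using vw(3) unfolding left_end_def right_end_def v_def w_def rg_def by (intro conn_base) (auto split: if_splits)
  then show ?thesis using conn_sym by (cases \<sigma>; cases \<tau>) auto
qed

lemma J0_cases:
  assumes "(p, q) \<in> J0"
  obtains "p \<in> range (rg 0)" "q \<in> range (rg 0)"
  | u a b where "u \<in> {0..3}" "a \<in> incident E u" "b \<in> incident E u" "p = left_end \<gamma> E n u a" "q = right_end \<gamma> E n u b"
     "\<not> (u = v \<and> (a = i \<or> b = i))" "if u = v then next_edge \<gamma> (E - {i}) u a b else next_edge \<gamma> E u a b"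
proof -
  obtain u a b where *: "u \<in> {0..3}" "p = left_end \<gamma> E n u a" "q = right_end \<gamma> E n u b" "detached \<gamma> E i v u a b"
    using assms unfolding vertex_joins_def by blast
  note inc = detached_incident[OF vw(4) *(4)]
  show thesis
  proof (cases "u = v \<and> a = i \<and> b = i")
    case True
    then show thesis using that(1) * end_cap(1,2) by auto
  next
    case False
    then have n: "if u = v then next_edge \<gamma> (E - {i}) u a b else next_edge \<gamma> E u a b"
      using *(4) by (auto simp: detached_def split: if_splits)
    then have "\<not> (u = v \<and> (a = i \<or> b = i))"
      using next_edge_incident[of \<gamma> "E - {i}" u a b] by (auto simp: incident_Diff split: if_splits)
    then show thesis using that(2)[OF *(1) _ _ *(2,3)] inc n by blast
  qed
qed

lemma J0_Rung: "(p, q) \<in> J0 \<Longrightarrow> p \<noteq> mid x b \<sigma> \<and> q \<noteq> mid x b \<sigma>"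
  by (auto simp: vertex_joins_def left_end_def right_end_def split: if_splits)

text \<open>The strict bound keeps the last rungs \<open>rg len\<close>, which belong to the disk at
  \<open>w\<close>, out of the capped set.\<close>

lemma J0_capped:
  assumes "e < len"
  shows "J0 \<subseteq> (L - capped e) \<times> (L - capped e) \<union> capped e \<times> capped e"
proof -
  have far: "rg len \<sigma> \<notin> capped e" for \<sigma> using assms by (auto simp: capped_def rg_inject)
  have other: "Rung a m \<sigma> \<notin> capped e" if "a \<noteq> i" for a m \<sigma> using that by (auto simp: capped_def rg_def)
  have "left_end \<gamma> E n u a \<notin> capped e" "right_end \<gamma> E n u a \<notin> capped e" if "a \<in> incident E u" "\<not> (u = v \<and> a = i)" for u a
  proof -
    have "left_end \<gamma> E n u a \<notin> capped e \<and> right_end \<gamma> E n u a \<notin> capped e"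
    proof (cases "a = i")
      case True
      then have "u = w" using that vw(6) by blast
      then show ?thesis using True end_cap(3,4) far by metis
    next
      case False
      then show ?thesis using other by (auto simp: left_end_def right_end_def)
    qed
    then show "left_end \<gamma> E n u a \<notin> capped e" "right_end \<gamma> E n u a \<notin> capped e" by auto
  qed
  note no = this
  have r0: "range (rg 0) \<subseteq> capped e" by (auto simp: capped_def)
  show ?thesis
  proof (rule subrelI)
    fix p q assume "(p, q) \<in> J0"
    then show "(p, q) \<in> (L - capped e) \<times> (L - capped e) \<union> capped e \<times> capped e"
    proof (cases rule: J0_cases)
      case 1 then show ?thesis using r0 by blast
    next
      case (2 u a b)
      then show ?thesis using end_labels no by blast
    qed
  qed
qed

lemma near_mid_far:
  assumes "x \<in> Y"
  shows "(near x b \<sigma>, mid x b \<sigma>) \<in> conn (Vj Y)" "(mid x b \<sigma>, far x b \<sigma>) \<in> conn (Vj Y)"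
  using virtual_joins_strand[OF assms refl, where \<gamma> = \<gamma> and E = E and n = n and b = b and \<sigma> = \<sigma>] conn_sym by (auto simp: near_def far_def)

text \<open>The swallowed part is a single class. Its shape is irrelevant to the type II move, which
  asks only for a connected tip.\<close>

lemma conn_capped:
  assumes "e \<le> len" "p \<in> capped e"
  shows "(rg 0 \<tau>, p) \<in> conn (J0 \<union> Vj (passed e))"
proof -
  let ?J = "J0 \<union> Vj (passed e)"
  have nf: "(near x b \<sigma>, mid x b \<sigma>) \<in> conn ?J" "(mid x b \<sigma>, far x b \<sigma>) \<in> conn ?J"
    if "on x b" "depth x b < e" for x b \<sigma>
  proof -
    have "x \<in> passed e" using that by (auto simp: passed_def on_def)
    note nm = near_mid_far[OF this, of b \<sigma>]
    show "(near x b \<sigma>, mid x b \<sigma>) \<in> conn ?J" "(mid x b \<sigma>, far x b \<sigma>) \<in> conn ?J"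
      by (rule conn_mono[OF nm(1)], blast) (rule conn_mono[OF nm(2)], blast)
  qed
  have r: "e' \<le> e \<Longrightarrow> (rg 0 \<tau>, rg e' \<sigma>) \<in> conn ?J" for e' \<sigma>
  proof (induction e')
    case 0
    show ?case by (rule conn_mono[OF cap_conn]) blast
  next
    case (Suc e')
    then have "e' < len" using assms(1) by simp
    then obtain x b where x: "on x b" "depth x b = e'" by (rule depth_ex)
    have "(rg e' \<sigma>, rg (Suc e') \<sigma>) \<in> conn ?J"
      using conn_trans[OF nf[OF x(1)]] Suc.prems x near_rg[OF x(1)] by simp
    moreover have "(rg 0 \<tau>, rg e' \<sigma>) \<in> conn ?J" using Suc by simp
    ultimately show ?case by (rule conn_trans[rotated])
  qed
  from assms(2) consider e' \<sigma> where "p = rg e' \<sigma>" "e' \<le> e"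
    | y c \<sigma> where "p = mid y c \<sigma>" "on y c" "depth y c < e"
    unfolding capped_def by blast
  then show ?thesis
  proof cases
    case 1 then show ?thesis using r by simp
  next
    case (2 y c \<sigma>)
    show ?thesis using conn_trans[OF r nf(1)[OF 2(2,3), of \<sigma>, unfolded near_rg(1)[OF 2(2)]]] 2 by simp
  qed
qed

text \<open>Only a strand at depth exactly \<open>e\<close> straddles the border of the capped set,
  with its near rung inside and its mid arc outside.\<close>

lemma virtual_capped:
  assumes "e \<le> len" "y \<in> S" "\<And>c. on y c \<Longrightarrow> depth y c \<noteq> e"
  shows "virtual_joins (band_crossing \<gamma> E n y \<sigma> \<tau>) \<subseteq> (L - capped e) \<times> (L - capped e) \<union> capped e \<times> capped e"
proof (rule subrelI)
  fix p q assume "(p, q) \<in> virtual_joins (band_crossing \<gamma> E n y \<sigma> \<tau>)"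
  then obtain c \<rho> where "{p, q} \<subseteq> {strand_in \<gamma> E n y c \<rho>, mid y c \<rho>, strand_out \<gamma> E n y c \<rho>}"
    by (rule virtual_joins_sides)
  then have pq: "{p, q} \<subseteq> strand_arcs \<gamma> E n y c" by (auto simp: strand_arcs_def)
  show "(p, q) \<in> (L - capped e) \<times> (L - capped e) \<union> capped e \<times> capped e"
  proof (cases "on y c \<and> depth y c < e")
    case True
    then show ?thesis using strand_capped[of y c e] pq by blast
  next
    case False
    then have "\<not> (on y c \<and> depth y c \<le> e)" using assms(3)[of c] by auto
    then show ?thesis
      using strand_uncapped[OF assms(1,2)] strand_arcs_labels[OF reg assms(2), of n c] pq by blast
  qed
qed

lemma band_crossings_uncapped:
  assumes "e \<le> len" "Y \<subseteq> S" "\<And>y c. y \<in> Y \<Longrightarrow> on y c \<Longrightarrow> e < depth y c" "A = L - capped e"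
  shows "band_crossings \<gamma> E n Y \<subseteq> over A"
proof
  fix c assume "c \<in> band_crossings \<gamma> E n Y"
  then obtain y \<sigma> \<tau> where c: "c = band_crossing \<gamma> E n y \<sigma> \<tau>" "y \<in> Y" unfolding band_crossings_def by blast
  have "strand_arcs \<gamma> E n y b \<subseteq> A" for b
  proof -
    have "\<not> (on y b \<and> depth y b \<le> e)" using assms(3)[OF c(2), of b] by auto
    moreover have "y \<in> S" using c assms(2) by blast
    ultimately show ?thesis using strand_uncapped[OF assms(1)] strand_arcs_labels[OF reg] assms(4) by blast
  qed
  then show "c \<in> over A" unfolding c(1) by (rule band_crossing_arcs)
qed

lemma twists_off: "twists E n \<subseteq> over A" if "\<And>j m \<sigma>. j \<in> E \<Longrightarrow> j \<noteq> i \<Longrightarrow> m \<le> nat \<bar>n j\<bar> \<Longrightarrow> Rung j m \<sigma> \<in> A"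
proof
  fix c assume "c \<in> twists E n"
  then obtain j k where c: "c = twist_crossing n j k" "j \<in> E" "k < nat \<bar>n j\<bar>" unfolding twists_def by blast
  then have "j \<noteq> i" using ni by auto
  then show "c \<in> over A" using c that[of j] by (simp add: twist_crossing_def Let_def)
qed

text \<open>A graph crossing consists of four band crossings and is undone by two type II moves: the
  tip is pulled across side \<open>t1\<close> of the other band up to the mid arcs, then across side
  \<open>t2\<close> up to the far rungs. For the second move the mid arcs belong to the tip.\<close>

lemma stage_Suc:
  assumes e: "e < len"
  shows "stage e = stage (Suc e)"
proof -
  obtain x b where x: "on x b" "depth x b = e" using e by (rule depth_ex)
  have xS: "x \<in> S" using x by (simp add: on_def)
  have ps: "passed (Suc e) = insert x (passed e)"
  proof
    show "passed (Suc e) \<subseteq> insert x (passed e)"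
    proof
      fix y assume "y \<in> passed (Suc e)"
      then obtain c where c: "on y c" "depth y c < Suc e" by (auto simp: passed_def)
      show "y \<in> insert x (passed e)"
      proof (cases "depth y c = e")
        case True then show ?thesis using depth_unique[OF c(1) x(1)] x(2) by simp
      next
        case False
        then have "depth y c < e" using c(2) by simp
        then show ?thesis using c(1) by (auto simp: passed_def on_def)
      qed
    qed
    show "insert x (passed e) \<subseteq> passed (Suc e)" using x xS by (fastforce simp: passed_def)
  qed
  show ?thesis
  proof (cases "x \<in> passed e")
    \<comment> \<open>The second visit to a self-crossing, which is virtual already.\<close>
    case True
    then have "passed (Suc e) = passed e" unfolding ps by (rule insert_absorb)
    then show ?thesis by (simp add: stage_def)
  next
    case new: False
    \<comment> \<open>\<open>t1\<close> is the side of the other band that the tip meets first on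
      its way from the cap; \<open>s1\<close> is the side of the retracted band that the other band
      meets first.\<close>
    define t1 where "t1 = (if d then first_side \<gamma> x b else opposite_side (first_side \<gamma> x b))"
    define t2 where "t2 = opposite_side t1"
    define s1 where "s1 = first_side \<gamma> x (\<not> b)"
    define s2 where "s2 = opposite_side s1"
    \<comment> \<open>With the cap at the head the band is traversed backwards, which exchanges the
      smoothings.\<close>
    define \<beta> where "\<beta> = (if d then graph_crossing_sign \<gamma> x \<noteq> 1 else graph_crossing_sign \<gamma> x = 1)"
    define c where "c = side_crossing \<gamma> E n x b"
    define sin where "sin = strand_in \<gamma> E n x (\<not> b)"
    define smid where "smid = mid x (\<not> b)"
    define sout where "sout = strand_out \<gamma> E n x (\<not> b)"
    \<comment> \<open>The arcs of side \<tau> of the other band just before and just after it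
      crosses side \<sigma> of the retracted band.\<close>
    define O0 where "O0 \<sigma> \<tau> = (if \<sigma> = s1 then sin \<tau> else smid \<tau>)" for \<sigma> \<tau>
    define O1 where "O1 \<sigma> \<tau> = (if \<sigma> = s1 then smid \<tau> else sout \<tau>)" for \<sigma> \<tau>
    have s12: "s2 \<noteq> s1" "t2 \<noteq> t1" "\<sigma> = s1 \<or> \<sigma> = s2" "\<sigma> = t1 \<or> \<sigma> = t2" for \<sigma>
      unfolding s2_def t2_def by (cases \<sigma>; cases s1; cases t1; simp)+
    have sh: "shape \<beta> (c \<sigma> t1) (near x b \<sigma>) (O0 \<sigma> t1) (mid x b \<sigma>) (O1 \<sigma> t1)"
      "shape \<beta> (c \<sigma> t2) (mid x b \<sigma>) (O0 \<sigma> t2) (far x b \<sigma>) (O1 \<sigma> t2)" for \<sigma>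
      using side_crossing_shape[of \<gamma> x E n b \<sigma> t1] side_crossing_shape[of \<gamma> x E n b \<sigma> t2]
        shape_reverse[OF side_crossing_shape[of \<gamma> x E n b \<sigma> t1]] shape_reverse[OF side_crossing_shape[of \<gamma> x E n b \<sigma> t2]]
      unfolding t1_def t2_def \<beta>_def c_def O0_def O1_def s1_def sin_def smid_def sout_def near_def far_def
      by (simp_all split: if_splits)
    have O: "O0 s1 \<tau> = sin \<tau>" "O1 s1 \<tau> = smid \<tau>" "O0 s2 \<tau> = smid \<tau>" "O1 s2 \<tau> = sout \<tau>" for \<tau>
      using s12(1) by (simp_all add: O0_def O1_def)
    note sh1 = sh(1)[of s1, unfolded O] sh(1)[of s2, unfolded O] sh(2)[of s1, unfolded O] sh(2)[of s2, unfolded O]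
    define R where "R = twists E n \<union> band_crossings \<gamma> E n (S - passed (Suc e))"
    have cx: "band_crossings \<gamma> E n {x} = {c s1 t1, c s2 t1, c s1 t2, c s2 t2}"
    proof -
      have "band_crossings \<gamma> E n {x} = {c \<sigma> \<tau> | \<sigma> \<tau>. True}"
        unfolding band_crossings_def c_def side_crossing_def by (cases b) auto
      also have "\<dots> = {c s1 t1, c s2 t1, c s1 t2, c s2 t2}"
      proof (intro set_eqI iffI)
        fix z assume "z \<in> {c \<sigma> \<tau> | \<sigma> \<tau>. True}"
        then obtain \<sigma> \<tau> where "z = c \<sigma> \<tau>" by blast
        then show "z \<in> {c s1 t1, c s2 t1, c s1 t2, c s2 t2}" using s12(3)[of \<sigma>] s12(4)[of \<tau>] by auto
      qed blast
      finally show ?thesis .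
    qed
    have cinj: "c \<sigma> \<tau> = c \<sigma>' \<tau>' \<longleftrightarrow> \<sigma> = \<sigma>' \<and> \<tau> = \<tau>'" for \<sigma> \<tau> \<sigma>' \<tau>'
      unfolding c_def side_crossing_def band_crossing_inject by (cases b) auto
    have cR: "c \<sigma> \<tau> \<notin> R" for \<sigma> \<tau>
    proof
      assume "c \<sigma> \<tau> \<in> R"
      then consider k l where "c \<sigma> \<tau> = twist_crossing n k l"
        | y \<sigma>' \<tau>' where "c \<sigma> \<tau> = band_crossing \<gamma> E n y \<sigma>' \<tau>'" "y \<noteq> x"
        unfolding R_def ps twists_def band_crossings_def by blast
      then show False
        unfolding c_def side_crossing_def by cases (metis twist_crossing_not_band, metis band_crossing_inject)
    qed
    have BU: "band_crossings \<gamma> E n (insert x Y) = band_crossings \<gamma> E n {x} \<union> band_crossings \<gamma> E n Y" for Y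
      unfolding band_crossings_def by blast
    have X0: "twists E n \<union> band_crossings \<gamma> E n (S - passed e) = insert (c s1 t1) (insert (c s2 t1) (insert (c s1 t2) (insert (c s2 t2) R)))"
    proof -
      have "S - passed e = insert x (S - passed (Suc e))" using ps new xS by blast
      then have "band_crossings \<gamma> E n (S - passed e) = band_crossings \<gamma> E n {x} \<union> band_crossings \<gamma> E n (S - passed (Suc e))"
        using BU[of "S - passed (Suc e)"] by simp
      then show ?thesis unfolding R_def cx by (simp only: Un_insert_left Un_insert_right Un_empty_left)
    qed
    have Vs: "Vj (passed (Suc e)) = Vj (passed e) \<union> virtual_joins (c s1 t1) \<union> virtual_joins (c s2 t1)
        \<union> virtual_joins (c s1 t2) \<union> virtual_joins (c s2 t2)"
      unfolding ps BU[of "passed e"] unfolding cx by (simp add: Un_ac)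
    let ?K = "capped e" and ?J = "J0 \<union> Vj (passed e)"
    have finR: "finite R" using finite_twists[OF finite_E] finite_band_crossings finite_sub_crossings[OF reg] R_def by blast
    have finL: "finite L" by (rule finite_band_labels[OF reg finite_E])
    \<comment> \<open>If \<open>x\<close> is a self-crossing, its other strand lies deeper than
      \<open>e\<close>, since \<open>x\<close> has not been passed yet.\<close>
    have depth_b: "\<not> (on x (\<not> b) \<and> depth x (\<not> b) \<le> e)"
    proof
      assume a: "on x (\<not> b) \<and> depth x (\<not> b) \<le> e"
      moreover have "\<not> depth x (\<not> b) < e" using new a xS by (auto simp: passed_def)
      ultimately have "depth x (\<not> b) = depth x b" using x by simp
      then show False using depth_unique[of x "\<not> b" x b] a x by simp
    qed
    have arcs: "sin \<tau> \<in> L - ?K" "smid \<tau> \<in> L - ?K" "sout \<tau> \<in> L - ?K" for \<tau>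
    proof -
      have A: "strand_arcs \<gamma> E n x (\<not> b) \<subseteq> L - ?K"
        unfolding Diff_eq by (rule Int_greatest[OF strand_arcs_labels[OF reg xS]])
          (simp only: disjoint_eq_subset_Compl[symmetric] strand_uncapped[OF less_imp_le[OF e] xS depth_b])
      show "sin \<tau> \<in> L - ?K" "smid \<tau> \<in> L - ?K" "sout \<tau> \<in> L - ?K"
        by (rule subsetD[OF A], simp add: strand_arcs_def sin_def smid_def sout_def)+
    qed
    have near: "near x b \<sigma> \<in> ?K" for \<sigma> using near_rg(1)[OF x(1)] x(2) by (auto simp: capped_def)
    have far: "far x b \<sigma> \<in> L - ?K" for \<sigma>
      using near_rg(2)[OF x(1)] x(2) e rg_inject[of "Suc e"] iE by (auto simp: capped_def rg_def split: if_splits)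
    have mid: "mid x b \<sigma> \<in> L - ?K" for \<sigma> using xS x(2) by (auto simp: capped_def)
    have neq: "mid x b \<sigma> \<noteq> smid \<tau>" "mid x b \<sigma> \<noteq> sin \<tau>" "mid x b \<sigma> \<noteq> sout \<tau>" "far x b \<sigma> \<noteq> mid x b \<tau>"
        "sin \<sigma> \<noteq> smid \<tau>" "sout \<sigma> \<noteq> smid \<tau>" "far x b \<sigma> \<noteq> smid \<tau>" "sin \<tau> \<noteq> mid x b \<sigma>" "sout \<tau> \<noteq> mid x b \<sigma>"
        "smid \<tau> \<noteq> mid x b \<sigma>" for \<sigma> \<tau>
      using near_rg(2)[OF x(1)] by (auto simp: smid_def sin_def sout_def strand_in_def strand_out_def)
    have smid_inj: "smid \<sigma> = smid \<tau> \<longleftrightarrow> \<sigma> = \<tau>" for \<sigma> \<tau> by (simp add: smid_def)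
    \<comment> \<open>The mid arcs of \<open>x\<close> occur in no other crossing, so the
      contractions made in both moves do not touch \<open>R\<close>.\<close>
    have Rmid: "R \<subseteq> over (L - ?K - range (mid x b) - range smid)"
      (is "_ \<subseteq> over ?A")
    proof -
      have "twists E n \<subseteq> over ?A"
        by (rule twists_off) (auto simp: capped_def rg_def smid_def last_rung_def)
      moreover have "band_crossings \<gamma> E n (S - passed (Suc e)) \<subseteq> over ?A"
      proof
        fix z assume z: "z \<in> band_crossings \<gamma> E n (S - passed (Suc e))"
        have "band_crossings \<gamma> E n (S - passed (Suc e)) \<subseteq> over (L - ?K)"
        proof (rule band_crossings_uncapped[OF less_imp_le[OF e]])
          fix y c assume y: "y \<in> S - passed (Suc e)" "on y c"
          then have "\<not> depth y c < Suc e" by (auto simp: passed_def)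
          then show "e < depth y c" by simp
        qed auto
        then have "z \<in> over (L - ?K)" using z by blast
        moreover have "crossing_arcs z \<inter> (range (mid x b) \<union> range smid) = {}"
        proof -
          obtain y \<sigma> \<tau> where y: "z = band_crossing \<gamma> E n y \<sigma> \<tau>" "y \<noteq> x" using z ps unfolding band_crossings_def by blast
          then show ?thesis by (auto simp: smid_def mid_crossing_arcs)
        qed
        ultimately show "z \<in> over ?A" by (cases z) auto
      qed
      ultimately show ?thesis unfolding R_def by blast
    qed
    have VJ: "Vj (passed e) \<subseteq> (L - ?K - range smid) \<times> (L - ?K - range smid) \<union> ?K \<times> ?K" and
      Vmid: "Vj (passed e) \<inter> (range (mid x b) \<times> UNIV \<union> UNIV \<times> range (mid x b)) = {}"
    proof -
      have "virtual_joins (band_crossing \<gamma> E n y \<sigma> \<tau>) \<subseteq> (L - ?K - range smid) \<times> (L - ?K - range smid) \<union> ?K \<times> ?K \<and>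
          virtual_joins (band_crossing \<gamma> E n y \<sigma> \<tau>) \<inter> (range (mid x b) \<times> UNIV \<union> UNIV \<times> range (mid x b)) = {}"
        if y: "y \<in> passed e" for y \<sigma> \<tau>
      proof -
        have yx: "y \<noteq> x" "y \<in> S" using y new by (auto simp: passed_def)
        have "virtual_joins (band_crossing \<gamma> E n y \<sigma> \<tau>) \<subseteq> (L - ?K) \<times> (L - ?K) \<union> ?K \<times> ?K"
        proof (rule virtual_capped[OF less_imp_le[OF e] yx(2)])
          show "on y c \<Longrightarrow> depth y c \<noteq> e" for c using depth_unique[of y c x b] x yx(1) by auto
        qed
        moreover have "p \<notin> range smid \<and> q \<notin> range smid \<and> p \<notin> range (mid x b) \<and> q \<notin> range (mid x b)"
          if "(p, q) \<in> virtual_joins (band_crossing \<gamma> E n y \<sigma> \<tau>)" for p q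
        proof -
          from that obtain c \<rho> where "{p, q} \<subseteq> {strand_in \<gamma> E n y c \<rho>, mid y c \<rho>, strand_out \<gamma> E n y c \<rho>}"
            by (rule virtual_joins_sides)
          then show ?thesis using yx(1) by (auto simp: smid_def strand_in_def strand_out_def)
        qed
        ultimately show ?thesis by blast
      qed
      note * = this
      show "Vj (passed e) \<subseteq> (L - ?K - range smid) \<times> (L - ?K - range smid) \<union> ?K \<times> ?K"
        "Vj (passed e) \<inter> (range (mid x b) \<times> UNIV \<union> UNIV \<times> range (mid x b)) = {}"
        unfolding band_crossings_def using * by blast+
    qed
    have J0': "J0 \<subseteq> (L - ?K - range smid) \<times> (L - ?K - range smid) \<union> ?K \<times> ?K"
      "J0 \<inter> (range (mid x b) \<times> UNIV \<union> UNIV \<times> range (mid x b)) = {}"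
      using J0_capped[OF e] J0_Rung unfolding smid_def by blast+
    have Jmid: "?J \<subseteq> (L - ?K - range smid - range (mid x b)) \<times> (L - ?K - range smid - range (mid x b)) \<union> ?K \<times> ?K"
      using J0' VJ Vmid mid by blast
    have cK: "(near x b s1, p) \<in> conn ?J" if "p \<in> ?K" for p
      using conn_capped[OF less_imp_le[OF e]] near that conn_sym conn_trans by meson
    have c4: "c \<sigma> t2 \<in> over A" if "mid x b \<sigma> \<in> A" "far x b \<sigma> \<in> A" "sin t2 \<in> A" "smid t2 \<in> A" "sout t2 \<in> A" for \<sigma> A
      unfolding shape_labels[OF sh(2)] using that by (auto simp: O0_def O1_def)
    have "stage e = br L (insert (c s1 t1) (insert (c s2 t1) (insert (c s1 t2) (insert (c s2 t2) R)))) ?J"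
      unfolding stage_def X0 ..
    also have "\<dots> = br L (insert (c s1 t2) (insert (c s2 t2) R)) (?J \<union> virtual_joins (c s1 t1) \<union> virtual_joins (c s2 t1))"
    proof (rule br_reidemeister2[OF _ finL, where K = ?K and ?P0.0 = "L - insert (smid t1) ?K", OF _ _ _ _ _ _ _ refl _ _ cK _ _ _ _ _ _ sh1(1,2)])
      show "c s1 t1 \<noteq> c s2 t1" "c s1 t1 \<notin> insert (c s1 t2) (insert (c s2 t2) R)" "c s2 t1 \<notin> insert (c s1 t2) (insert (c s2 t2) R)"
        using cR s12(1,2)[symmetric] by (simp_all add: cinj)
      show "insert (c s1 t2) (insert (c s2 t2) R) \<subseteq> over (L - insert (smid t1) ?K)"
      proof (intro insert_subsetI)
        show "c s1 t2 \<in> over (L - insert (smid t1) ?K)"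
          "c s2 t2 \<in> over (L - insert (smid t1) ?K)"
          by (rule c4; use mid far arcs neq smid_inj s12(2) in auto)+
        show "R \<subseteq> over (L - insert (smid t1) ?K)"
          by (rule subset_trans[OF Rmid]) (intro Sigma_mono; blast)
      qed
      show "?J \<subseteq> (L - insert (smid t1) ?K) \<times> (L - insert (smid t1) ?K) \<union> ?K \<times> ?K"
        by (rule subset_trans[OF Jmid]) blast
    qed (use finR capped_labels[OF less_imp_le[OF e]] arcs near mid neq in auto)
    also have "\<dots> = br L R (?J \<union> virtual_joins (c s1 t1) \<union> virtual_joins (c s2 t1) \<union> virtual_joins (c s1 t2) \<union> virtual_joins (c s2 t2))"
    proof -
      let ?K2 = "?K \<union> range (mid x b)" and ?J2 = "?J \<union> virtual_joins (c s1 t1) \<union> virtual_joins (c s2 t1)"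
      let ?P = "L - insert (smid t2) ?K2"
      note v1 = shape_virtual[OF sh1(1)] and v2 = shape_virtual[OF sh1(2)]
      \<comment> \<open>The virtual joins left by the first move tie the mid arcs to the
        tip.\<close>
      have base: "(near x b \<sigma>, mid x b \<sigma>) \<in> conn ?J2" for \<sigma>
      proof -
        have "(near x b s1, mid x b s1) \<in> virtual_joins (c s1 t1) \<union> (virtual_joins (c s1 t1))\<inverse>" unfolding v1 by blast
        moreover have "(near x b s2, mid x b s2) \<in> virtual_joins (c s2 t1) \<union> (virtual_joins (c s2 t1))\<inverse>" unfolding v2 by blast
        ultimately show ?thesis using s12(3)[of \<sigma>] by (intro conn_base) auto
      qed
      have cK1: "(near x b s1, p) \<in> conn ?J2" if "p \<in> ?K" for p
        by (rule conn_mono[OF cK[OF that]]) blast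
      have cK2: "(mid x b s1, p) \<in> conn ?J2" if "p \<in> ?K2" for p
      proof -
        have "(near x b s1, p) \<in> conn ?J2" using that
        proof
          assume "p \<in> range (mid x b)"
          then obtain \<sigma> where "p = mid x b \<sigma>" by blast
          then show ?thesis using conn_trans[OF cK1[OF near] base] by simp
        qed (rule cK1)
        then show ?thesis by (rule conn_trans[OF conn_sym[OF base]])
      qed
      have J2: "?J2 \<subseteq> ?P \<times> ?P \<union> ?K2 \<times> ?K2"
      proof -
        have "smid t1 \<in> ?P" "sin t1 \<in> ?P" "sout t1 \<in> ?P" using arcs neq s12(2) smid_inj by auto
        then have "{(near x b s1, mid x b s1), (sin t1, smid t1)} \<union> {(near x b s1, mid x b s1), (sin t1, smid t1)}\<inverse> \<subseteq> ?P \<times> ?P \<union> ?K2 \<times> ?K2"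
          "{(near x b s2, mid x b s2), (smid t1, sout t1)} \<union> {(near x b s2, mid x b s2), (smid t1, sout t1)}\<inverse> \<subseteq> ?P \<times> ?P \<union> ?K2 \<times> ?K2"
          using near by auto
        then have "virtual_joins (c s1 t1) \<subseteq> ?P \<times> ?P \<union> ?K2 \<times> ?K2" "virtual_joins (c s2 t1) \<subseteq> ?P \<times> ?P \<union> ?K2 \<times> ?K2"
          using v1 v2 by blast+
        moreover have "?J \<subseteq> ?P \<times> ?P \<union> ?K2 \<times> ?K2"
          by (rule subset_trans[OF Jmid]) blast
        ultimately show ?thesis by (intro Un_subset_iff[THEN iffD2] conjI) (simp_all only: Un_subset_iff)
      qed
      show ?thesis
      proof (rule br_reidemeister2[OF finR finL, where K = ?K2 and ?P0.0 = ?P, OF _ _ _ _ _ _ refl _ J2 cK2 _ _ _ _ _ _ sh1(3,4)])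
        show "c s1 t2 \<noteq> c s2 t2" "c s1 t2 \<notin> R" "c s2 t2 \<notin> R" using cR s12(1) by (auto simp: cinj)
        show "R \<subseteq> over ?P" by (rule subset_trans[OF Rmid]) (intro Sigma_mono; blast)
      qed (use capped_labels[OF less_imp_le[OF e]] arcs near mid far neq in auto)
    qed
    also have "\<dots> = stage (Suc e)" unfolding stage_def Vs R_def by (simp add: Un_assoc)
    finally show ?thesis .
  qed
qed

lemma stage_len: "band_bracket \<gamma> E n (detached \<gamma> E i v) = stage len"
proof -
  have "e \<le> len \<Longrightarrow> stage 0 = stage e" for e
    by (induction e) (auto simp: stage_Suc)
  moreover have "stage 0 = band_bracket \<gamma> E n (detached \<gamma> E i v)"
  proof -
    have "passed 0 = {}" by (auto simp: passed_def)
    moreover have "band_crossings \<gamma> E n {} = {}" by (simp add: band_crossings_def)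
    ultimately show ?thesis by (simp add: stage_def band_bracket_def)
  qed
  ultimately show ?thesis by simp
qed


section \<open>Deleting the retracted band\<close>

abbreviation "E' \<equiv> E - {i}"
abbreviation "S' \<equiv> sub_crossings \<gamma> E'"
text \<open>\<open>Q\<close> consists of all labels of the retracted band and \<open>Lr\<close> of
  those of the other bands, which still carry virtual joins where the retracted band used to cross
  them.\<close>

abbreviation "Q \<equiv> capped len"
abbreviation "Lr \<equiv> L - capped len"
abbreviation "Xr \<equiv> twists E n \<union> band_crossings \<gamma> E n S'"
abbreviation "Jr \<equiv> vertex_joins \<gamma> E n (next_edge \<gamma> E') \<union> Vj (S - S') \<inter> Lr \<times> Lr"

lemma S'_iff: "x \<in> S' \<longleftrightarrow> x \<in> S \<and> (\<forall>b. fst (crossing_point x b) \<noteq> i)"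
  by (auto simp: sub_crossings_iff)

lemma passed_len: "passed len = S - S'"
proof (rule set_eqI)
  fix x
  have "x \<in> passed len \<longleftrightarrow> x \<in> S \<and> (\<exists>b. on x b)"
    unfolding passed_def mem_Collect_eq using depth_less[of x] by blast
  also have "\<dots> \<longleftrightarrow> x \<in> S - S'" unfolding on_def S'_iff Diff_iff by blast
  finally show "x \<in> passed len \<longleftrightarrow> x \<in> S - S'" .
qed

lemma stage_len_eq: "stage len = br L Xr (J0 \<union> Vj (S - S'))"
proof -
  have "S - (S - S') = S'" using S'_iff by blast
  then show ?thesis by (simp only: stage_def passed_len)
qed

lemma Rung_Q: "m \<le> len \<Longrightarrow> Rung i m \<sigma> \<in> Q"
  using Rung_rg[of m] by (auto simp: capped_def)

lemma Lr_Rung [simp]: "Rung j m \<sigma> \<in> Lr \<longleftrightarrow> j \<in> E' \<and> m \<le> last_rung \<gamma> E n j"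
proof (cases "j = i")
  case True
  then show ?thesis using Rung_Q[of m \<sigma>] by auto
next
  case False
  then have "Rung j m \<sigma> \<notin> Q" by (auto simp: capped_def rg_def)
  then show ?thesis using False by auto
qed

lemma Lr_mid [simp]: "mid x b \<sigma> \<in> Lr \<longleftrightarrow> x \<in> S \<and> fst (crossing_point x b) \<noteq> i"
  using depth_less[of x b] by (auto simp: capped_def on_def)

lemma Vj_parts: "Vj (S - S') \<subseteq> Lr \<times> Lr \<union> Q \<times> Q"
proof -
  have "virtual_joins (band_crossing \<gamma> E n y \<sigma> \<tau>) \<subseteq> Lr \<times> Lr \<union> Q \<times> Q" if "y \<in> S - S'" for y \<sigma> \<tau>
  proof (rule virtual_capped[OF order_refl])
    show "on y c \<Longrightarrow> depth y c \<noteq> len" for c using depth_less[of y c] by simp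
  qed (use that in blast)
  then show ?thesis unfolding band_crossings_def by blast
qed

lemma Xr_labels: "Xr \<subseteq> over Lr"
proof -
  have "band_crossings \<gamma> E n S' \<subseteq> over Lr"
  proof (rule band_crossings_uncapped[OF order_refl])
    show "S' \<subseteq> S" using S'_iff by blast
    show "\<And>y c. y \<in> S' \<Longrightarrow> on y c \<Longrightarrow> len < depth y c" by (simp add: S'_iff on_def)
  qed simp
  moreover have "twists E n \<subseteq> over Lr"
    by (rule twists_off, rule Lr_Rung[THEN iffD2]) (simp add: last_rung_def)
  ultimately show ?thesis by (rule Un_least[rotated])
qed

lemma incident_E': "a \<in> incident E' u \<longleftrightarrow> a \<in> incident E u \<and> a \<noteq> i"
  by (auto simp: incident_Diff)

lemma ends_Lr: "a \<in> incident E' u \<Longrightarrow> left_end \<gamma> E n u a \<in> Lr" "a \<in> incident E' u \<Longrightarrow> right_end \<gamma> E n u a \<in> Lr"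
  by (simp_all add: left_end_def right_end_def incident_def del: Diff_iff)

lemma ends_Q: "u = v \<or> u = w \<Longrightarrow> left_end \<gamma> E n u i \<in> Q" "u = v \<or> u = w \<Longrightarrow> right_end \<gamma> E n u i \<in> Q"
  by (auto simp: left_end_def right_end_def intro!: Rung_Q)

lemma conn_Q:
  assumes "p \<in> Q" "q \<in> Q"
  shows "(p, q) \<in> conn (J0 \<union> Vj (S - S'))"
proof -
  have "(rg 0 LeftSide, r) \<in> conn (J0 \<union> Vj (S - S'))" if "r \<in> Q" for r
    using conn_capped[OF order_refl that] by (simp only: passed_len)
  from this[OF assms(1)] this[OF assms(2)] show ?thesis by (meson conn_sym conn_trans)
qed

lemma Jr_labels: "Jr \<subseteq> Lr \<times> Lr"
proof -
  have "(left_end \<gamma> E n u a, right_end \<gamma> E n u b) \<in> Lr \<times> Lr" if "next_edge \<gamma> E' u a b" for u a b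
    using next_edge_incident[OF that] ends_Lr by blast
  then show ?thesis unfolding vertex_joins_def by blast
qed

lemma vertex_joinsI: "u \<in> {0..3} \<Longrightarrow> W u a b \<Longrightarrow> (left_end \<gamma> E n u a, right_end \<gamma> E n u b) \<in> vertex_joins \<gamma> E n W"
  unfolding vertex_joins_def by blast

lemma Q_disjoint: "Lr \<inter> Q = {}" by blast

text \<open>Nothing else is attached at \<open>w\<close>, so the band, its cap and the disk at
  \<open>w\<close> make up one split circle.\<close>

lemma remove_band_isolated:
  assumes iso: "incident E' w = {}"
  shows "stage len = \<delta> * br Lr Xr Jr"
proof -
  have w: "incident E w = {i}" using iso vw(5) by (auto simp: incident_Diff)
  let ?Z = "(J0 \<union> Vj (S - S')) \<inter> Q \<times> Q"
  have J0_sub: "J0 \<subseteq> Jr \<union> ?Z"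
  proof (rule subrelI)
    fix p q assume J: "(p, q) \<in> J0"
    show "(p, q) \<in> Jr \<union> ?Z"
    proof (cases "p \<in> Q \<and> q \<in> Q")
      case True
      then show ?thesis using J by blast
    next
      case False
      from J show ?thesis
      proof (cases rule: J0_cases)
        case 1
        then show ?thesis using False by (auto simp: capped_def)
      next
        case (2 u a b)
        have "next_edge \<gamma> E' u a b"
        proof (cases "u = v")
          case False
          have "a \<noteq> i \<and> b \<noteq> i"
          proof (rule ccontr)
            assume "\<not> (a \<noteq> i \<and> b \<noteq> i)"
            then have "i \<in> incident E u" using 2 by auto
            then have "u = w" using vw(6) False by blast
            then have "a = i" "b = i" using 2 w by auto
            then show False using \<open>\<not> (p \<in> Q \<and> q \<in> Q)\<close> 2 \<open>u = w\<close> ends_Q by blast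
          qed
          then show ?thesis using 2 False next_edge_remove[OF reg 2(1) EE] by auto
        qed (use 2 in simp)
        from vertex_joinsI[OF 2(1), of "next_edge \<gamma> E'", OF this] show ?thesis using 2 by simp
      qed
    qed
  qed
  have Jr_sub: "Jr \<subseteq> J0 \<union> Vj (S - S')"
  proof (rule subrelI)
    fix p q assume "(p, q) \<in> Jr"
    then show "(p, q) \<in> J0 \<union> Vj (S - S')"
    proof
      assume "(p, q) \<in> vertex_joins \<gamma> E n (next_edge \<gamma> E')"
      then obtain u a b where *: "p = left_end \<gamma> E n u a" "q = right_end \<gamma> E n u b" "u \<in> {0..3}" "next_edge \<gamma> E' u a b"
        unfolding vertex_joins_def by blast
      have "detached \<gamma> E i v u a b"
      proof (cases "u = v")
        case False
        have "\<not> next_edge \<gamma> E u i b"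
        proof
          assume "next_edge \<gamma> E u i b"
          then have "i \<in> incident E u" using next_edge_incident by blast
          then have "u = w" using vw(6) False by blast
          then show False using next_edge_incident[OF *(4)] iso by simp
        qed
        then show ?thesis using *(4) False next_edge_remove[OF reg *(3) EE] by (simp add: detached_def)
      qed (use * in \<open>simp add: detached_def\<close>)
      from vertex_joinsI[OF *(3), of "detached \<gamma> E i v", OF this] show ?thesis using * by simp
    qed blast
  qed
  have "J0 \<union> Vj (S - S') = Jr \<union> ?Z" using J0_sub Jr_sub Vj_parts by blast
  moreover have "L = Lr \<union> Q" using capped_labels[of len] by blast
  ultimately have "stage len = br (Lr \<union> Q) Xr (Jr \<union> ?Z)" using stage_len_eq by simp
  also have "\<dots> = \<delta> * br Lr Xr Jr"
  proof (rule br_circle[where c = "rg 0 LeftSide", OF _ Jr_labels Xr_labels Q_disjoint])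
    show "finite Lr" using finite_band_labels[OF reg finite_E] by simp
    show c: "rg 0 LeftSide \<in> Q" by (auto simp: capped_def)
    have "J0 \<union> Vj (S - S') \<subseteq> Lr \<times> Lr \<union> Q \<times> Q"
      using J0_sub Jr_labels Vj_parts by blast
    then show "(rg 0 LeftSide, q) \<in> conn ?Z" if "q \<in> Q" for q
      by (rule conn_component[OF conn_Q[OF c that] c _ Q_disjoint])
  qed blast
  finally show ?thesis .
qed

text \<open>As with the stub in \<open>br_Cut_next\<close>, but at the other end: all of
  \<open>Q\<close> is slid to the right end of the successor \<open>z\<close> of \<open>i\<close> at
  \<open>w\<close>, and the predecessor of \<open>i\<close> runs on to \<open>z\<close>.\<close>

lemma remove_band_attached:
  assumes att: "incident E' w \<noteq> {}"
  shows "stage len = br Lr Xr Jr"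
proof -
  obtain z where z: "next_edge \<gamma> E w i z" and zu: "\<And>b. next_edge \<gamma> E w i b \<Longrightarrow> b = z"
    using next_edge_total[OF reg vw(2) EE vw(5)] by blast
  have zi: "z \<noteq> i" using next_edge_self[OF reg vw(2) EE] z att by (auto simp: incident_Diff)
  then have zin: "z \<in> incident E' w" using next_edge_incident[OF z] by (simp add: incident_E')
  define anc where "anc = right_end \<gamma> E n w z"
  define f where "f p = (if p \<in> Q then anc else p)" for p
  let ?J = "J0 \<union> Vj (S - S')"
  have anc: "anc \<in> Lr" unfolding anc_def by (rule ends_Lr(2)[OF zin])
  have f: "p \<in> Q \<Longrightarrow> f p = anc" "p \<in> Lr \<Longrightarrow> f p = p" for p by (auto simp: f_def)
  have JrI: "(left_end \<gamma> E n u a, right_end \<gamma> E n u b) \<in> conn Jr" if "u \<in> {0..3}" "next_edge \<gamma> E' u a b" for u a b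
    using vertex_joinsI[OF that(1), of "next_edge \<gamma> E'" a b] that(2) by (intro conn_base) blast
  have J0I: "(left_end \<gamma> E n u a, right_end \<gamma> E n u b) \<in> conn ?J" if "u \<in> {0..3}" "detached \<gamma> E i v u a b" for u a b
    using vertex_joinsI[OF that(1), of "detached \<gamma> E i v" a b] that(2) by (intro conn_base) blast
  have "br L Xr ?J = br Lr Xr Jr"
  proof (rule br_contract[where f = f, OF _ _ f(2) Xr_labels])
    show "f ` L \<subseteq> Lr" using anc by (auto simp: f_def)
    show "(f p, f q) \<in> conn Jr" if pq: "(p, q) \<in> ?J" for p q
      using pq
    proof
      assume "(p, q) \<in> Vj (S - S')"
      then consider "p \<in> Lr" "q \<in> Lr" "(p, q) \<in> Jr" | "p \<in> Q" "q \<in> Q" using Vj_parts by blast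
      then show ?thesis by cases (simp_all only: f conn_refl conn_base simp_thms)
    next
      assume "(p, q) \<in> J0"
      then show ?thesis
      proof (cases rule: J0_cases)
        case 1
        then have "p \<in> Q" "q \<in> Q" by (auto simp: capped_def)
        then show ?thesis by (simp add: f)
      next
        case (2 u a b)
        have fl: "f p = left_end \<gamma> E n u a" if "a \<noteq> i" using 2 that ends_Lr(1)[of a u] by (simp only: f incident_E' simp_thms)
        have fr: "f q = right_end \<gamma> E n u b" if "b \<noteq> i" using 2 that ends_Lr(2)[of b u] by (simp only: f incident_E' simp_thms)
        have uw: "u = w" "u \<noteq> v" if "a = i \<or> b = i" using that 2 vw(6) by blast+
        consider "a \<noteq> i" "b \<noteq> i" | "a = i" | "a \<noteq> i" "b = i" by blast
        then show ?thesis
        proof cases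
          case 1
          then have "next_edge \<gamma> E' u a b" using 2 next_edge_remove[OF reg 2(1) EE] by (auto split: if_splits)
          then show ?thesis using JrI[OF 2(1)] fl fr 1 by simp
        next
          case a: 2
          then have "b = z" using zu 2 uw by simp
          moreover have "f p = anc" using f(1) ends_Q(1) 2 uw a by simp
          ultimately show ?thesis using fr zi uw a by (simp add: anc_def)
        next
          case b: 3
          then have "next_edge \<gamma> E w a i" using 2 uw by simp
          then have "next_edge \<gamma> E' w a z" unfolding next_edge_remove[OF reg vw(2) EE] using z zi b by blast
          then have "(left_end \<gamma> E n w a, anc) \<in> conn Jr" unfolding anc_def by (rule JrI[OF vw(2)])
          moreover have "f q = anc" using f(1) ends_Q(2) 2 uw b by simp
          ultimately show ?thesis using fl b uw by simp
        qed
      qed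
    qed
    show "(p, q) \<in> conn ?J" if pq: "(p, q) \<in> Jr" for p q
      using pq
    proof
      assume "(p, q) \<in> vertex_joins \<gamma> E n (next_edge \<gamma> E')"
      then obtain u a b where *: "p = left_end \<gamma> E n u a" "q = right_end \<gamma> E n u b" "u \<in> {0..3}" "next_edge \<gamma> E' u a b"
        unfolding vertex_joins_def by blast
      show ?thesis
      proof (cases "u = v \<or> next_edge \<gamma> E u a b")
        case True
        then have "detached \<gamma> E i v u a b" using *(4) next_edge_remove[OF reg *(3) EE] by (auto simp: detached_def)
        then show ?thesis using J0I[OF *(3)] * by simp
      next
        \<comment> \<open>The pair arises at \<open>w\<close> by skipping \<open>i\<close>; the
          detour through \<open>i\<close> runs inside the connected set \<open>Q\<close>.\<close>
        case False
        then have n: "next_edge \<gamma> E u a i" "next_edge \<gamma> E u i b" using *(4) next_edge_remove[OF reg *(3) EE] by auto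
        then have uw: "u = w" using next_edge_incident[OF n(1)] vw(6) False by blast
        have d: "detached \<gamma> E i v u a i" "detached \<gamma> E i v u i b" using n False by (simp_all add: detached_def)
        show ?thesis unfolding *(1,2)
          by (rule conn_trans[OF J0I[OF *(3) d(1)] conn_trans[OF conn_Q J0I[OF *(3) d(2)]]]) (use ends_Q uw in auto)
      qed
    qed (auto intro: conn_base)
    show "(f p, p) \<in> conn ?J" if "p \<in> L" for p
    proof (cases "p \<in> Q")
      case True
      have "detached \<gamma> E i v w i z" using z vw(3) by (simp add: detached_def)
      then have "(left_end \<gamma> E n w i, anc) \<in> conn ?J" unfolding anc_def by (rule J0I[OF vw(2)])
      moreover have "(p, left_end \<gamma> E n w i) \<in> conn ?J" by (rule conn_Q[OF True]) (use ends_Q in auto)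
      ultimately show ?thesis using True by (simp add: f) (meson conn_sym conn_trans)
    qed (simp add: f_def)
  qed blast
  then show ?thesis by (simp only: stage_len_eq)
qed

section \<open>Renumbering the remaining bands\<close>

text \<open>The new index of the rung \<open>m\<close> of the band of \<open>j\<close>.\<close>

definition red :: "nat \<Rightarrow> nat \<Rightarrow> nat" where
  "red j m = min m (nat \<bar>n j\<bar>) + card {t\<in>crossing_times \<gamma> E' j. position \<gamma> E n (j, t) < m}"

abbreviation "T j \<equiv> crossing_times \<gamma> E j"
abbreviation "T' j \<equiv> crossing_times \<gamma> E' j"

lemma T'_T: "T' j \<subseteq> T j"
proof -
  have "S' \<subseteq> S" using S'_iff by blast
  then show ?thesis unfolding crossing_times_def by blast
qed

lemma finite_T': "finite (T' j)" by (rule finite_crossing_times_sub[OF reg])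

lemma position_T: "t \<in> T j \<Longrightarrow> nat \<bar>n j\<bar> \<le> position \<gamma> E n (j, t) \<and> position \<gamma> E n (j, t) < last_rung \<gamma> E n j"
proof -
  assume "t \<in> T j"
  then obtain x b where "x \<in> S" "crossing_point x b = (j, t)" unfolding crossing_times_point by force
  then show ?thesis using position_bounds[OF reg, of x E b j n] by simp
qed

lemma red_small: "m \<le> nat \<bar>n j\<bar> \<Longrightarrow> red j m = m"
proof -
  assume "m \<le> nat \<bar>n j\<bar>"
  then have "{t\<in>T' j. position \<gamma> E n (j, t) < m} = {}" using position_T T'_T by fastforce
  then have "card {t\<in>T' j. position \<gamma> E n (j, t) < m} = 0" by (simp only: card.empty)
  then show ?thesis using \<open>m \<le> nat \<bar>n j\<bar>\<close> by (simp add: red_def)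
qed

lemma red_last: "red j (last_rung \<gamma> E n j) = last_rung \<gamma> E' n j"
proof -
  have "{t\<in>T' j. position \<gamma> E n (j, t) < last_rung \<gamma> E n j} = T' j" using position_T T'_T by blast
  then show ?thesis by (simp add: red_def last_rung_def)
qed

lemma red_position:
  assumes "t \<in> T' j"
  shows "red j (position \<gamma> E n (j, t)) = position \<gamma> E' n (j, t)"
    "red j (Suc (position \<gamma> E n (j, t))) = Suc (position \<gamma> E' n (j, t))"
proof -
  have tT: "t \<in> T j" using assms T'_T by blast
  have less: "position \<gamma> E n (j, s) < position \<gamma> E n (j, t) \<longleftrightarrow> s < t"
    and le: "position \<gamma> E n (j, s) < Suc (position \<gamma> E n (j, t)) \<longleftrightarrow> s \<le> t" if "s \<in> T' j" for s
    using position_inject[OF reg _ tT, of s n] position_inject[OF reg tT, of s n] that T'_T[of j] by auto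
  have "{s\<in>T' j. position \<gamma> E n (j, s) < position \<gamma> E n (j, t)} = {s\<in>T' j. s < t}" using less by blast
  then show "red j (position \<gamma> E n (j, t)) = position \<gamma> E' n (j, t)"
    using position_T[OF tT] by (simp add: red_def position_def[of \<gamma> E'])
  have "{s\<in>T' j. position \<gamma> E n (j, s) < Suc (position \<gamma> E n (j, t))} = insert t {s\<in>T' j. s < t}"
    using le assms by auto
  then have "card {s\<in>T' j. position \<gamma> E n (j, s) < Suc (position \<gamma> E n (j, t))} = Suc (card {s\<in>T' j. s < t})"
    using finite_T'[of j] by simp
  then show "red j (Suc (position \<gamma> E n (j, t))) = Suc (position \<gamma> E' n (j, t))"
    using position_T[OF tT] by (simp add: red_def position_def[of \<gamma> E'])
qed

text \<open>A half twist or a surviving crossing raises the new index by one; a crossing with the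
  retracted band leaves it as it is.\<close>

lemma red_Suc_cases:
  assumes "m < last_rung \<gamma> E n j"
  obtains "red j (Suc m) = Suc (red j m)"
  | x b where "x \<in> S - S'" "fst (crossing_point x b) = j" "position \<gamma> E n (crossing_point x b) = m" "red j (Suc m) = red j m"
proof (cases "m < nat \<bar>n j\<bar>")
  case True
  then show ?thesis using that(1) by (simp add: red_small)
next
  case False
  then obtain x b where x: "x \<in> S" "fst (crossing_point x b) = j" "position \<gamma> E n (crossing_point x b) = m"
    using position_sub_ex1[OF reg, of n j m E] assms by (metis not_less)
  obtain t where t: "crossing_point x b = (j, t)" using x(2) by (metis prod.collapse)
  have m: "m = position \<gamma> E n (j, t)" using x(3) t by simp
  have tT: "t \<in> T j" using crossing_timesI[OF x(1) t] .
  show ?thesis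
  proof (cases "t \<in> T' j")
    case True
    then show ?thesis using that(1) red_position m by simp
  next
    case no: False
    then have "x \<in> S - S'" using crossing_timesI[of x \<gamma> E' b j t] t x(1) by blast
    moreover have "red j (Suc m) = red j m"
    proof -
      have "position \<gamma> E n (j, s) < Suc m \<longleftrightarrow> position \<gamma> E n (j, s) < m" if "s \<in> T' j" for s
      proof -
        have "s \<noteq> t" "s \<in> T j" using that no T'_T by auto
        then have "position \<gamma> E n (j, s) \<noteq> m"
          unfolding m using position_inject[OF reg _ tT, of s n] position_inject[OF reg tT, of s n] by auto
        then show ?thesis by auto
      qed
      then have "{s\<in>T' j. position \<gamma> E n (j, s) < Suc m} = {s\<in>T' j. position \<gamma> E n (j, s) < m}" by blast
      then show ?thesis using \<open>\<not> m < nat \<bar>n j\<bar>\<close> by (simp add: red_def)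
    qed
    ultimately show ?thesis using that(2) x by blast
  qed
qed

lemma red_mono: "m \<le> m' \<Longrightarrow> red j m \<le> red j m'"
proof -
  assume "m \<le> m'"
  then have "{t\<in>T' j. position \<gamma> E n (j, t) < m} \<subseteq> {t\<in>T' j. position \<gamma> E n (j, t) < m'}" by auto
  then have "card {t\<in>T' j. position \<gamma> E n (j, t) < m} \<le> card {t\<in>T' j. position \<gamma> E n (j, t) < m'}"
    using finite_T'[of j] by (intro card_mono) auto
  then show ?thesis using \<open>m \<le> m'\<close> by (simp add: red_def)
qed

text \<open>A discrete intermediate value argument: \<open>red j\<close> starts at 0 and grows by at
  most one per step.\<close>

lemma red_surj: "m' \<le> red j m \<Longrightarrow> m \<le> last_rung \<gamma> E n j \<Longrightarrow> \<exists>k\<le>m. red j k = m'"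
proof (induction m)
  case 0
  then show ?case using red_small[of 0 j] by auto
next
  case (Suc m)
  show ?case
  proof (cases "m' \<le> red j m")
    case True
    then show ?thesis using Suc by (metis le_Suc_eq Suc_leD)
  next
    case False
    have "m < last_rung \<gamma> E n j" using Suc.prems by simp
    then have "red j (Suc m) \<le> Suc (red j m)" by (rule red_Suc_cases) auto
    then have "red j (Suc m) = m'" using False Suc.prems by simp
    then show ?thesis by blast
  qed
qed

text \<open>The mid arcs of a vanished crossing are merged with the rung before it. The new index
  does not change across such a crossing, so the rung behind it gets the same image.\<close>

fun collapse :: "band_arc \<Rightarrow> band_arc" where
  "collapse (Rung j m \<sigma>) = Rung j (red j m) \<sigma>"
| "collapse (OverMid x \<sigma>) = (if x \<in> S' then OverMid x \<sigma> else Rung (fst (fst x)) (red (fst (fst x)) (position \<gamma> E n (fst x))) \<sigma>)"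
| "collapse (UnderMid x \<sigma>) = (if x \<in> S' then UnderMid x \<sigma> else Rung (fst (snd x)) (red (fst (snd x)) (position \<gamma> E n (snd x))) \<sigma>)"

lemma collapse_mid:
  "collapse (mid x b \<sigma>) = (if x \<in> S' then mid x b \<sigma> else
     Rung (fst (crossing_point x b)) (red (fst (crossing_point x b)) (position \<gamma> E n (crossing_point x b))) \<sigma>)"
  by (simp add: mid.simps crossing_point.simps)

lemma collapse_strand:
  assumes "x \<in> S - S'"
  shows "collapse (mid x b \<sigma>) = collapse (strand_in \<gamma> E n x b \<sigma>)" "collapse (strand_out \<gamma> E n x b \<sigma>) = collapse (strand_in \<gamma> E n x b \<sigma>)"
proof -
  let ?p = "crossing_point x b"
  show "collapse (mid x b \<sigma>) = collapse (strand_in \<gamma> E n x b \<sigma>)"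
    using assms by (simp add: collapse_mid strand_in_def)
  have "position \<gamma> E n ?p < last_rung \<gamma> E n (fst ?p)" using position_bounds[OF reg, of x E b "fst ?p" n] assms by simp
  then have "red (fst ?p) (Suc (position \<gamma> E n ?p)) = red (fst ?p) (position \<gamma> E n ?p)"
  proof (cases rule: red_Suc_cases)
    \<comment> \<open>\<open>x\<close> is the only crossing at this position and does not survive,
      so the index stays put after all.\<close>
    case 1
    have "fst ?p = fst (crossing_point x b)" ..
    obtain j t where t: "?p = (j, t)" by fastforce
    have "t \<notin> T' j"
    proof
      assume "t \<in> T' j"
      then obtain y c where y: "y \<in> S'" "crossing_point y c = ?p" unfolding crossing_times_point t by force
      have "x \<in> S" using assms by blast
      from crossing_point_inj[OF reg sub_crossings_sub[OF this] sub_crossings_sub[OF y(1)] y(2)[symmetric]]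
      have "x = y" by blast
      then show False using y assms by blast
    qed
    then have no: "position \<gamma> E n (j, s) \<noteq> position \<gamma> E n (j, t)" if "s \<in> T' j" for s
      using that T'_T[of j] position_inject[OF reg, of s E j t n] position_inject[OF reg, of t E j s n]
        crossing_timesI[of x \<gamma> E b j t] t assms by (metis DiffD1 linorder_neqE_linordered_idom nat_neq_iff subsetD)
    have "{s\<in>T' j. position \<gamma> E n (j, s) < Suc (position \<gamma> E n (j, t))} = {s\<in>T' j. position \<gamma> E n (j, s) < position \<gamma> E n (j, t)}"
      using no by (auto simp: less_Suc_eq)
    moreover have "nat \<bar>n j\<bar> \<le> position \<gamma> E n (j, t)" using position_T[of t j] crossing_timesI[of x \<gamma> E b j t] t assms by blast
    ultimately show ?thesis using t by (simp add: red_def)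
  qed simp
  then show "collapse (strand_out \<gamma> E n x b \<sigma>) = collapse (strand_in \<gamma> E n x b \<sigma>)"
    by (simp add: strand_in_def strand_out_def)
qed

lemma collapse_kept:
  assumes "x \<in> S'" "crossing_point x b = p"
  shows "collapse (Rung (fst p) (position \<gamma> E n p) \<sigma>) = Rung (fst p) (position \<gamma> E' n p) \<sigma>"
    "collapse (Rung (fst p) (Suc (position \<gamma> E n p)) \<sigma>) = Rung (fst p) (Suc (position \<gamma> E' n p)) \<sigma>"
proof -
  obtain j t where p: "p = (j, t)" by fastforce
  have "t \<in> T' j" using crossing_timesI[OF assms(1)] assms(2) p by blast
  then show "collapse (Rung (fst p) (position \<gamma> E n p) \<sigma>) = Rung (fst p) (position \<gamma> E' n p) \<sigma>"
    "collapse (Rung (fst p) (Suc (position \<gamma> E n p)) \<sigma>) = Rung (fst p) (Suc (position \<gamma> E' n p)) \<sigma>"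
    unfolding p by (simp_all add: red_position)
qed

lemma collapse_band:
  assumes "x \<in> S'"
  shows "map_crossing collapse (band_crossing \<gamma> E n x \<sigma> \<tau>) = band_crossing \<gamma> E' n x \<sigma> \<tau>"
proof -
  have k: "crossing_point x True = fst x" "crossing_point x False = snd x" by (simp_all add: crossing_point.simps)
  show ?thesis
    using assms by (simp add: band_crossing_def Let_def collapse_kept[OF assms k(1)] collapse_kept[OF assms k(2)] del: collapse.simps(1))
qed

lemma collapse_twist:
  assumes "c \<in> twists E n"
  shows "map_crossing collapse c = c"
proof -
  obtain j k where "c = twist_crossing n j k" "k < nat \<bar>n j\<bar>" using assms unfolding twists_def by blast
  then show ?thesis by (simp add: twist_crossing_def Let_def red_small)
qed

lemma collapse_end:
  "collapse (left_end \<gamma> E n u a) = left_end \<gamma> E' n u a" "collapse (right_end \<gamma> E n u a) = right_end \<gamma> E' n u a"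
  by (simp_all add: left_end_def right_end_def red_last red_small)

lemma conn_Vj_Lr:
  assumes "x \<in> S - S'" "fst (crossing_point x b) \<noteq> i"
  shows "(strand_in \<gamma> E n x b \<sigma>, mid x b \<sigma>) \<in> conn Jr" "(strand_in \<gamma> E n x b \<sigma>, strand_out \<gamma> E n x b \<sigma>) \<in> conn Jr"
proof -
  note vs = virtual_joins_strand[OF assms(1) refl, where \<gamma> = \<gamma> and E = E and n = n and b = b and \<sigma> = \<sigma>]
  have "fst (crossing_point x b) \<in> E" "position \<gamma> E n (crossing_point x b) < last_rung \<gamma> E n (fst (crossing_point x b))"
    using assms(1) position_bounds[OF reg _ refl, of x E n b] by (auto simp: sub_crossings_iff)
  then have L: "strand_in \<gamma> E n x b \<sigma> \<in> Lr"
    using assms(2) by (simp add: strand_in_def del: Diff_iff) simp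
  have V: "Vj (S - S') \<subseteq> Q \<times> Q \<union> Lr \<times> Lr" using Vj_parts by blast
  have "Q \<inter> Lr = {}" by blast
  note cc = conn_component[OF _ L V this]
  show "(strand_in \<gamma> E n x b \<sigma>, mid x b \<sigma>) \<in> conn Jr"
    by (rule conn_mono[OF cc[OF vs(1)]]) blast
  show "(strand_in \<gamma> E n x b \<sigma>, strand_out \<gamma> E n x b \<sigma>) \<in> conn Jr"
    by (rule conn_mono[OF cc[OF conn_trans[OF vs]]]) blast
qed

text \<open>Rungs with the same new index are separated only by vanished crossings, and the virtual
  joins lead through these.\<close>

lemma conn_Rung_red:
  assumes "j \<in> E'" "m' \<le> last_rung \<gamma> E n j"
  shows "m \<le> m' \<Longrightarrow> red j m = red j m' \<Longrightarrow> (Rung j m \<sigma>, Rung j m' \<sigma>) \<in> conn Jr"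
  using assms(2)
proof (induction m')
  case (Suc k)
  show ?case
  proof (cases "m = Suc k")
    case False
    then have mk: "m \<le> k" using Suc.prems by simp
    then have r: "red j m = red j k" "red j (Suc k) = red j k"
      using red_mono[OF mk, of j] red_mono[of k "Suc k" j] Suc.prems by auto
    have "k < last_rung \<gamma> E n j" using Suc.prems by simp
    then have "(Rung j k \<sigma>, Rung j (Suc k) \<sigma>) \<in> conn Jr"
    proof (cases rule: red_Suc_cases)
      case (2 x b)
      then have "fst (crossing_point x b) \<noteq> i" using assms(1) by auto
      from conn_Vj_Lr(2)[OF 2(1) this, of \<sigma>] 2 show ?thesis by (simp add: strand_in_def strand_out_def)
    qed (use r in simp)
    moreover have "(Rung j m \<sigma>, Rung j k \<sigma>) \<in> conn Jr" using Suc mk r by simp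
    ultimately show ?thesis by (rule conn_trans[rotated])
  qed simp
qed simp

lemma Lr_cases:
  assumes "p \<in> Lr"
  obtains j m \<sigma> where "p = Rung j m \<sigma>" "j \<in> E'" "m \<le> last_rung \<gamma> E n j"
  | x b \<sigma> where "p = mid x b \<sigma>" "x \<in> S'"
  | x b \<sigma> where "p = mid x b \<sigma>" "x \<in> S - S'" "fst (crossing_point x b) \<noteq> i"
proof -
  have "p \<in> L" using assms by blast
  then show thesis
  proof (cases rule: band_labels_cases)
    case (1 j m \<sigma>)
    then show ?thesis using that(1) assms Lr_Rung by blast
  next
    case (2 x b \<sigma>)
    then have "x \<in> S" "fst (crossing_point x b) \<noteq> i" using assms Lr_mid by blast+
    then show ?thesis using that(2,3) 2 by blast
  qed
qed

text \<open>A mid arc of a vanished crossing may be traded for the rung before it, so fibres of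
  \<open>collapse\<close> have to be compared only on rungs and surviving mid arcs.\<close>

lemma Lr_Rung_rep:
  assumes "p \<in> Lr"
  obtains x b \<sigma> where "p = mid x b \<sigma>" "x \<in> S'"
  | j m \<sigma> where "j \<in> E'" "m \<le> last_rung \<gamma> E n j" "collapse p = Rung j (red j m) \<sigma>" "(p, Rung j m \<sigma>) \<in> conn Jr"
  using assms
proof (cases rule: Lr_cases)
  case (1 j m \<sigma>)
  then show ?thesis using that(2)[of j m \<sigma>] by simp
next
  case (2 x b \<sigma>)
  then show ?thesis by (rule that(1))
next
  case (3 x b \<sigma>)
  let ?p = "crossing_point x b"
  have "fst ?p \<in> E'" using 3 by (simp add: sub_crossings_iff)
  moreover have "position \<gamma> E n ?p \<le> last_rung \<gamma> E n (fst ?p)"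
    using position_bounds[OF reg _ refl, of x E n b] 3(2) by auto
  moreover have "(p, Rung (fst ?p) (position \<gamma> E n ?p) \<sigma>) \<in> conn Jr"
    using conn_Vj_Lr(1)[OF 3(2,3), of \<sigma>, THEN conn_sym] 3(1) by (simp add: strand_in_def)
  ultimately show ?thesis using that(2) 3 by (simp add: collapse_mid)
qed

text \<open>The renumbering postponed during the retraction. Each fibre of \<open>collapse\<close>
  is tied together by virtual joins, and the quotient is the code of the sub-diagram without
  \<open>i\<close>.\<close>

lemma br_collapse: "br Lr Xr Jr = band_bracket \<gamma> E' n (next_edge \<gamma> E')"
  unfolding band_bracket_def
proof (rule br_quotient[where f = collapse, OF _ Xr_labels])
  let ?L' = "band_labels \<gamma> E' n" and ?J' = "vertex_joins \<gamma> E' n (next_edge \<gamma> E')"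
  have S'S: "S' \<subseteq> S" using S'_iff by blast
  show "collapse ` Lr = ?L'"
  proof
    show "collapse ` Lr \<subseteq> ?L'"
    proof
      fix q assume "q \<in> collapse ` Lr"
      then obtain p where p: "p \<in> Lr" "q = collapse p" by blast
      from p(1) show "q \<in> ?L'"
      proof (cases rule: Lr_Rung_rep)
        case (1 x b \<sigma>)
        then show ?thesis using p(2) by (simp add: collapse_mid)
      next
        case (2 j m \<sigma>)
        then show ?thesis using p(2) red_mono[OF 2(2), of j] by (simp add: red_last)
      qed
    qed
    show "?L' \<subseteq> collapse ` Lr"
    proof
      fix q assume "q \<in> ?L'"
      then show "q \<in> collapse ` Lr"
      proof (cases rule: band_labels_cases)
        case (1 j m \<sigma>)
        then have "m \<le> red j (last_rung \<gamma> E n j)" by (simp add: red_last)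
        from red_surj[OF this order_refl] obtain k where "k \<le> last_rung \<gamma> E n j" "red j k = m" by blast
        then show ?thesis using 1 by (intro image_eqI[of _ _ "Rung j k \<sigma>"]) (simp_all del: Diff_iff)
      next
        case (2 x b \<sigma>)
        then have "x \<in> S" "fst (crossing_point x b) \<noteq> i" using S'_iff by blast+
        then show ?thesis using 2 by (intro image_eqI[of _ _ "mid x b \<sigma>"]) (simp_all add: collapse_mid del: Diff_iff)
      qed
    qed
  qed
  show "inj_on (map_crossing collapse) Xr"
  proof (rule inj_on_band_crossings[where g = "\<lambda>p. p", OF order_refl])
    fix c assume "c \<in> twists E n"
    have "map_crossing (\<lambda>p. p) c = c" by (cases c) simp
    then show "map_crossing (\<lambda>p. p) (map_crossing collapse c) = c" by (simp add: collapse_twist[OF \<open>c \<in> twists E n\<close>])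
  next
    fix p c y b \<rho> assume "collapse p = mid y b \<rho>"
    then show "\<exists>x b \<sigma>. p = mid x b \<sigma>"
    proof (cases p)
      case (OverMid x \<sigma>)
      then show ?thesis using mid.simps[of x True \<sigma>] by metis
    next
      case (UnderMid x \<sigma>)
      then show ?thesis using mid.simps[of x False \<sigma>] by metis
    qed simp
  qed (simp add: collapse_mid)
  show "map_crossing collapse ` Xr = twists E' n \<union> band_crossings \<gamma> E' n S'"
  proof -
    have "map_crossing collapse ` twists E n = twists E' n"
    proof -
      have "map_crossing collapse ` twists E n = twists E n" using collapse_twist by simp
      moreover have "twists E n = twists E' n" unfolding twists_def using ni by force
      ultimately show ?thesis by simp
    qed
    moreover have "map_crossing collapse ` band_crossings \<gamma> E n S' = band_crossings \<gamma> E' n S'"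
    proof
      show "map_crossing collapse ` band_crossings \<gamma> E n S' \<subseteq> band_crossings \<gamma> E' n S'"
      proof
        fix c assume "c \<in> map_crossing collapse ` band_crossings \<gamma> E n S'"
        then obtain x \<sigma> \<tau> where "c = map_crossing collapse (band_crossing \<gamma> E n x \<sigma> \<tau>)" "x \<in> S'"
          unfolding band_crossings_def by blast
        then show "c \<in> band_crossings \<gamma> E' n S'" unfolding band_crossings_def using collapse_band by blast
      qed
      show "band_crossings \<gamma> E' n S' \<subseteq> map_crossing collapse ` band_crossings \<gamma> E n S'"
      proof
        fix c assume "c \<in> band_crossings \<gamma> E' n S'"
        then obtain x \<sigma> \<tau> where x: "c = band_crossing \<gamma> E' n x \<sigma> \<tau>" "x \<in> S'"
          unfolding band_crossings_def by blast
        then have "c = map_crossing collapse (band_crossing \<gamma> E n x \<sigma> \<tau>)" using collapse_band by simp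
        moreover have "band_crossing \<gamma> E n x \<sigma> \<tau> \<in> band_crossings \<gamma> E n S'" using x unfolding band_crossings_def by blast
        ultimately show "c \<in> map_crossing collapse ` band_crossings \<gamma> E n S'" by (rule image_eqI)
      qed
    qed
    ultimately show ?thesis by (simp only: image_Un)
  qed
  show "(collapse p, collapse q) \<in> conn ?J'" if pq: "(p, q) \<in> Jr" for p q
    using pq
  proof
    assume "(p, q) \<in> vertex_joins \<gamma> E n (next_edge \<gamma> E')"
    then obtain u a b where *: "p = left_end \<gamma> E n u a" "q = right_end \<gamma> E n u b" "u \<in> {0..3}" "next_edge \<gamma> E' u a b"
      unfolding vertex_joins_def by blast
    then have "(collapse p, collapse q) \<in> ?J'" unfolding vertex_joins_def collapse_end *(1,2) by blast
    then show ?thesis by (intro conn_base) blast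
  next
    assume "(p, q) \<in> Vj (S - S') \<inter> Lr \<times> Lr"
    then obtain x \<sigma> \<tau> where x: "x \<in> S - S'" and v: "(p, q) \<in> virtual_joins (band_crossing \<gamma> E n x \<sigma> \<tau>)"
      unfolding band_crossings_def by blast
    from v obtain c \<rho> where "{p, q} \<subseteq> {strand_in \<gamma> E n x c \<rho>, mid x c \<rho>, strand_out \<gamma> E n x c \<rho>}"
      by (rule virtual_joins_sides)
    then have "collapse p = collapse q" using collapse_strand[OF x, of c \<rho>] by auto
    then show ?thesis by simp
  qed
  show "\<exists>p\<in>Lr. \<exists>q\<in>Lr. collapse p = p' \<and> collapse q = q' \<and> (p, q) \<in> conn Jr" if pq: "(p', q') \<in> ?J'" for p' q'
  proof -
    obtain u a b where *: "p' = left_end \<gamma> E' n u a" "q' = right_end \<gamma> E' n u b" "u \<in> {0..3}" "next_edge \<gamma> E' u a b"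
      using pq unfolding vertex_joins_def by blast
    let ?p = "left_end \<gamma> E n u a" and ?q = "right_end \<gamma> E n u b"
    have J: "(?p, ?q) \<in> Jr" using vertex_joinsI[OF *(3), of "next_edge \<gamma> E'", OF *(4)] by blast
    then have "?p \<in> Lr" "?q \<in> Lr" using Jr_labels by blast+
    moreover have "(?p, ?q) \<in> conn Jr" using J by (intro conn_base) blast
    ultimately show ?thesis using *(1,2) collapse_end by metis
  qed
  show "(p, q) \<in> conn Jr" if p: "p \<in> Lr" and q: "q \<in> Lr" and e: "collapse p = collapse q" for p q
    using p
  proof (cases rule: Lr_Rung_rep)
    case (1 x b \<sigma>)
    from q show ?thesis
    proof (cases rule: Lr_Rung_rep)
      case (2 j m \<sigma>)
      then show ?thesis using e 1 by (simp add: collapse_mid)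
    qed (use 1 e in \<open>simp add: collapse_mid\<close>)
  next
    case P: (2 j m \<sigma>)
    from q show ?thesis
    proof (cases rule: Lr_Rung_rep)
      case (1 x b \<sigma>)
      then show ?thesis using e P by (simp add: collapse_mid)
    next
      case (2 j' m' \<sigma>')
      then have e': "j' = j" "\<sigma>' = \<sigma>" "red j m = red j m'" using e P by auto
      have "(Rung j m \<sigma>, Rung j m' \<sigma>) \<in> conn Jr"
      proof (cases "m \<le> m'")
        case True
        show ?thesis by (rule conn_Rung_red[OF P(1) _ True e'(3)]) (use 2(2) e'(1) in simp)
      next
        case False
        then have "m' \<le> m" by simp
        from conn_Rung_red[OF P(1,2) this e'(3)[symmetric]] show ?thesis by (rule conn_sym)
      qed
      moreover have "(q, Rung j m' \<sigma>) \<in> conn Jr" using 2(4) e'(1,2) by simp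
      ultimately show ?thesis by (rule conn_trans[OF P(4) conn_trans[OF _ conn_sym]])
    qed
  qed
qed

theorem band_bracket_retract:
  "band_bracket \<gamma> E n (detached \<gamma> E i v) =
     (if incident (E - {i}) w = {} then \<delta> else 1) * band_bracket \<gamma> (E - {i}) n (next_edge \<gamma> (E - {i}))"
  using stage_len br_collapse remove_band_isolated remove_band_attached by simp

end

section \<open>The writhe\<close>

lemma orientation_flip:
  assumes "link_orientation D ori" "(p, q) \<in> passages D \<or> (q, p) \<in> passages D"
  shows "(q, p) \<in> ori \<longleftrightarrow> (p, q) \<notin> ori"
  using assms unfolding link_orientation_def by blast

text \<open>An orientation enters a label once and leaves it once, so with two passages at
  \<open>q\<close> it uses one for each.\<close>

lemma orientation_through:
  assumes o: "link_orientation D ori" and q: "q \<in> labels D"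
    and pq: "(p, q) \<in> passages D \<or> (q, p) \<in> passages D" and qr: "(q, r) \<in> passages D \<or> (r, q) \<in> passages D"
    and "p \<noteq> r"
  shows "(p, q) \<in> ori \<longleftrightarrow> (q, r) \<in> ori"
proof -
  have "\<exists>!s. (q, s) \<in> ori" "\<exists>!s. (s, q) \<in> ori" using o q unfolding link_orientation_def by blast+
  then show ?thesis using orientation_flip[OF o pq] orientation_flip[OF o qr] \<open>p \<noteq> r\<close> by metis
qed

locale oriented_bands =
  fixes \<gamma> :: spatial_graph and n :: "nat \<Rightarrow> int" and ori :: "(band_arc \<times> band_arc) set"
  assumes reg: "regular_projection \<gamma>" and bo: "boundary_orientation \<gamma> n ori"
begin

abbreviation "D \<equiv> twisted_bands \<gamma> n"
abbreviation "step \<equiv> forward_step \<gamma> n"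

lemma lo: "link_orientation D ori"
  using bo by (simp add: boundary_orientation_def)

lemma step_flip: "step p q \<Longrightarrow> (q, p) \<in> ori \<longleftrightarrow> (p, q) \<notin> ori"
  using orientation_flip[OF lo forward_step_passage] .

lemma step_labels: "step p q \<Longrightarrow> p \<in> labels D \<and> q \<in> labels D"
proof -
  assume "step p q"
  then show ?thesis
  proof cases
    case (twist i k \<sigma>)
    then show ?thesis
      using Rung_band_labels[of i k \<sigma> \<gamma> "{1..6}" n] Rung_band_labels[of i "Suc k" "opposite_side \<sigma>" \<gamma> "{1..6}" n]
      by (simp add: band_labels_def last_rung_def)
  next
    case (enter x i b m \<sigma>)
    then show ?thesis
      using Rung_band_labels[of i m \<sigma> \<gamma> "{1..6}" n] mid_band_labels[of x b \<sigma> \<gamma> "{1..6}" n]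
        position_range[OF reg enter(3), of n b] crossing_point_edge[OF enter(3), of b] sub_crossings_all[of \<gamma>]
      by (simp add: band_labels_def)
  next
    case (leave x i b m \<sigma>)
    then show ?thesis
      using Rung_band_labels[of i "Suc m" \<sigma> \<gamma> "{1..6}" n] mid_band_labels[of x b \<sigma> \<gamma> "{1..6}" n]
        position_range[OF reg leave(3), of n b] crossing_point_edge[OF leave(3), of b] sub_crossings_all[of \<gamma>]
      by (simp add: band_labels_def)
  qed
qed

lemma step_asym: "step p q \<Longrightarrow> \<not> step q p"
  by (auto elim!: forward_step.cases)

lemma step_chain:
  assumes "step p q" "step q r"
  shows "(p, q) \<in> ori \<longleftrightarrow> (q, r) \<in> ori"
proof (rule orientation_through[OF lo])
  show "q \<in> labels D" using step_labels[OF assms(1)] by simp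
  show "p \<noteq> r" using step_asym[OF assms(1)] assms(2) by blast
qed (use forward_step_passage assms in blast)+

text \<open>The direction of a rung is read off from the passage that follows it along the band;
  below the last rung there is exactly one.\<close>

definition forward :: "nat \<Rightarrow> nat \<Rightarrow> side \<Rightarrow> bool" where
  "forward i m \<sigma> \<longleftrightarrow> (\<exists>q. step (Rung i m \<sigma>) q \<and> (Rung i m \<sigma>, q) \<in> ori)"

lemma forward_iff:
  assumes "i \<in> {1..6}" "m < last_rung \<gamma> {1..6} n i" "step (Rung i m \<sigma>) q"
  shows "forward i m \<sigma> \<longleftrightarrow> (Rung i m \<sigma>, q) \<in> ori"
  using forward_step_Rung_ex1(1)[OF reg assms(1,2), of \<sigma>] assms(3) unfolding forward_def by metis

lemma step_edge: "step (Rung i m \<sigma>) (Rung j l \<tau>) \<Longrightarrow> j = i"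
  by (erule forward_step.cases) auto

text \<open>The boundary of the disk at the tail reaches the band on its right side and departs from
  it on its left side, in one and the same sense. This is where the condition on the disks in
  \<open>boundary_orientation\<close> enters.\<close>

lemma forward_start:
  assumes i: "i \<in> {1..6}" and l: "0 < last_rung \<gamma> {1..6} n i"
  shows "forward i 0 LeftSide \<longleftrightarrow> \<not> forward i 0 RightSide"
proof -
  let ?v = "tail i" and ?L = "Rung i 0 LeftSide" and ?R = "Rung i 0 RightSide"
  have v: "?v \<in> {0..3}" and inc: "i \<in> incident {1..6} ?v"
    using tail_head_range[OF i] i by (auto simp: incident_def)
  obtain z where z: "next_edge \<gamma> {1..6} ?v i z" using next_edge_ex1(1)[OF reg v inc] by blast
  obtain y where y: "next_edge \<gamma> {1..6} ?v y i" using next_edge_ex1(2)[OF reg v inc] by blast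
  have yz: "z \<noteq> i" "y \<noteq> i"
    using next_edge_ex1(3)[OF reg v inc z] next_edge_ex1(3)[OF reg v _ y] next_edge_incident[OF y] by auto
  let ?Z = "right_end \<gamma> {1..6} n ?v z" and ?Y = "left_end \<gamma> {1..6} n ?v y"
  have "(left_end \<gamma> {1..6} n ?v i, ?Z) \<in> disk_arcs \<gamma> {1..6} n ?v" "(?Y, right_end \<gamma> {1..6} n ?v i) \<in> disk_arcs \<gamma> {1..6} n ?v"
    using z y unfolding disk_arcs_def by blast+
  then have arcs: "(?L, ?Z) \<in> disk_arcs \<gamma> {1..6} n ?v" "(?Y, ?R) \<in> disk_arcs \<gamma> {1..6} n ?v"
    by (simp_all add: left_end_def right_end_def)
  then have pas: "(?L, ?Z) \<in> passages D" "(?Y, ?R) \<in> passages D"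
    using v by (auto simp: passages_def band_diagram_def)
  obtain q where q: "step ?L q" using forward_step_Rung_ex1(1)[OF reg i l] by blast
  obtain r where r: "step ?R r" using forward_step_Rung_ex1(1)[OF reg i l] by blast
  have qz: "q \<noteq> ?Z" using q step_edge[of i 0 LeftSide] yz(1) by (auto simp: right_end_def split: if_splits)
  have ry: "?Y \<noteq> r" using r step_edge[of i 0 RightSide] yz(2) by (auto simp: left_end_def split: if_splits)
  have "(q, ?L) \<in> ori \<longleftrightarrow> (?L, ?Z) \<in> ori"
    by (rule orientation_through[OF lo]) (use step_labels[OF q] forward_step_passage[OF q] pas qz in auto)
  then have fL: "forward i 0 LeftSide \<longleftrightarrow> (?L, ?Z) \<notin> ori" using step_flip[OF q] forward_iff[OF i l q] by blast
  have "(?Y, ?R) \<in> ori \<longleftrightarrow> (?R, r) \<in> ori"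
    by (rule orientation_through[OF lo]) (use step_labels[OF r] forward_step_passage[OF r] pas ry in auto)
  then have fR: "forward i 0 RightSide \<longleftrightarrow> (?Y, ?R) \<in> ori" using forward_iff[OF i l r] by blast
  have "disk_arcs \<gamma> {1..6} n ?v \<subseteq> ori \<or> (disk_arcs \<gamma> {1..6} n ?v)\<inverse> \<subseteq> ori"
    using bo v by (simp add: boundary_orientation_def)
  then have "(?L, ?Z) \<in> ori \<longleftrightarrow> (?Y, ?R) \<in> ori"
  proof
    assume "(disk_arcs \<gamma> {1..6} n ?v)\<inverse> \<subseteq> ori"
    then have "(?Z, ?L) \<in> ori" "(?R, ?Y) \<in> ori" using arcs by blast+
    then show ?thesis using orientation_flip[OF lo] pas by blast
  qed (use arcs in blast)
  then show ?thesis using fL fR by blast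
qed

text \<open>Opposite directions propagate along the band: a half twist exchanges the sides, a
  crossing keeps them.\<close>

lemma forward_sides:
  assumes i: "i \<in> {1..6}"
  shows "m < last_rung \<gamma> {1..6} n i \<Longrightarrow> forward i m LeftSide \<longleftrightarrow> \<not> forward i m RightSide"
proof (induction m)
  case 0
  then show ?case by (rule forward_start[OF i])
next
  case (Suc m)
  then have m: "m < last_rung \<gamma> {1..6} n i" by simp
  show ?case
  proof (cases "m < nat \<bar>n i\<bar>")
    case True
    have "forward i m \<sigma> \<longleftrightarrow> forward i (Suc m) (opposite_side \<sigma>)" for \<sigma>
    proof -
      obtain q where q: "step (Rung i (Suc m) (opposite_side \<sigma>)) q"
        using forward_step_Rung_ex1(1)[OF reg i Suc.prems] by blast
      have s: "step (Rung i m \<sigma>) (Rung i (Suc m) (opposite_side \<sigma>))" by (rule forward_step.twist[where n = n, OF i True])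
      show ?thesis using step_chain[OF s q] forward_iff[OF i m s] forward_iff[OF i Suc.prems q] by simp
    qed
    from this[of LeftSide] this[of RightSide] show ?thesis using Suc.IH[OF m] by auto
  next
    case False
    then have "nat \<bar>n i\<bar> \<le> m" by simp
    from position_ex1[OF reg this m] obtain x b where x: "x \<in> graph_crossings \<gamma>" "i = fst (crossing_point x b)"
      "m = position \<gamma> {1..6} n (crossing_point x b)" by (auto simp del: prod.inject)
    have "forward i m \<sigma> \<longleftrightarrow> forward i (Suc m) \<sigma>" for \<sigma>
    proof -
      obtain q where q: "step (Rung i (Suc m) \<sigma>) q"
        using forward_step_Rung_ex1(1)[OF reg i Suc.prems] by blast
      note s = forward_step.enter[OF x, of \<sigma>] forward_step.leave[OF x, of \<sigma>]
      show ?thesis using step_chain[OF s] step_chain[OF s(2) q] forward_iff[OF i m s(1)] forward_iff[OF i Suc.prems q] by simp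
    qed
    then show ?thesis using Suc.IH[OF m] by simp
  qed
qed

lemma twist_sign:
  assumes i: "i \<in> {1..6}" and k: "k < nat \<bar>n i\<bar>"
  shows "crossing_sign ori (twist_crossing n i k) = - sgn (n i)"
proof -
  have l: "k < last_rung \<gamma> {1..6} n i" using k by (simp add: last_rung_def)
  have s: "step (Rung i k \<sigma>) (Rung i (Suc k) (opposite_side \<sigma>))" for \<sigma> by (rule forward_step.twist[where n = n, OF i k])
  have f: "(Rung i k \<sigma>, Rung i (Suc k) (opposite_side \<sigma>)) \<in> ori \<longleftrightarrow> forward i k \<sigma>" for \<sigma>
    using forward_iff[OF i l s] by simp
  have g: "(Rung i (Suc k) (opposite_side \<sigma>), Rung i k \<sigma>) \<in> ori \<longleftrightarrow> \<not> forward i k \<sigma>" for \<sigma>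
    using step_flip[OF s] f by simp
  show ?thesis
    using f[of LeftSide] f[of RightSide] g[of LeftSide] g[of RightSide] forward_sides[OF i l] k
    by (auto simp: twist_crossing_def Let_def sgn_if)
qed

text \<open>The two sides of the upper band run across the given side of the lower band in opposite
  directions.\<close>

lemma band_sign:
  assumes x: "x \<in> graph_crossings \<gamma>"
  shows "crossing_sign ori (band_crossing \<gamma> {1..6} n x LeftSide \<tau>) + crossing_sign ori (band_crossing \<gamma> {1..6} n x RightSide \<tau>) = 0"
proof -
  define i where "i b = fst (crossing_point x b)" for b
  define m where "m b = position \<gamma> {1..6} n (crossing_point x b)" for b
  have r: "i b \<in> {1..6}" "m b < last_rung \<gamma> {1..6} n (i b)" for b
    using crossing_point_edge[OF x] position_range[OF reg x, of n b] by (auto simp: i_def m_def)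
  have s: "step (Rung (i b) (m b) \<sigma>) (mid x b \<sigma>)" "step (mid x b \<sigma>) (Rung (i b) (Suc (m b)) \<sigma>)" for b \<sigma>
    using forward_step.enter[OF x, of "i b" b "m b" n \<sigma>] forward_step.leave[OF x, of "i b" b "m b" n \<sigma>]
    by (simp_all add: i_def m_def)
  have f: "(Rung (i b) (m b) \<sigma>, mid x b \<sigma>) \<in> ori \<longleftrightarrow> forward (i b) (m b) \<sigma>"
    "(mid x b \<sigma>, Rung (i b) (Suc (m b)) \<sigma>) \<in> ori \<longleftrightarrow> forward (i b) (m b) \<sigma>"
    "(mid x b \<sigma>, Rung (i b) (m b) \<sigma>) \<in> ori \<longleftrightarrow> \<not> forward (i b) (m b) \<sigma>"
    "(Rung (i b) (Suc (m b)) \<sigma>, mid x b \<sigma>) \<in> ori \<longleftrightarrow> \<not> forward (i b) (m b) \<sigma>" for b \<sigma>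
    using forward_iff[OF r s(1)] step_chain[OF s] step_flip[OF s(1)] step_flip[OF s(2)] by simp_all
  have "forward (i True) (m True) LeftSide \<longleftrightarrow> \<not> forward (i True) (m True) RightSide" by (rule forward_sides[OF r])
  note f' = f[of True] f[of False] this
  have e: "i True = fst (fst x)" "i False = fst (snd x)" "m True = position \<gamma> {1..6} n (fst x)" "m False = position \<gamma> {1..6} n (snd x)"
    "\<And>\<sigma>. mid x True \<sigma> = OverMid x \<sigma>" "\<And>\<sigma>. mid x False \<sigma> = UnderMid x \<sigma>"
    by (simp_all add: i_def m_def mid.simps crossing_point.simps)
  show ?thesis
    using f'[unfolded e] by (cases "graph_crossing_sign \<gamma> x = 1"; cases \<tau>) (simp_all add: band_crossing_def Let_def)
qed

theorem writhe_bands: "writhe D ori = - (\<Sum>i=1..6. n i)"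
proof -
  let ?C = "graph_crossings \<gamma>" and ?s = "crossing_sign ori"
  have fC: "finite ?C" using reg by (simp add: regular_projection_def)
  have cr: "crossings D = twists {1..6} n \<union> band_crossings \<gamma> {1..6} n ?C"
    unfolding band_diagram_def twists_def band_crossings_def link_diagram.simps sub_crossings_all ..
  have "sum ?s (twists {1..6} n) = (\<Sum>(i, k)\<in>(SIGMA i:{1..6}. {..<nat \<bar>n i\<bar>}). ?s (twist_crossing n i k))"
    unfolding twists_image by (subst sum.reindex) (auto simp: inj_on_def twist_crossing_inject case_prod_unfold)
  also have "\<dots> = (\<Sum>i=1..6. \<Sum>k<nat \<bar>n i\<bar>. ?s (twist_crossing n i k))"
    by (rule sum.Sigma[symmetric]) auto
  also have "\<dots> = (\<Sum>i=1..6. - n i)"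
  proof (rule sum.cong[OF refl])
    fix i :: nat assume "i \<in> {1..6}"
    then have "(\<Sum>k<nat \<bar>n i\<bar>. ?s (twist_crossing n i k)) = (\<Sum>k<nat \<bar>n i\<bar>. - sgn (n i))"
      by (intro sum.cong) (auto simp: twist_sign)
    also have "\<dots> = - n i" by (simp add: sgn_if)
    finally show "(\<Sum>k<nat \<bar>n i\<bar>. ?s (twist_crossing n i k)) = - n i" .
  qed
  finally have T: "sum ?s (twists {1..6} n) = - (\<Sum>i=1..6. n i)" by (simp add: sum_negf)
  let ?b = "\<lambda>(x, \<tau>, \<sigma>). band_crossing \<gamma> {1..6} n x \<sigma> \<tau>"
  have bw: "band_crossings \<gamma> {1..6} n ?C = ?b ` (?C \<times> UNIV \<times> UNIV)"
  proof (intro set_eqI iffI)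
    fix c assume "c \<in> band_crossings \<gamma> {1..6} n ?C"
    then obtain x \<sigma> \<tau> where "c = band_crossing \<gamma> {1..6} n x \<sigma> \<tau>" "x \<in> ?C" unfolding band_crossings_def by blast
    then show "c \<in> ?b ` (?C \<times> UNIV \<times> UNIV)" by (intro image_eqI[of _ _ "(x, \<tau>, \<sigma>)"]) auto
  next
    fix c assume "c \<in> ?b ` (?C \<times> UNIV \<times> UNIV)"
    then obtain p where p: "c = ?b p" "p \<in> ?C \<times> UNIV \<times> UNIV" by (rule imageE)
    obtain x \<tau> \<sigma> where "p = (x, \<tau>, \<sigma>)" by (rule prod_cases3)
    then have "c = band_crossing \<gamma> {1..6} n x \<sigma> \<tau>" "x \<in> ?C" using p by simp_all
    then show "c \<in> band_crossings \<gamma> {1..6} n ?C" unfolding band_crossings_def by blast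
  qed
  have sides: "(UNIV :: side set) = {LeftSide, RightSide}" using side.exhaust by blast
  have "sum ?s (band_crossings \<gamma> {1..6} n ?C) = (\<Sum>p\<in>?C \<times> UNIV \<times> UNIV. ?s (?b p))"
    unfolding bw by (subst sum.reindex) (auto simp: inj_on_def band_crossing_inject)
  also have "\<dots> = (\<Sum>x\<in>?C. \<Sum>\<tau>\<in>UNIV. \<Sum>\<sigma>\<in>UNIV. ?s (band_crossing \<gamma> {1..6} n x \<sigma> \<tau>))"
    by (simp add: sum.cartesian_product case_prod_unfold)
  also have "\<dots> = 0"
  proof (rule sum.neutral, rule ballI, rule sum.neutral, rule ballI)
    fix x \<tau> assume "x \<in> ?C"
    then show "(\<Sum>\<sigma>\<in>UNIV. ?s (band_crossing \<gamma> {1..6} n x \<sigma> \<tau>)) = 0"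
      unfolding sides using band_sign by simp
  qed
  finally have B: "sum ?s (band_crossings \<gamma> {1..6} n ?C) = 0" .
  have "twists {1..6} n \<inter> band_crossings \<gamma> {1..6} n ?C = {}"
    using twist_crossing_not_band unfolding twists_def band_crossings_def by blast
  then have "writhe D ori = sum ?s (twists {1..6} n) + sum ?s (band_crossings \<gamma> {1..6} n ?C)"
    unfolding writhe_def cr using finite_twists[of "{1..6}" n] finite_band_crossings[OF fC] by (intro sum.union_disjoint) auto
  then show ?thesis using T B by simp
qed

end

section \<open>The bracket of the twisted bands\<close>

lemma band_bracket_next: "band_bracket \<gamma> E n (next_edge \<gamma> E) = bracket (band_diagram \<gamma> E n)"
  by (simp add: band_bracket_def bracket_band_diagram)

lemma band_diagram_cong:
  assumes "\<And>i. i \<in> E \<Longrightarrow> n i = n' i"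
  shows "band_diagram \<gamma> E n = band_diagram \<gamma> E n'"
proof -
  have l: "last_rung \<gamma> E n i = last_rung \<gamma> E n' i" if "i \<in> E" for i using assms that by (simp add: last_rung_def)
  have t: "twist_crossing n i k = twist_crossing n' i k" if "i \<in> E" for i k
    using assms that by (simp add: twist_crossing_def)
  have p: "position \<gamma> E n p = position \<gamma> E n' p" if "fst p \<in> E" for p
    using assms that by (cases p) (simp add: position_def)
  have b: "band_crossing \<gamma> E n x \<sigma> \<tau> = band_crossing \<gamma> E n' x \<sigma> \<tau>" if "x \<in> sub_crossings \<gamma> E" for x \<sigma> \<tau>
    using that p by (simp add: band_crossing_def sub_crossings_def)
  have e: "left_end \<gamma> E n v i = left_end \<gamma> E n' v i" "right_end \<gamma> E n v i = right_end \<gamma> E n' v i" if "i \<in> E" for v i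
    using l[OF that] by (simp_all add: left_end_def right_end_def)
  have d: "disk_arcs \<gamma> E n v = disk_arcs \<gamma> E n' v" for v
  proof -
    have "(left_end \<gamma> E n v i, right_end \<gamma> E n v j) = (left_end \<gamma> E n' v i, right_end \<gamma> E n' v j)"
      if "next_edge \<gamma> E v i j" for i j
      using next_edge_incident[OF that] e by (simp add: incident_def)
    then show ?thesis unfolding disk_arcs_def by metis
  qed
  have 1: "{Rung i m \<sigma> | i m \<sigma>. i \<in> E \<and> m \<le> last_rung \<gamma> E n i} = {Rung i m \<sigma> | i m \<sigma>. i \<in> E \<and> m \<le> last_rung \<gamma> E n' i}"
    using l by auto
  have 2: "{twist_crossing n i k | i k. i \<in> E \<and> k < nat \<bar>n i\<bar>} = {twist_crossing n' i k | i k. i \<in> E \<and> k < nat \<bar>n' i\<bar>}"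
    using t assms by metis
  have 3: "{band_crossing \<gamma> E n x \<sigma> \<tau> | x \<sigma> \<tau>. x \<in> sub_crossings \<gamma> E} = {band_crossing \<gamma> E n' x \<sigma> \<tau> | x \<sigma> \<tau>. x \<in> sub_crossings \<gamma> E}"
    using b by metis
  show ?thesis unfolding band_diagram_def 1 2 3 d ..
qed

definition \<phi>A :: "int poly fract" where "\<phi>A = \<A>\<^sup>2 + \<A> powi (-2)"

lemma \<phi>A: "\<delta> = - \<phi>A" "\<phi>A \<noteq> 0"
  using delta_nonzero by (auto simp: \<phi>A_def)

text \<open>The weight of a cut band with \<open>k\<close> half twists, relative to that of an uncut one.\<close>

definition cut_weight :: "int \<Rightarrow> int poly fract" where
  "cut_weight k = (1 - (- (\<A> powi (-4))) powi k) / \<phi>A"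

lemma powi_step:
  fixes a :: "'a :: field"
  assumes "a \<noteq> 0"
  shows "a powi (k + 1) = a * a powi k" "a powi (k - 1) = a powi k / a"
  using assms by (simp_all add: power_int_add power_int_diff)

text \<open>\<open>b\<close> stands for the band at its disk and \<open>c\<close> for the band on a
  cap. The values of \<open>c\<close> are geometric with ratio \<open>x\<close>, the kink factor.
  Every twist adds a cut term to \<open>b\<close>; relative to \<open>\<A> powi k\<close> these
  terms form a geometric series with ratio \<open>y\<close>, where \<open>x = \<A> * y\<close>, and
  1 - y = A^(-2) \<phi> turns its sum into \<open>cut_weight k\<close>.\<close>

lemma twist_recursion:
  fixes b c :: "int \<Rightarrow> int poly fract"
  assumes b: "\<And>k. k \<noteq> 0 \<Longrightarrow> b k = weight (k > 0) * b (k - sgn k) + weight (\<not> k > 0) * (\<iota> * c (k - sgn k))"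
    and c: "\<And>k. k \<noteq> 0 \<Longrightarrow> c k = (weight (k > 0) + weight (\<not> k > 0) * \<delta>) * c (k - sgn k)"
  shows "c k = (- (\<A> powi (-3))) powi k * c 0 \<and> b k = \<A> powi k * (b 0 + cut_weight k * (\<iota> * c 0))"
proof -
  note A = A_nonzero
  define x where "x = - (\<A> powi (-3))"
  define y where "y = - (\<A> powi (-4))"
  have x0: "x \<noteq> 0" "y \<noteq> 0" using A by (auto simp: x_def y_def)
  have xy: "x powi k = \<A> powi k * y powi k" for k
  proof -
    have "x = \<A> * y" using A by (simp add: x_def y_def power_int_minus field_simps eval_nat_numeral)
    then show ?thesis by (simp add: power_int_mult_distrib)
  qed
  \<comment> \<open>The two kink factors are inverse to each other.\<close>
  have xA: "\<A> + \<A> powi (-1) * \<delta> = x" "\<A> powi (-1) + \<A> * \<delta> = 1 / x"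
    using A by (simp_all add: x_def power_int_minus field_simps eval_nat_numeral)
  have yA: "1 - y = \<A> powi (-2) * \<phi>A" "1 - 1 / y = \<A>\<^sup>2 * \<phi>A"
    using A by (simp_all add: y_def \<phi>A_def power_int_minus field_simps eval_nat_numeral)
  have zu: "cut_weight (k + 1) = cut_weight k + \<A> powi (-2) * y powi k" for k
  proof -
    have "1 - y * y powi k = (1 - y powi k) + \<A> powi (-2) * \<phi>A * y powi k"
      unfolding yA(1)[symmetric] by (simp add: algebra_simps)
    then show ?thesis using \<phi>A(2) unfolding cut_weight_def y_def[symmetric] powi_step(1)[OF x0(2)]
      by (simp only: add_divide_distrib) simp
  qed
  have zd: "cut_weight (k - 1) = cut_weight k + \<A>\<^sup>2 * y powi k" for k
  proof -
    have "1 - y powi k / y = (1 - y powi k) + \<A>\<^sup>2 * \<phi>A * y powi k"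
      unfolding yA(2)[symmetric] by (simp add: algebra_simps)
    then show ?thesis using \<phi>A(2) unfolding cut_weight_def y_def[symmetric] powi_step(2)[OF x0(2)]
      by (simp only: add_divide_distrib) simp
  qed
  \<comment> \<open>Twists are taken out towards 0, so the induction starts there and runs in both
    directions.\<close>
  have "c k = x powi k * c 0 \<and> b k = \<A> powi k * (b 0 + cut_weight k * (\<iota> * c 0))"
  proof (induction k rule: int_induct[where k = 0])
    case base
    show ?case by (simp add: cut_weight_def)
  next
    case (step1 k)
    then have k: "k + 1 \<noteq> 0" "k + 1 > 0" "k + 1 - sgn (k + 1) = k" by auto
    have "c (k + 1) = x * c k" using c[OF k(1)] k(2,3) xA(1) by (simp add: weight_def)
    moreover have "b (k + 1) = \<A> * b k + \<A> powi (-1) * (\<iota> * c k)" using b[OF k(1)] k(2,3) by (simp add: weight_def)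
    ultimately show ?case
      unfolding step1(2)[THEN conjunct1] step1(2)[THEN conjunct2] powi_step(1)[OF A] powi_step(1)[OF x0(1)] zu
      using A by (simp add: xy power_int_minus field_simps eval_nat_numeral)
  next
    case (step2 k)
    then have k: "k - 1 \<noteq> 0" "\<not> k - 1 > 0" "k - 1 - sgn (k - 1) = k" by auto
    have "c (k - 1) = 1 / x * c k" using c[OF k(1)] unfolding k(3)
      by (simp only: weight_def k(2) not_False_eq_True if_True if_False power_int_1_right xA(2))
    moreover have "b (k - 1) = \<A> powi (-1) * b k + \<A> * (\<iota> * c k)" using b[OF k(1)] unfolding k(3)
      by (simp only: weight_def k(2) not_False_eq_True if_True if_False power_int_1_right)
    ultimately show ?case
      unfolding step2(2)[THEN conjunct1] step2(2)[THEN conjunct2] powi_step(2)[OF A] powi_step(2)[OF x0(1)] zd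
      using A by (simp add: xy power_int_minus field_simps eval_nat_numeral)
  qed
  then show ?thesis by (simp add: x_def)
qed

section \<open>Counting bare disks, and the sum over sets of uncut bands\<close>

definition isolated :: "nat set \<Rightarrow> nat set" where
  "isolated E = {v\<in>{0..3}. incident E v = {}}"

text \<open>Each vertex that is not on any edge counts as a disk, whose boundary is one more circle.\<close>

definition disk_bracket :: "spatial_graph \<Rightarrow> (nat \<Rightarrow> int) \<Rightarrow> nat set \<Rightarrow> int poly fract" where
  "disk_bracket \<gamma> n E = \<delta> ^ card (isolated E) * bracket (band_diagram \<gamma> E n)"

text \<open>Removing a band can lay bare the disk at its tail and the one at its head. These match
  the two factors \<delta> that arise when the band is cut and retracted.\<close>

lemma card_isolated_Diff:
  assumes "i \<in> E" "E \<subseteq> {1..6}"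
  shows "card (isolated (E - {i})) = card (isolated E)
    + (if incident (E - {i}) (tail i) = {} then 1 else 0) + (if incident (E - {i}) (head i) = {} then 1 else 0)"
proof -
  let ?t = "if incident (E - {i}) (tail i) = {} then {tail i} else {}"
  let ?h = "if incident (E - {i}) (head i) = {} then {head i} else {}"
  have i: "i \<in> {1..6}" using assms by blast
  have r: "tail i \<in> {0..3}" "head i \<in> {0..3}" "tail i \<noteq> head i" using tail_head_range[OF i] tail_neq_head[OF i] by auto
  have inc: "i \<in> incident E v \<longleftrightarrow> v = tail i \<or> v = head i" for v using assms(1) by (auto simp: incident_def)
  have "isolated (E - {i}) = isolated E \<union> (?t \<union> ?h)"
  proof (rule set_eqI)
    fix u
    show "u \<in> isolated (E - {i}) \<longleftrightarrow> u \<in> isolated E \<union> (?t \<union> ?h)"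
    proof (cases "u = tail i \<or> u = head i")
      case True
      then have "incident E u \<noteq> {}" using inc by blast
      then show ?thesis using True r by (auto simp: isolated_def)
    next
      case False
      then have "incident (E - {i}) u = incident E u" using inc[of u] by (simp add: incident_Diff)
      then show ?thesis using False by (auto simp: isolated_def)
    qed
  qed
  moreover have "isolated E \<inter> (?t \<union> ?h) = {}" "?t \<inter> ?h = {}" using inc r by (auto simp: isolated_def)
  moreover have "finite (isolated E)" by (simp add: isolated_def)
  ultimately show ?thesis by (simp add: card_Un_disjoint)
qed

lemma disk_bracket_cong: "(\<And>i. i \<in> E \<Longrightarrow> n i = n' i) \<Longrightarrow> disk_bracket \<gamma> n E = disk_bracket \<gamma> n' E"
  using band_diagram_cong[of E n n' \<gamma>] by (simp add: disk_bracket_def)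

text \<open>All half twists of one band are resolved at once. The circles split off at either end
  are absorbed by the disks laid bare, so no case distinction remains.\<close>

theorem disk_bracket_twist:
  assumes reg: "regular_projection \<gamma>" and E: "E \<subseteq> {1..6}" "i \<in> E"
  shows "disk_bracket \<gamma> n E = \<A> powi n i * (disk_bracket \<gamma> (n(i := 0)) E + cut_weight (n i) * disk_bracket \<gamma> n (E - {i}))"
proof -
  define b where "b k = band_bracket \<gamma> E (n(i := k)) (next_edge \<gamma> E)" for k
  define c where "c k = band_bracket \<gamma> E (n(i := k)) (detached \<gamma> E i (tail i))" for k
  define \<iota> where "\<iota> = (if incident (E - {i}) (tail i) = {} then \<delta> else 1)"
  have ht: "half_twist \<gamma> E (n(i := k)) (n(i := k - sgn k)) i" if "k \<noteq> 0" for k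
    by unfold_locales (use assms that in auto)
  have "b k = weight (k > 0) * b (k - sgn k) + weight (\<not> k > 0) * (\<iota> * c (k - sgn k))"
    "c k = (weight (k > 0) + weight (\<not> k > 0) * \<delta>) * c (k - sgn k)" if "k \<noteq> 0" for k
    using half_twist.band_bracket_next_step[OF ht[OF that]] half_twist.band_bracket_detached_step[OF ht[OF that]]
    by (simp_all add: b_def c_def \<iota>_def)
  from twist_recursion[of b \<iota> c "n i", OF this]
  have bk: "b (n i) = \<A> powi n i * (b 0 + cut_weight (n i) * (\<iota> * c 0))" by blast
  \<comment> \<open>The cut was made at the tail, so this is where the cap is.\<close>
  interpret retraction \<gamma> E "n(i := 0)" i True
    by unfold_locales (use assms in auto)
  have "c 0 = (if incident (E - {i}) (head i) = {} then \<delta> else 1) * bracket (band_diagram \<gamma> (E - {i}) (n(i := 0)))"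
    using band_bracket_retract by (simp add: c_def v_def w_def band_bracket_next)
  moreover have "band_diagram \<gamma> (E - {i}) (n(i := 0)) = band_diagram \<gamma> (E - {i}) n"
    by (rule band_diagram_cong) auto
  ultimately have c0: "\<delta> ^ card (isolated E) * (\<iota> * c 0) = disk_bracket \<gamma> n (E - {i})"
    unfolding disk_bracket_def card_isolated_Diff[OF E(2,1)] \<iota>_def by simp
  have "disk_bracket \<gamma> n E = \<delta> ^ card (isolated E) * (\<A> powi n i * (b 0 + cut_weight (n i) * (\<iota> * c 0)))"
    using bk by (simp add: disk_bracket_def b_def band_bracket_next)
  also have "\<dots> = \<A> powi n i * (\<delta> ^ card (isolated E) * b 0 + cut_weight (n i) * (\<delta> ^ card (isolated E) * (\<iota> * c 0)))"
    by (simp only: distrib_left mult.left_commute)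
  finally show ?thesis unfolding c0 by (simp add: disk_bracket_def b_def band_bracket_next)
qed

text \<open>The factor \<delta> is the disk laid bare at \<open>u\<close>. A second disk laid bare
  at the other end is balanced by the circle that the retracted band leaves there.\<close>

theorem disk_bracket_pendant:
  assumes reg: "regular_projection \<gamma>" and E: "E \<subseteq> {1..6}" and u: "incident E u = {i}" and n: "n i = 0"
  shows "\<delta> * disk_bracket \<gamma> n E = disk_bracket \<gamma> n (E - {i})"
proof -
  have "i \<in> incident E u" using u by simp
  then have i: "i \<in> E" "u = tail i \<or> u = head i" by (auto simp: incident_def)
  interpret retraction \<gamma> E n i "u = tail i"
    by unfold_locales (use assms i in auto)
  have v: "v = u" using i(2) by (auto simp: v_def)
  have "bracket (band_diagram \<gamma> E n) = (if incident (E - {i}) w = {} then \<delta> else 1) * bracket (band_diagram \<gamma> (E - {i}) n)"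
    using band_bracket_retract unfolding v detached_pendant[OF u] band_bracket_next by simp
  moreover have "incident (E - {i}) u = {}" using u by (simp add: incident_Diff)
  ultimately show ?thesis
    unfolding disk_bracket_def card_isolated_Diff[OF i(1) E] using i(2) by (auto simp: w_def split: if_splits)
qed

text \<open>Four bare disks; the empty code itself has no circle, so its bracket is
  \<open>\<delta> powi (-1)\<close>.\<close>

lemma disk_bracket_empty: "disk_bracket \<gamma> n {} = \<delta> ^ 3"
proof -
  have "bracket (band_diagram \<gamma> {} n) = \<delta> powi (-1)"
    by (simp add: bracket_def state_circles_def band_diagram_def sub_crossings_def components_def)
  moreover have "isolated {} = {0..3}" by (auto simp: isolated_def incident_def)
  ultimately show ?thesis using delta_nonzero by (simp add: disk_bracket_def power_int_minus eval_nat_numeral)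
qed

text \<open>\<open>F\<close> holds the bands resolved so far and makes an induction possible;
  \<open>G\<close> holds those among them that are cut.\<close>

theorem disk_bracket_state_sum:
  assumes reg: "regular_projection \<gamma>" and F: "F \<subseteq> {1..6}"
  shows "disk_bracket \<gamma> n {1..6} = (\<Prod>i\<in>F. \<A> powi n i) *
    (\<Sum>G\<in>Pow F. (\<Prod>i\<in>G. cut_weight (n i)) * disk_bracket \<gamma> (\<lambda>i. if i \<in> F then 0 else n i) ({1..6} - G))"
proof -
  have "finite F" using F by (rule finite_subset) simp
  then show ?thesis using F
  proof (induction F)
    case (insert i F)
    let ?n = "\<lambda>j. if j \<in> F then 0 else n j" and ?m = "\<lambda>j. if j \<in> insert i F then 0 else n j"
    let ?z = "\<lambda>G. \<Prod>j\<in>G. cut_weight (n j)"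
    have s: "disk_bracket \<gamma> ?n ({1..6} - G) = \<A> powi n i *
        (disk_bracket \<gamma> ?m ({1..6} - G) + cut_weight (n i) * disk_bracket \<gamma> ?m ({1..6} - insert i G))" if "G \<in> Pow F" for G
    proof -
      have "disk_bracket \<gamma> ?n ({1..6} - G - {i}) = disk_bracket \<gamma> ?m ({1..6} - insert i G)"
        by (subst Diff_insert[symmetric], rule disk_bracket_cong) auto
      moreover have "?n(i := 0) = ?m" by auto
      moreover have "i \<in> {1..6} - G" using insert that by auto
      ultimately show ?thesis using disk_bracket_twist[OF reg, of "{1..6} - G" i ?n] insert(2) by simp
    qed
    have z: "?z (insert i G) = cut_weight (n i) * ?z G" if "G \<in> Pow F" for G
      using that insert(1,2) by (subst prod.insert) (auto intro: finite_subset)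
    let ?d = "\<lambda>G. disk_bracket \<gamma> ?m ({1..6} - G)"
    have "(\<Sum>G\<in>Pow (insert i F). ?z G * ?d G) = (\<Sum>G\<in>Pow F. ?z G * ?d G) + (\<Sum>G\<in>insert i ` Pow F. ?z G * ?d G)"
      unfolding Pow_insert using insert(1,2) by (intro sum.union_disjoint) auto
    also have "(\<Sum>G\<in>insert i ` Pow F. ?z G * ?d G) = (\<Sum>G\<in>Pow F. ?z (insert i G) * ?d (insert i G))"
      using insert(2) by (subst sum.reindex) (auto simp: inj_on_def)
    also have "\<dots> = (\<Sum>G\<in>Pow F. ?z G * (cut_weight (n i) * ?d (insert i G)))"
      by (intro sum.cong refl) (simp only: z mult_ac)
    finally have "\<A> powi n i * (\<Sum>G\<in>Pow (insert i F). ?z G * ?d G) =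
        (\<Sum>G\<in>Pow F. ?z G * (\<A> powi n i * (?d G + cut_weight (n i) * ?d (insert i G))))"
      by (simp only: sum.distrib[symmetric] sum_distrib_left distrib_left mult_ac)
    also have "\<dots> = (\<Sum>G\<in>Pow F. ?z G * disk_bracket \<gamma> ?n ({1..6} - G))"
      by (intro sum.cong refl) (simp only: s)
    finally show ?case using insert by (simp add: mult.assoc mult.left_commute)
  qed simp
qed

lemma disk_bracket_flat_sum:
  assumes "regular_projection \<gamma>"
  shows "bracket (twisted_bands \<gamma> n) = \<A> powi (\<Sum>i=1..6. n i) *
    (\<Sum>G\<in>Pow {1..6}. (\<Prod>i\<in>G. cut_weight (n i)) * disk_bracket \<gamma> (\<lambda>_. 0) ({1..6} - G))"
proof -
  have "isolated {1..6} = {}" using other_edge by (force simp: isolated_def)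
  then have "disk_bracket \<gamma> n {1..6} = bracket (twisted_bands \<gamma> n)" by (simp add: disk_bracket_def)
  moreover have "disk_bracket \<gamma> (\<lambda>i. if i \<in> {1..6} then 0 else n i) ({1..6} - G) = disk_bracket \<gamma> (\<lambda>_. 0) ({1..6} - G)" for G
    by (rule disk_bracket_cong) auto
  moreover have "(\<Prod>i\<in>F. \<A> powi n i) = \<A> powi (\<Sum>i\<in>F. n i)" if "finite F" for F
    using that by (induction F) (simp_all add: power_int_add A_nonzero)
  ultimately show ?thesis using disk_bracket_state_sum[OF assms subset_refl, of n] by simp
qed

section \<open>The subgraphs of the complete graph on four vertices\<close>

lemma incident_vertices:
  assumes "E \<subseteq> {1..6}"
  shows "incident E 0 = E \<inter> {1, 2, 3}" "incident E 1 = E \<inter> {1, 5, 6}"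
    "incident E 2 = E \<inter> {2, 4, 6}" "incident E 3 = E \<inter> {3, 4, 5}"
proof -
  have "i = 1 \<or> i = 2 \<or> i = 3 \<or> i = 4 \<or> i = 5 \<or> i = 6" if "i \<in> E" for i using that assms by auto
  then show "incident E 0 = E \<inter> {1, 2, 3}" "incident E 1 = E \<inter> {1, 5, 6}"
    "incident E 2 = E \<inter> {2, 4, 6}" "incident E 3 = E \<inter> {3, 4, 5}"
    by (fastforce simp: incident_def tail_def head_def split: if_splits)+
qed

text \<open>All cycles of the graph, four triangles and three quadrilaterals, so that
  \<open>forest\<close> has its usual meaning.\<close>

definition cycles :: "nat set set" where
  "cycles = {{1, 2, 6}, {2, 3, 4}, {1, 3, 5}, {4, 5, 6}, {1, 2, 4, 5}, {1, 3, 4, 6}, {2, 3, 5, 6}}"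

definition forest :: "nat set \<Rightarrow> bool" where
  "forest E \<longleftrightarrow> (\<forall>C\<in>cycles. \<not> C \<subseteq> E)"

text \<open>A finite check over all sets of edges, by the edges present at each vertex.\<close>

lemma forest_leaf:
  assumes "E \<subseteq> {1..6}" "E \<noteq> {}" "forest E"
  obtains u i where "incident E u = {i}"
proof -
  have i: "i = 1 \<or> i = 2 \<or> i = 3 \<or> i = 4 \<or> i = 5 \<or> i = 6" if "i \<in> E" for i using that assms(1) by auto
  then have "1 \<in> E \<or> 2 \<in> E \<or> 3 \<in> E \<or> 4 \<in> E \<or> 5 \<in> E \<or> 6 \<in> E" using assms(2) by blast
  then have "(\<exists>i. E \<inter> {1, 2, 3} = {i}) \<or> (\<exists>i. E \<inter> {1, 5, 6} = {i}) \<or> (\<exists>i. E \<inter> {2, 4, 6} = {i}) \<or> (\<exists>i. E \<inter> {3, 4, 5} = {i})"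
    using assms(3) unfolding forest_def cycles_def
    by (cases "1 \<in> E"; cases "2 \<in> E"; cases "3 \<in> E"; cases "4 \<in> E"; cases "5 \<in> E"; cases "6 \<in> E"; simp)
  then show thesis using that incident_vertices[OF assms(1)] by metis
qed

text \<open>A forest on four vertices has \<open>4 - card E\<close> components, each of which
  retracts to a disk and contributes one circle. The quotient avoids a truncated subtraction in the
  exponent.\<close>

lemma disk_bracket_forest:
  assumes "regular_projection \<gamma>" "E \<subseteq> {1..6}" "forest E"
  shows "disk_bracket \<gamma> (\<lambda>_. 0) E = \<delta> ^ 3 / \<delta> ^ card E"
proof -
  have "finite E" using assms(2) by (rule finite_subset) simp
  then show ?thesis using assms(2,3)
  proof (induction E rule: finite_remove_induct)
    case empty
    then show ?case by (simp add: disk_bracket_empty)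
  next
    case (remove E)
    obtain u i where u: "incident E u = {i}" using forest_leaf[OF remove(5,2,6)] by blast
    then have i: "i \<in> E" by (auto simp: incident_def)
    have "forest (E - {i})" using remove(6) unfolding forest_def by blast
    then have "disk_bracket \<gamma> (\<lambda>_. 0) (E - {i}) = \<delta> ^ 3 / \<delta> ^ card (E - {i})" using remove i by blast
    moreover have "\<delta> * disk_bracket \<gamma> (\<lambda>_. 0) E = disk_bracket \<gamma> (\<lambda>_. 0) (E - {i})"
      by (rule disk_bracket_pendant[OF assms(1) remove(5) u refl])
    moreover have "\<delta> ^ card E = \<delta> * \<delta> ^ card (E - {i})" using card.remove[OF remove(1) i] by simp
    moreover have "disk_bracket \<gamma> (\<lambda>_. 0) E = \<delta> * disk_bracket \<gamma> (\<lambda>_. 0) E / \<delta>"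
      by (rule nonzero_mult_div_cancel_left[OF delta_nonzero, symmetric])
    ultimately show ?case by (simp only: divide_divide_eq_left mult.commute)
  qed
qed

lemma isolated_eq:
  assumes "E \<subseteq> {1..6}"
  shows "isolated E = (if E \<inter> {1, 2, 3} = {} then {0} else {}) \<union> (if E \<inter> {1, 5, 6} = {} then {1} else {}) \<union>
    (if E \<inter> {2, 4, 6} = {} then {2} else {}) \<union> (if E \<inter> {3, 4, 5} = {} then {3} else {})"
proof -
  have "{v\<in>{0..3}. P v} = (if P 0 then {0} else {}) \<union> (if P 1 then {1} else {}) \<union>
      (if P 2 then {2} else {}) \<union> (if P 3 then {3} else {})" for P :: "nat \<Rightarrow> bool"
  proof -
    have "{0..3} = {0, 1, 2, 3 :: nat}" by auto
    then show ?thesis by auto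
  qed
  then show ?thesis unfolding isolated_def incident_vertices[OF assms, symmetric] .
qed

text \<open>Six applications turn the sum over the 64 sets of cut bands into explicit terms.\<close>

lemma sum_Pow_insert:
  assumes "finite A" "a \<notin> A"
  shows "sum f (Pow (insert a A)) = sum f (Pow A) + (\<Sum>G\<in>Pow A. f (insert a G))"
proof -
  have "sum f (Pow (insert a A)) = sum f (Pow A) + sum f (insert a ` Pow A)"
    unfolding Pow_insert using assms by (intro sum.union_disjoint) auto
  also have "sum f (insert a ` Pow A) = (\<Sum>G\<in>Pow A. f (insert a G))"
    using assms(2) by (subst sum.reindex) (auto simp: inj_on_def)
  finally show ?thesis .
qed

text \<open>The part of the state sum in which no cycle survives; the cubic terms are the complements of the 16
  spanning trees.\<close>

definition point_coefficient :: "(nat \<Rightarrow> int poly fract) \<Rightarrow> int poly fract" where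
  "point_coefficient z = (z 1 * z 2 * z 4 + z 1 * z 2 * z 5 + z 1 * z 2 * z 6 + z 1 * z 3 * z 4 + z 1 * z 3 * z 5 + z 1 * z 3 * z 6 + z 1 * z 4 * z 5 + z 1 * z 4 * z 6 + z 2 * z 3 * z 4 + z 2 * z 3 * z 5 + z 2 * z 3 * z 6 + z 2 * z 4 * z 5 + z 2 * z 5 * z 6 + z 3 * z 4 * z 6 + z 3 * z 5 * z 6 + z 4 * z 5 * z 6)
      - \<phi>A * (z 1 * z 2 * z 3 * z 4 + z 1 * z 2 * z 3 * z 5 + z 1 * z 2 * z 3 * z 6 + z 1 * z 2 * z 4 * z 5 + z 1 * z 2 * z 4 * z 6 + z 1 * z 2 * z 5 * z 6 + z 1 * z 3 * z 4 * z 5 + z 1 * z 3 * z 4 * z 6 + z 1 * z 3 * z 5 * z 6 + z 1 * z 4 * z 5 * z 6 + z 2 * z 3 * z 4 * z 5 + z 2 * z 3 * z 4 * z 6 + z 2 * z 3 * z 5 * z 6 + z 2 * z 4 * z 5 * z 6 + z 3 * z 4 * z 5 * z 6)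
      + \<phi>A\<^sup>2 * (z 1 * z 2 * z 3 * z 4 * z 5 + z 1 * z 2 * z 3 * z 4 * z 6 + z 1 * z 2 * z 3 * z 5 * z 6 + z 1 * z 2 * z 4 * z 5 * z 6 + z 1 * z 3 * z 4 * z 5 * z 6 + z 2 * z 3 * z 4 * z 5 * z 6)
      - \<phi>A ^ 3 * (z 1 * z 2 * z 3 * z 4 * z 5 * z 6)"

text \<open>The 64 sets of uncut bands are: the whole graph; 6 \<Theta>-graphs; with four edges, 3
  quadrilaterals and 12 triangles with a pendant edge; with three edges, 4 triangles and 16 spanning
  trees; and 22 smaller forests. The coefficient of a triangle collects the three ways of adding a
  pendant edge, which retracts, and the triangle alone, whose factor -\<phi> is the disk at the
  vertex it misses.\<close>

lemma flat_state_sum: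
  fixes z :: "nat \<Rightarrow> int poly fract"
  assumes reg: "regular_projection \<gamma>"
  shows "(\<Sum>G\<in>Pow {1..6}. (\<Prod>i\<in>G. z i) * disk_bracket \<gamma> (\<lambda>_. 0) ({1..6} - G)) =
    bracket (flat_bands \<gamma> {1..6}) + (\<Sum>i=1..6. z i * bracket (flat_bands \<gamma> ({1..6} - {i})))
      + (bracket (flat_bands \<gamma> {1, 2, 6}) * (z 3 * z 4 + z 3 * z 5 + z 4 * z 5 - \<phi>A * z 3 * z 4 * z 5)
      + bracket (flat_bands \<gamma> {2, 3, 4}) * (z 1 * z 5 + z 1 * z 6 + z 5 * z 6 - \<phi>A * z 1 * z 5 * z 6)
      + bracket (flat_bands \<gamma> {1, 3, 5}) * (z 2 * z 4 + z 2 * z 6 + z 4 * z 6 - \<phi>A * z 2 * z 4 * z 6)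
      + bracket (flat_bands \<gamma> {4, 5, 6}) * (z 1 * z 2 + z 1 * z 3 + z 2 * z 3 - \<phi>A * z 1 * z 2 * z 3)
      + bracket (flat_bands \<gamma> {1, 2, 4, 5}) * (z 3 * z 6)
      + bracket (flat_bands \<gamma> {1, 3, 4, 6}) * (z 2 * z 5)
      + bracket (flat_bands \<gamma> {2, 3, 5, 6}) * (z 1 * z 4))
      + point_coefficient z"
proof -
  note [simp del] = One_nat_def
  let ?V = "disk_bracket \<gamma> (\<lambda>_. 0)" and ?B = "\<lambda>E. bracket (flat_bands \<gamma> E)"
  have E0: "{1..6} = {1, 2, 3, 4, 5, 6 :: nat}" by auto
  have sub: "E \<subseteq> {1..6}" if "E \<subseteq> {1, 2, 3, 4, 5, 6}" for E :: "nat set" using that E0 by simp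
  have iso: "?V E = (- \<phi>A) ^ card ((if E \<inter> {1, 2, 3} = {} then {0} else {}) \<union> (if E \<inter> {1, 5, 6} = {} then {1} else {}) \<union>
    (if E \<inter> {2, 4, 6} = {} then {2} else {}) \<union> (if E \<inter> {3, 4, 5} = {} then {3 :: nat} else {})) * ?B E"
    if "E \<subseteq> {1, 2, 3, 4, 5, 6}" for E
    unfolding disk_bracket_def isolated_eq[OF sub[OF that]] \<phi>A(1) ..
  \<comment> \<open>Each of these graphs covers all four vertices, so no disk is added.\<close>
  have core: "?V {1, 2, 3, 4, 5, 6} = ?B {1, 2, 3, 4, 5, 6}"
    "?V {2, 3, 4, 5, 6} = ?B {2, 3, 4, 5, 6}"
    "?V {1, 3, 4, 5, 6} = ?B {1, 3, 4, 5, 6}"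
    "?V {1, 2, 4, 5, 6} = ?B {1, 2, 4, 5, 6}"
    "?V {1, 2, 3, 5, 6} = ?B {1, 2, 3, 5, 6}"
    "?V {1, 2, 3, 4, 6} = ?B {1, 2, 3, 4, 6}"
    "?V {1, 2, 3, 4, 5} = ?B {1, 2, 3, 4, 5}"
    "?V {1, 2, 4, 5} = ?B {1, 2, 4, 5}"
    "?V {1, 3, 4, 6} = ?B {1, 3, 4, 6}"
    "?V {2, 3, 5, 6} = ?B {2, 3, 5, 6}"
    by (subst iso; simp)+
  \<comment> \<open>A triangle misses exactly one vertex.\<close>
  have tri: "?V {1, 2, 6} = - \<phi>A * ?B {1, 2, 6}"
    "?V {2, 3, 4} = - \<phi>A * ?B {2, 3, 4}"
    "?V {1, 3, 5} = - \<phi>A * ?B {1, 3, 5}"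
    "?V {4, 5, 6} = - \<phi>A * ?B {4, 5, 6}"
    by (subst iso; simp)+
  have pendant: "- \<phi>A * ?V E = ?V (E - {i})" if "E \<subseteq> {1, 2, 3, 4, 5, 6}" "incident E u = {i}" for E u i
    using disk_bracket_pendant[OF reg sub[OF that(1)] that(2)] unfolding \<phi>A(1) by simp
  note inc = incident_vertices[OF sub]
  \<comment> \<open>The powers of \<delta> = -\<phi> with exponent
    \<open>3 - card E\<close>.\<close>
  have trees: "?V E = (if card E = 0 then - (\<phi>A ^ 3) else if card E = 1 then \<phi>A\<^sup>2 else if card E = 2 then - \<phi>A else 1)"
    if "E \<subseteq> {1, 2, 3, 4, 5, 6}" "forest E" "card E \<le> 3" for E
  proof -
    consider "card E = 0" | "card E = 1" | "card E = 2" | "card E = 3" using \<open>card E \<le> 3\<close> by linarith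
    then show ?thesis
      using disk_bracket_forest[OF reg sub[OF that(1)] that(2)] \<phi>A(2) unfolding \<phi>A(1)
      by cases (simp_all add: power3_eq_cube power2_eq_square)
  qed
  \<comment> \<open>Retracting the pendant edge lays bare the vertex that the triangle misses, and
    the two factors -\<phi> cancel.\<close>
  have leaf: "?V E = b" if "E \<subseteq> {1, 2, 3, 4, 5, 6}" "incident E u = {i}" "E - {i} = C" "?V C = - \<phi>A * b" for E C u i b
  proof -
    have "- \<phi>A * ?V E = - \<phi>A * b" using pendant[OF that(1,2)] that(3,4) by simp
    then show ?thesis using \<phi>A(2) by simp
  qed
  have unicyclic:
    "?V {1, 2, 3, 6} = ?B {1, 2, 6}"
    "?V {1, 2, 4, 6} = ?B {1, 2, 6}"
    "?V {1, 2, 5, 6} = ?B {1, 2, 6}"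
    "?V {1, 2, 3, 4} = ?B {2, 3, 4}"
    "?V {2, 3, 4, 5} = ?B {2, 3, 4}"
    "?V {2, 3, 4, 6} = ?B {2, 3, 4}"
    "?V {1, 2, 3, 5} = ?B {1, 3, 5}"
    "?V {1, 3, 4, 5} = ?B {1, 3, 5}"
    "?V {1, 3, 5, 6} = ?B {1, 3, 5}"
    "?V {1, 4, 5, 6} = ?B {4, 5, 6}"
    "?V {2, 4, 5, 6} = ?B {4, 5, 6}"
    "?V {3, 4, 5, 6} = ?B {4, 5, 6}"
    subgoal by (rule leaf[OF _ _ _ tri(1), of _ 3 3]) (simp_all add: inc insert_Diff_if)
    subgoal by (rule leaf[OF _ _ _ tri(1), of _ 3 4]) (simp_all add: inc insert_Diff_if)
    subgoal by (rule leaf[OF _ _ _ tri(1), of _ 3 5]) (simp_all add: inc insert_Diff_if)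
    subgoal by (rule leaf[OF _ _ _ tri(2), of _ 1 1]) (simp_all add: inc insert_Diff_if)
    subgoal by (rule leaf[OF _ _ _ tri(2), of _ 1 5]) (simp_all add: inc insert_Diff_if)
    subgoal by (rule leaf[OF _ _ _ tri(2), of _ 1 6]) (simp_all add: inc insert_Diff_if)
    subgoal by (rule leaf[OF _ _ _ tri(3), of _ 2 2]) (simp_all add: inc insert_Diff_if)
    subgoal by (rule leaf[OF _ _ _ tri(3), of _ 2 4]) (simp_all add: inc insert_Diff_if)
    subgoal by (rule leaf[OF _ _ _ tri(3), of _ 2 6]) (simp_all add: inc insert_Diff_if)
    subgoal by (rule leaf[OF _ _ _ tri(4), of _ 0 1]) (simp_all add: inc insert_Diff_if)
    subgoal by (rule leaf[OF _ _ _ tri(4), of _ 0 2]) (simp_all add: inc insert_Diff_if)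
    subgoal by (rule leaf[OF _ _ _ tri(4), of _ 0 3]) (simp_all add: inc insert_Diff_if)
    done
  show ?thesis
    unfolding E0
    by (simp add: sum_Pow_insert core tri unicyclic trees insert_Diff_if forest_def cycles_def point_coefficient_def algebra_simps)
qed

theorem mainTheorem4:
  fixes \<gamma> :: "nat \<Rightarrow> real \<Rightarrow> complex \<times> real"
    and n :: "nat \<Rightarrow> int"
    and ori :: "(band_arc \<times> band_arc) set"
    and \<phi> :: "int poly fract"
    and y :: "nat \<Rightarrow> int poly fract"
  assumes "K4_diagram \<gamma>"
    and "n = twist_parameter \<gamma>"
    and "boundary_orientation \<gamma> n ori"
    and "\<phi> = \<A>\<^sup>2 + \<A> powi (-2)"
    and "y = (\<lambda>i. (- (\<A> powi (-4))) powi n i)"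
  shows "jones (twisted_bands \<gamma> n) ori =
    (- (\<A> ^ 4)) powi (\<Sum>i=1..6. n i) *
    (bracket (flat_bands \<gamma> {1..6})
     + (\<Sum>i=1..6. (1 - y i) / \<phi> * bracket (flat_bands \<gamma> ({1..6} - {i})))
     + 1 / \<phi>\<^sup>2 *
       (bracket (flat_bands \<gamma> {1, 2, 6}) * (2 - y 3 - y 4 - y 5 + y 3 * y 4 * y 5)
      + bracket (flat_bands \<gamma> {2, 3, 4}) * (2 - y 1 - y 5 - y 6 + y 1 * y 5 * y 6)
      + bracket (flat_bands \<gamma> {1, 3, 5}) * (2 - y 2 - y 4 - y 6 + y 2 * y 4 * y 6)
      + bracket (flat_bands \<gamma> {4, 5, 6}) * (2 - y 1 - y 2 - y 3 + y 1 * y 2 * y 3)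
      + bracket (flat_bands \<gamma> {1, 2, 4, 5}) * (1 - y 3 - y 6 + y 3 * y 6)
      + bracket (flat_bands \<gamma> {1, 3, 4, 6}) * (1 - y 2 - y 5 + y 2 * y 5)
      + bracket (flat_bands \<gamma> {2, 3, 5, 6}) * (1 - y 1 - y 4 + y 1 * y 4))
     + 1 / \<phi> ^ 3 *
       (6 - 2 * (\<Sum>i=1..6. y i) + (\<Sum>i=1..3. y i * y (i + 3))
        + y 3 * y 4 * y 5 + y 2 * y 4 * y 6 + y 1 * y 5 * y 6 + y 1 * y 2 * y 3
        - y 1 * y 2 * y 3 * y 4 * y 5 * y 6))"
proof -
  have reg: "regular_projection \<gamma>" using assms(1) by (simp add: K4_diagram_def)
  interpret oriented_bands \<gamma> n ori by unfold_locales (use reg assms(3) in auto)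
  define z where "z i = cut_weight (n i)" for i
  have \<phi>: "\<phi> = \<phi>A" "\<phi> \<noteq> 0" using assms(4) \<phi>A(2) by (simp_all add: \<phi>A_def)
  have z: "(1 - y i) / \<phi> = z i" for i by (simp add: z_def cut_weight_def \<phi>(1) assms(5))
  \<comment> \<open>In terms of \<open>z\<close> the low-order terms of each coefficient cancel,
    which sets free exactly the power of \<phi> in its denominator.\<close>
  have y: "y i = 1 - \<phi> * z i" for i using z[of i] \<phi>(2) by (simp add: field_simps)
  have triangle: "2 - y a - y b - y c + y a * y b * y c =
      \<phi>\<^sup>2 * (z a * z b + z a * z c + z b * z c - \<phi> * z a * z b * z c)" for a b c
    unfolding y by (simp add: algebra_simps power2_eq_square)
  have square: "1 - y a - y b + y a * y b = \<phi>\<^sup>2 * (z a * z b)" for a b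
    unfolding y by (simp add: algebra_simps power2_eq_square)
  have point: "6 - 2 * (\<Sum>i=1..6. y i) + (\<Sum>i=1..3. y i * y (i + 3))
      + y 3 * y 4 * y 5 + y 2 * y 4 * y 6 + y 1 * y 5 * y 6 + y 1 * y 2 * y 3
      - y 1 * y 2 * y 3 * y 4 * y 5 * y 6 = \<phi> ^ 3 * point_coefficient z"
  proof -
    have "{1..6} = {1, 2, 3, 4, 5, 6 :: nat}" "{1..3} = {1, 2, 3 :: nat}" by auto
    then show ?thesis unfolding y point_coefficient_def \<phi>(1)[symmetric]
      by (simp add: algebra_simps power2_eq_square power3_eq_cube del: One_nat_def)
  qed
  \<comment> \<open>Stated for arbitrary terms, so that the brackets and coefficients stay closed
    while the powers of \<phi> cancel.\<close>
  have cancel: "1 / \<phi>\<^sup>2 * (b1 * (\<phi>\<^sup>2 * t1) + b2 * (\<phi>\<^sup>2 * t2) + b3 * (\<phi>\<^sup>2 * t3) + b4 * (\<phi>\<^sup>2 * t4)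
      + b5 * (\<phi>\<^sup>2 * t5) + b6 * (\<phi>\<^sup>2 * t6) + b7 * (\<phi>\<^sup>2 * t7)) =
      b1 * t1 + b2 * t2 + b3 * t3 + b4 * t4 + b5 * t5 + b6 * t6 + b7 * t7"
    "1 / \<phi> ^ 3 * (\<phi> ^ 3 * t) = t" for b1 b2 b3 b4 b5 b6 b7 t1 t2 t3 t4 t5 t6 t7 t
  proof -
    have "1 / \<phi>\<^sup>2 * (b * (\<phi>\<^sup>2 * t)) = b * t" for b t using \<phi>(2) by simp
    then show "1 / \<phi>\<^sup>2 * (b1 * (\<phi>\<^sup>2 * t1) + b2 * (\<phi>\<^sup>2 * t2) + b3 * (\<phi>\<^sup>2 * t3) + b4 * (\<phi>\<^sup>2 * t4)
      + b5 * (\<phi>\<^sup>2 * t5) + b6 * (\<phi>\<^sup>2 * t6) + b7 * (\<phi>\<^sup>2 * t7)) =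
      b1 * t1 + b2 * t2 + b3 * t3 + b4 * t4 + b5 * t5 + b6 * t6 + b7 * t7"
      by (simp only: distrib_left)
    show "1 / \<phi> ^ 3 * (\<phi> ^ 3 * t) = t" using \<phi>(2) by simp
  qed
  let ?N = "\<Sum>i=1..6. n i"
  have "jones (twisted_bands \<gamma> n) ori = ((- (\<A> ^ 3)) powi ?N * \<A> powi ?N) *
      (\<Sum>G\<in>Pow {1..6}. (\<Prod>i\<in>G. z i) * disk_bracket \<gamma> (\<lambda>_. 0) ({1..6} - G))"
    unfolding jones_def writhe_bands disk_bracket_flat_sum[OF reg] z_def by (simp only: minus_minus mult.assoc)
  \<comment> \<open>The writhe is \<open>- ?N\<close>, hence the positive exponent; the second
    factor comes from the uncut twists.\<close>
  also have "(- (\<A> ^ 3)) powi ?N * \<A> powi ?N = (- (\<A> ^ 4)) powi ?N"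
  proof -
    have "- (\<A> ^ 3) * \<A> = - (\<A> ^ 4)" by (simp add: eval_nat_numeral mult.assoc)
    then show ?thesis by (simp only: power_int_mult_distrib[symmetric])
  qed
  finally show ?thesis
    unfolding flat_state_sum[OF reg] z triangle square point cancel unfolding \<phi>(1) .
qed

end
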